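(* Let $2\le p<\infty$, let $\Omega$ be a bounded symmetric domain in $\mathbf{C}^n$ (in its standard representation), and let $\lambda<\varepsilon_\Omega$. Let $\varphi:\Omega\to\mathbf{C}^n$ and $\psi:\Omega\to\mathbf{C}$ be holomorphic with $\varphi(\Omega)\subseteq\Omega$, and let $W_{\varphi,\psi}$ be the weighted composition operator on $A^2_\lambda(\Omega,dV_\lambda)$. If $W_{\varphi,\psi}\in S_p$, then $$\int_\Omega|\psi(z)|^p\left[\frac{K(\varphi(z),\varphi(z))}{K(z,z)}\right]^{\frac{p(1-\lambda)}{2}}d\sigma(z)<\infty,$$ where $d\sigma(z)=K(z,z)\,dV(z)$.
   Context: $\Omega$ is a bounded symmetric domain in $\mathbf{C}^n$ in its standard (Harish-Chandra, i.e. circular and centred at $0$) representation, with volume measure $dV$ normalized so that $V(\Omega)=1$; $K(z,\omega)$ is its Bergman kernel with respect to $dV$, so that $K(z,0)=K(0,\omega)=1$ for all $z,\omega\in\Omega$. $\varepsilon_\Omega>0$ is a number such that $C_\lambda=\int_\Omega K(z,z)^\lambda\,dV(z)<\infty$ for every real $\lambda<\varepsilon_\Omega$. For such $\lambda$, $dV_\lambda(z)=C_\lambda^{-1}K(z,z)^\lambda\,dV(z)$ is a probability measure. $A^2_\lambda(\Omega,dV_\lambda)$ is the weighted Bergman space (a Hilbert space) of holomorphic functions $f$ on $\Omega$ with $\|f\|_{A^2_\lambda}=\left(\int_\Omega|f|^2\,dV_\lambda\right)^{1/2}<\infty$. Its reproducing kernel is $K(z,\omega)^{1-\lambda}$. The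 weighted composition operator is $W_{\varphi,\psi}f(z)=\psi(z)f(\varphi(z))$, $z\in\Omega$, for $f$ holomorphic on $\Omega$. A compact operator $T$ on $A^2_\lambda(\Omega,dV_\lambda)$ belongs to the Schatten class $S_p$ if $(T^*T)^{p/2}$ is in the trace class. *)

theory Defs
  imports "HOL-Analysis.Analysis"
begin

section \<open>Holomorphy and bounded symmetric domains in \<open>\<complex>\<^sup>n\<close>\<close>

text \<open>
  \<open>\<complex>\<^sup>n\<close> is \<^typ>\<open>complex ^ 'n\<close>; complex scalar multiplication on it is \<open>*s\<close>. Only open sets
  are used below, so the (real) Frechet derivative is taken unrestricted, and holomorphy is its
  complex linearity.
\<close>

definition holomorphic_fun :: "(complex ^ 'n) set \<Rightarrow> (complex ^ 'n \<Rightarrow> complex) \<Rightarrow> bool" where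
  "holomorphic_fun \<Omega> f \<longleftrightarrow>
     (\<forall>z\<in>\<Omega>. \<exists>D. (f has_derivative D) (at z) \<and> (\<forall>c v. D (c *s v) = c * D v))"

definition holomorphic_map :: "(complex ^ 'n) set \<Rightarrow> (complex ^ 'n \<Rightarrow> complex ^ 'm) \<Rightarrow> bool" where
  "holomorphic_map \<Omega> F \<longleftrightarrow> (\<forall>i. holomorphic_fun \<Omega> (\<lambda>z. F z $ i))"

text \<open>An involutive holomorphic self-map is its own inverse, hence an automorphism of \<open>\<Omega>\<close>.\<close>

definition symmetry_at :: "(complex ^ 'n) set \<Rightarrow> complex ^ 'n \<Rightarrow> (complex ^ 'n \<Rightarrow> complex ^ 'n) \<Rightarrow> bool" where
  "symmetry_at \<Omega> a s \<longleftrightarrow>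
     holomorphic_map \<Omega> s \<and> s ` \<Omega> \<subseteq> \<Omega> \<and> (\<forall>z\<in>\<Omega>. s (s z) = z) \<and>
     s a = a \<and> (\<exists>U. open U \<and> a \<in> U \<and> (\<forall>z\<in>U \<inter> \<Omega>. s z = z \<longrightarrow> z = a))"

definition bounded_symmetric_domain :: "(complex ^ 'n) set \<Rightarrow> bool" where
  "bounded_symmetric_domain \<Omega> \<longleftrightarrow>
     open \<Omega> \<and> connected \<Omega> \<and> \<Omega> \<noteq> {} \<and> bounded \<Omega> \<and> (\<forall>a\<in>\<Omega>. \<exists>s. symmetry_at \<Omega> a s)"

text \<open>The standard (Harish-Chandra) representation: circular and centred at the origin.\<close>

definition standard_representation :: "(complex ^ 'n) set \<Rightarrow> bool" where
  "standard_representation \<Omega> \<longleftrightarrow> 0 \<in> \<Omega> \<and> (\<forall>z\<in>\<Omega>. \<forall>c. norm c = 1 \<longrightarrow> c *s z \<in> \<Omega>)"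


section \<open>Operators on a Hilbert space of functions\<close>

text \<open>
  A Hilbert space is given by its carrier \<open>H\<close>, a set of complex functions closed under the
  pointwise linear operations, and its inner product \<open>ip\<close>, linear in the first argument.
  Operators are compared only on \<open>H\<close>.
\<close>

type_synonym 'a inner_prod = "('a \<Rightarrow> complex) \<Rightarrow> ('a \<Rightarrow> complex) \<Rightarrow> complex"
type_synonym 'a operator = "('a \<Rightarrow> complex) \<Rightarrow> ('a \<Rightarrow> complex)"

definition ip_norm :: "'a inner_prod \<Rightarrow> ('a \<Rightarrow> complex) \<Rightarrow> real" where
  "ip_norm ip f = sqrt (Re (ip f f))"

definition linear_op :: "('a \<Rightarrow> complex) set \<Rightarrow> 'a operator \<Rightarrow> bool" where
  "linear_op H T \<longleftrightarrow> T ` H \<subseteq> H \<and>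
     (\<forall>f\<in>H. \<forall>g\<in>H. T (\<lambda>x. f x + g x) = (\<lambda>x. T f x + T g x)) \<and>
     (\<forall>f\<in>H. \<forall>c. T (\<lambda>x. c * f x) = (\<lambda>x. c * T f x))"

definition bounded_op :: "('a \<Rightarrow> complex) set \<Rightarrow> 'a inner_prod \<Rightarrow> 'a operator \<Rightarrow> bool" where
  "bounded_op H ip T \<longleftrightarrow> linear_op H T \<and> (\<exists>C. \<forall>f\<in>H. ip_norm ip (T f) \<le> C * ip_norm ip f)"

definition compact_op :: "('a \<Rightarrow> complex) set \<Rightarrow> 'a inner_prod \<Rightarrow> 'a operator \<Rightarrow> bool" where
  "compact_op H ip T \<longleftrightarrow> linear_op H T \<and>
     (\<forall>F :: nat \<Rightarrow> 'a \<Rightarrow> complex. (\<exists>C. \<forall>k. F k \<in> H \<and> ip_norm ip (F k) \<le> C) \<longrightarrow>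
        (\<exists>g\<in>H. \<exists>r. strict_mono r \<and> (\<lambda>k. ip_norm ip (\<lambda>x. T (F (r k)) x - g x)) \<longlonglongrightarrow> 0))"

definition is_adjoint :: "('a \<Rightarrow> complex) set \<Rightarrow> 'a inner_prod \<Rightarrow> 'a operator \<Rightarrow> 'a operator \<Rightarrow> bool" where
  "is_adjoint H ip T S \<longleftrightarrow> bounded_op H ip S \<and> (\<forall>f\<in>H. \<forall>g\<in>H. ip (T f) g = ip f (S g))"

definition positive_op :: "('a \<Rightarrow> complex) set \<Rightarrow> 'a inner_prod \<Rightarrow> 'a operator \<Rightarrow> bool" where
  "positive_op H ip A \<longleftrightarrow> bounded_op H ip A \<and> (\<forall>f\<in>H. ip (A f) f \<in> \<real>\<^sub>\<ge>\<^sub>0)"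

definition orthonormal_basis :: "('a \<Rightarrow> complex) set \<Rightarrow> 'a inner_prod \<Rightarrow> ('a \<Rightarrow> complex) set \<Rightarrow> bool" where
  "orthonormal_basis H ip E \<longleftrightarrow> E \<subseteq> H \<and>
     (\<forall>e\<in>E. \<forall>e'\<in>E. ip e e' = (if e = e' then 1 else 0)) \<and>
     (\<forall>f\<in>H. (\<forall>e\<in>E. ip f e = 0) \<longrightarrow> f = (\<lambda>x. 0))"

text \<open>\<open>is_abs H ip B A\<close>: \<open>A = |B| = (B\<^sup>*B)\<^sup>1\<^sup>/\<^sup>2\<close>, the positive square root.\<close>

definition is_abs :: "('a \<Rightarrow> complex) set \<Rightarrow> 'a inner_prod \<Rightarrow> 'a operator \<Rightarrow> 'a operator \<Rightarrow> bool" where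
  "is_abs H ip B A \<longleftrightarrow> positive_op H ip A \<and>
     (\<exists>S. is_adjoint H ip B S \<and> (\<forall>f\<in>H. A (A f) = S (B f)))"

text \<open>The sum of the nonnegative terms does not depend on the orthonormal basis.\<close>

definition trace_class :: "('a \<Rightarrow> complex) set \<Rightarrow> 'a inner_prod \<Rightarrow> 'a operator \<Rightarrow> bool" where
  "trace_class H ip B \<longleftrightarrow> bounded_op H ip B \<and>
     (\<exists>A E. is_abs H ip B A \<and> orthonormal_basis H ip E \<and> (\<lambda>e. ip (A e) e) summable_on E)"

text \<open>
  \<open>is_power H ip A r P\<close>: \<open>P = A\<^sup>r\<close> for a positive compact \<open>A\<close> and \<open>r > 0\<close>. By the spectral
  theorem \<open>A\<close> is diagonalised by an orthonormal basis; \<open>P\<close> is the bounded operator that acts on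
  it through the powers of the eigenvalues (note \<^prop>\<open>0 powr r = (0::real)\<close>).
\<close>

definition is_power ::
  "('a \<Rightarrow> complex) set \<Rightarrow> 'a inner_prod \<Rightarrow> 'a operator \<Rightarrow> real \<Rightarrow> 'a operator \<Rightarrow> bool" where
  "is_power H ip A r P \<longleftrightarrow> bounded_op H ip P \<and>
     (\<exists>E s. orthonormal_basis H ip E \<and>
        (\<forall>e\<in>E. 0 \<le> s e \<and> A e = (\<lambda>x. complex_of_real (s e) * e x)
              \<and> P e = (\<lambda>x. complex_of_real (s e powr r) * e x)))"

definition schatten_class ::
  "('a \<Rightarrow> complex) set \<Rightarrow> 'a inner_prod \<Rightarrow> real \<Rightarrow> 'a operator \<Rightarrow> bool" where
  "schatten_class H ip p T \<longleftrightarrow> compact_op H ip T \<and>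
     (\<exists>S P. is_adjoint H ip T S \<and> is_power H ip (S \<circ> T) (p / 2) P \<and> trace_class H ip P)"


section \<open>Bergman spaces and the Bergman kernel\<close>

text \<open>
  A holomorphic function on \<open>\<Omega>\<close> is represented by its extension by zero, so that functions which
  agree on \<open>\<Omega>\<close> are equal. All measures live on the space \<open>\<Omega>\<close>.
\<close>

definition bergman_space ::
  "(complex ^ 'n) set \<Rightarrow> (complex ^ 'n) measure \<Rightarrow> (complex ^ 'n \<Rightarrow> complex) set" where
  "bergman_space \<Omega> M =
     {f. holomorphic_fun \<Omega> f \<and> (\<forall>z. z \<notin> \<Omega> \<longrightarrow> f z = 0) \<and> integrable M (\<lambda>z. (norm (f z))\<^sup>2)}"

definition L2_inner :: "(complex ^ 'n) measure \<Rightarrow> (complex ^ 'n) inner_prod" where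
  "L2_inner M f g = (LINT z|M. f z * cnj (g z))"

text \<open>\<open>dV\<close>: Lebesgue measure on \<open>\<Omega>\<close>, normalised to total mass 1.\<close>

definition normalized_volume :: "(complex ^ 'n) set \<Rightarrow> (complex ^ 'n) measure" where
  "normalized_volume \<Omega> = uniform_measure (restrict_space lborel \<Omega>) \<Omega>"

text \<open>\<open>K(\<cdot>,\<omega>)\<close> is the element of \<open>A\<^sup>2(\<Omega>,dV)\<close> representing evaluation at \<open>\<omega>\<close>.\<close>

definition bergman_kernel :: "(complex ^ 'n) set \<Rightarrow> complex ^ 'n \<Rightarrow> complex ^ 'n \<Rightarrow> complex" where
  "bergman_kernel \<Omega> z \<omega> =
     (THE k. k \<in> bergman_space \<Omega> (normalized_volume \<Omega>) \<and>
        (\<forall>f\<in>bergman_space \<Omega> (normalized_volume \<Omega>). f \<omega> = L2_inner (normalized_volume \<Omega>) f k)) z"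

text \<open>\<open>K(z,z)\<close> is real and positive on \<open>\<Omega>\<close>.\<close>

definition bergman_diag :: "(complex ^ 'n) set \<Rightarrow> complex ^ 'n \<Rightarrow> real" where
  "bergman_diag \<Omega> z = Re (bergman_kernel \<Omega> z z)"

definition weighted_volume :: "(complex ^ 'n) set \<Rightarrow> real \<Rightarrow> (complex ^ 'n) measure" where
  "weighted_volume \<Omega> l =
     density (normalized_volume \<Omega>) (\<lambda>z. ennreal (bergman_diag \<Omega> z powr l / (LINT w|normalized_volume \<Omega>. bergman_diag \<Omega> w powr l)))"

definition invariant_measure :: "(complex ^ 'n) set \<Rightarrow> (complex ^ 'n) measure" where
  "invariant_measure \<Omega> = density (normalized_volume \<Omega>) (\<lambda>z. ennreal (bergman_diag \<Omega> z))"

definition weighted_composition ::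
  "(complex ^ 'n) set \<Rightarrow> (complex ^ 'n \<Rightarrow> complex ^ 'n) \<Rightarrow> (complex ^ 'n \<Rightarrow> complex) \<Rightarrow> (complex ^ 'n) operator" where
  "weighted_composition \<Omega> \<phi> \<psi> f = (\<lambda>z. if z \<in> \<Omega> then \<psi> z * f (\<phi> z) else 0)"

end

theory Submission
  imports Defs "HOL-Complex_Analysis.Complex_Analysis"
begin

text \<open>
  Write \<open>K\<close> for the Bergman kernel, \<open>d z = K z z\<close>, \<open>m = 1 - l\<close>, and \<open>T\<close> for the weighted
  composition operator.

  The Schatten hypothesis provides an orthonormal basis \<open>E\<close> of the weighted Bergman space whose
  images \<open>T e\<close> are orthogonal with squared norms \<open>s e\<close>, and \<open>\<Sum> s e powr (p / 2)\<close> converges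
  (\<open>schatten_class_singular_values\<close>). Two facts connect this with point values; both express that
  \<open>K\<close> to the power \<open>m\<close> is the reproducing kernel of the weighted space. Every \<open>f\<close> in the space
  satisfies \<open>\<bar>f a\<bar>\<^sup>2 \<le> d a powr m * \<parallel>f\<parallel>\<^sup>2\<close> (\<open>weighted_evaluation\<close>), and this is sharp, the extremal
  function being \<open>K(\<cdot>, a)\<close> to the power \<open>m\<close> (\<open>peak_function\<close>). Expanding the extremal function at
  \<open>a = \<phi> z\<close> in the basis \<open>E\<close> and applying \<open>T\<close> gives
  \<open>\<bar>\<psi> z\<bar>\<^sup>2 d(\<phi> z) powr m \<le> \<Sum> \<bar>T e z\<bar>\<^sup>2\<close>. The evaluation bound for the orthogonal family \<open>T e\<close> shows
  that the numbers \<open>\<bar>T e z\<bar>\<^sup>2 / (s e * d z powr m)\<close> add up to at most 1. Since \<open>p / 2 \<ge> 1\<close>, Jensen's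
  inequality bounds the integrand of the theorem by
  \<open>\<Sum> s e powr (p / 2) * \<bar>T e z\<bar>\<^sup>2 / (s e * d z powr m)\<close>. Because \<open>d / d powr m = d powr l\<close>, each
  summand has integral \<open>C * s e powr (p / 2)\<close> with respect to the invariant measure, where \<open>C\<close> is the
  normalising constant of the weighted volume, and the sum of these is finite.

  The two facts about point evaluations rest on the automorphisms of \<open>\<Omega>\<close>. At the origin they follow
  from the mean value property of circular domains. The transformation rule
  \<open>kernel_transformation\<close>, which needs the complex Jacobian in the change of variables formula,
  carries them to the orbit of the origin under the automorphism group. The symmetry at a point
  is a reflection up to a quadratic error, and reflecting in midpoints shows that the orbit is dense
  (\<open>orbit_dense\<close>); continuity and Fatou's lemma do the rest. For a real exponent \<open>m\<close> the power of
  \<open>K(\<cdot>, a)\<close> requires a logarithm. The kernel has no zeros (\<open>kernel_nonzero\<close>), and moving \<open>a\<close> along a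
  path to the origin deforms \<open>K(\<cdot>, a)\<close> to \<open>K(\<cdot>, 0) = 1\<close> among functions without zeros, so a
  continuous logarithm exists.
\<close>

section \<open>Holomorphic functions of several variables\<close>

lemma norm_smult_vec: "norm (c *s v) = norm c * norm v" for v :: "complex ^ 'n"
  by (simp add: norm_vec_def norm_mult L2_set_right_distrib)

lemma of_real_smult_vec: "complex_of_real r *s v = r *\<^sub>R v" for v :: "complex ^ 'n"
  by (simp add: vec_eq_iff scaleR_conv_of_real[where 'a=complex])

lemma has_derivative_smult_vec:
  "((\<lambda>\<zeta>. z + \<zeta> *s v) has_derivative (\<lambda>\<zeta>. \<zeta> *s v)) (at \<zeta> within S)" for z v :: "complex ^ 'n"
proof -
  have "bounded_linear (\<lambda>\<zeta>. \<zeta> *s v)"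
    by (rule bounded_linear_intro [where K="norm v"])
       (simp_all add: norm_smult_vec vec_eq_iff algebra_simps)
  then show ?thesis
    using has_derivative_add[OF has_derivative_const[of z] bounded_linear_imp_has_derivative] by simp
qed

lemma continuous_on_smult_vec [continuous_intros]:
  "continuous_on S f \<Longrightarrow> continuous_on S g \<Longrightarrow> continuous_on S (\<lambda>x. f x *s g x)"
  for g :: "'a::topological_space \<Rightarrow> complex ^ 'n"
  unfolding vector_scalar_mult_def by (intro continuous_intros) 

definition cderiv :: "(complex ^ 'n \<Rightarrow> complex) \<Rightarrow> complex ^ 'n \<Rightarrow> complex ^ 'n \<Rightarrow> complex" where
  "cderiv f z = frechet_derivative f (at z)"

lemma holomorphic_fun_cderiv:
  assumes "holomorphic_fun \<Omega> f" "z \<in> \<Omega>"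
  shows "(f has_derivative cderiv f z) (at z)" "cderiv f z (c *s v) = c * cderiv f z v"
proof -
  obtain D where D: "(f has_derivative D) (at z)" "\<forall>c v. D (c *s v) = c * D v"
    using assms unfolding holomorphic_fun_def by blast
  then have "D = cderiv f z" unfolding cderiv_def by (blast intro: frechet_derivative_at)
  with D show "(f has_derivative cderiv f z) (at z)" "cderiv f z (c *s v) = c * cderiv f z v" by auto
qed

lemma holomorphic_fun_subset: "holomorphic_fun \<Omega> f \<Longrightarrow> S \<subseteq> \<Omega> \<Longrightarrow> holomorphic_fun S f"
  unfolding holomorphic_fun_def by blast

lemma holomorphic_fun_continuous_on: "holomorphic_fun \<Omega> f \<Longrightarrow> continuous_on \<Omega> f"
  unfolding holomorphic_fun_def
  by (meson continuous_at_imp_continuous_on has_derivative_continuous)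

lemma holomorphic_map_continuous_on:
  assumes "holomorphic_map \<Omega> F" shows "continuous_on \<Omega> F"
proof -
  have "continuous_on \<Omega> (\<lambda>z. \<chi> i. F z $ i)"
    using assms unfolding holomorphic_map_def
    by (intro continuous_on_vec_lambda) (simp add: holomorphic_fun_continuous_on)
  then show ?thesis by simp
qed

lemma holomorphic_map_has_derivative:
  fixes F :: "complex ^ 'n \<Rightarrow> complex ^ 'm"
  assumes "holomorphic_map \<Omega> F" "z \<in> \<Omega>"
  shows "(F has_derivative (\<lambda>v. \<chi> i. cderiv (\<lambda>z. F z $ i) z v)) (at z)"
proof -
  have "((\<lambda>z. \<chi> i. F z $ i) has_derivative (\<lambda>v. \<chi> i. cderiv (\<lambda>z. F z $ i) z v)) (at z)"
    unfolding has_derivative_componentwise_within [of "\<lambda>z. \<chi> i. F z $ i"]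
  proof
    fix b :: "complex ^ 'm" assume "b \<in> Basis"
    then obtain i u where b: "b = axis i u" "u \<in> Basis" by (auto simp: Basis_vec_def)
    have "((\<lambda>z. F z $ i) has_derivative (\<lambda>v. cderiv (\<lambda>z. F z $ i) z v)) (at z)"
      using assms holomorphic_fun_cderiv(1) unfolding holomorphic_map_def by blast
    then have "((\<lambda>z. F z $ i \<bullet> u) has_derivative (\<lambda>v. cderiv (\<lambda>z. F z $ i) z v \<bullet> u)) (at z)"
      by (rule has_derivative_inner_left)
    then show "((\<lambda>z. (\<chi> i. F z $ i) \<bullet> b) has_derivative (\<lambda>v. (\<chi> i. cderiv (\<lambda>z. F z $ i) z v) \<bullet> b)) (at z)"
      by (simp add: b inner_axis)
  qed
  then show ?thesis by simp
qed

lemma holomorphic_fun_compose: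
  assumes f: "holomorphic_fun S f" and F: "holomorphic_map \<Omega> F" and sub: "F ` \<Omega> \<subseteq> S"
  shows "holomorphic_fun \<Omega> (\<lambda>z. f (F z))"
  unfolding holomorphic_fun_def
proof
  fix z assume z: "z \<in> \<Omega>"
  let ?D = "\<lambda>v. \<chi> i. cderiv (\<lambda>z. F z $ i) z v"
  have "(f has_derivative cderiv f (F z)) (at (F z))"
    using f sub z by (auto intro!: holomorphic_fun_cderiv(1))
  then have "((\<lambda>z. f (F z)) has_derivative (\<lambda>v. cderiv f (F z) (?D v))) (at z)"
    using has_derivative_compose[OF holomorphic_map_has_derivative[OF F z]] by blast
  moreover have "?D (c *s v) = c *s ?D v" for c v
  proof -
    have "cderiv (\<lambda>z. F z $ i) z (c *s v) = c * cderiv (\<lambda>z. F z $ i) z v" for i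
      using F z unfolding holomorphic_map_def by (intro holomorphic_fun_cderiv(2)) auto
    then show ?thesis by (simp add: vec_eq_iff)
  qed
  moreover have "cderiv f (F z) (c *s v) = c * cderiv f (F z) v" for c v
    using f sub z by (auto intro!: holomorphic_fun_cderiv(2))
  ultimately show "\<exists>D. ((\<lambda>z. f (F z)) has_derivative D) (at z) \<and> (\<forall>c v. D (c *s v) = c * D v)"
    by (intro exI[of _ "\<lambda>v. cderiv f (F z) (?D v)"]) auto
qed

lemma holomorphic_map_compose:
  assumes "holomorphic_map S G" "holomorphic_map \<Omega> F" "F ` \<Omega> \<subseteq> S"
  shows "holomorphic_map \<Omega> (\<lambda>z. G (F z))"
  using assms holomorphic_fun_compose[of S] unfolding holomorphic_map_def[of S] holomorphic_map_def[of \<Omega> "\<lambda>z. G (F z)"]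
  by blast

lemma holomorphic_fun_const: "holomorphic_fun \<Omega> (\<lambda>z. c)"
  unfolding holomorphic_fun_def by (intro ballI exI[of _ "\<lambda>v. 0"]) auto

lemma holomorphic_fun_nth: "holomorphic_fun \<Omega> (\<lambda>z. z $ i)"
  unfolding holomorphic_fun_def
  by (intro ballI exI[of _ "\<lambda>v. v $ i"])
     (auto intro!: bounded_linear.has_derivative[OF bounded_linear_vec_nth])

lemma holomorphic_fun_add:
  assumes "holomorphic_fun \<Omega> f" "holomorphic_fun \<Omega> g"
  shows "holomorphic_fun \<Omega> (\<lambda>z. f z + g z)"
  unfolding holomorphic_fun_def
proof
  fix z assume z: "z \<in> \<Omega>"
  show "\<exists>D. ((\<lambda>z. f z + g z) has_derivative D) (at z) \<and> (\<forall>c v. D (c *s v) = c * D v)"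
    by (intro exI[of _ "\<lambda>v. cderiv f z v + cderiv g z v"] conjI has_derivative_add)
       (auto simp: holomorphic_fun_cderiv[OF assms(1) z] holomorphic_fun_cderiv[OF assms(2) z] algebra_simps)
qed

lemma holomorphic_fun_mult:
  assumes "holomorphic_fun \<Omega> f" "holomorphic_fun \<Omega> g"
  shows "holomorphic_fun \<Omega> (\<lambda>z. f z * g z)"
  unfolding holomorphic_fun_def
proof
  fix z assume z: "z \<in> \<Omega>"
  show "\<exists>D. ((\<lambda>z. f z * g z) has_derivative D) (at z) \<and> (\<forall>c v. D (c *s v) = c * D v)"
    by (intro exI[of _ "\<lambda>v. f z * cderiv g z v + cderiv f z v * g z"] conjI has_derivative_mult)
       (auto simp: holomorphic_fun_cderiv[OF assms(1) z] holomorphic_fun_cderiv[OF assms(2) z] algebra_simps)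
qed

lemma holomorphic_fun_cmult: "holomorphic_fun \<Omega> f \<Longrightarrow> holomorphic_fun \<Omega> (\<lambda>z. c * f z)"
  by (intro holomorphic_fun_mult holomorphic_fun_const)

lemma holomorphic_fun_diff:
  assumes "holomorphic_fun \<Omega> f" "holomorphic_fun \<Omega> g"
  shows "holomorphic_fun \<Omega> (\<lambda>z. f z - g z)"
  using holomorphic_fun_add[OF assms(1) holomorphic_fun_cmult[OF assms(2), of "-1"]] by simp

lemma holomorphic_fun_sum:
  "finite I \<Longrightarrow> (\<And>i. i \<in> I \<Longrightarrow> holomorphic_fun \<Omega> (f i)) \<Longrightarrow> holomorphic_fun \<Omega> (\<lambda>z. \<Sum>i\<in>I. f i z)"
  by (induction I rule: finite_induct) (auto intro: holomorphic_fun_const holomorphic_fun_add)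

lemma holomorphic_fun_prod:
  "finite I \<Longrightarrow> (\<And>i. i \<in> I \<Longrightarrow> holomorphic_fun \<Omega> (f i)) \<Longrightarrow> holomorphic_fun \<Omega> (\<lambda>z. \<Prod>i\<in>I. f i z)"
  by (induction I rule: finite_induct) (auto intro: holomorphic_fun_const holomorphic_fun_mult)

lemma holomorphic_fun_chain:
  assumes f: "holomorphic_fun \<Omega> f" and g: "\<And>z. z \<in> \<Omega> \<Longrightarrow> g field_differentiable (at (f z))"
  shows "holomorphic_fun \<Omega> (\<lambda>z. g (f z))"
  unfolding holomorphic_fun_def
proof
  fix z assume z: "z \<in> \<Omega>"
  obtain g' where "(g has_field_derivative g') (at (f z))"
    using g[OF z] unfolding field_differentiable_def by blast
  then have "((\<lambda>z. g (f z)) has_derivative (\<lambda>v. g' * cderiv f z v)) (at z)"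
    using has_derivative_compose[OF holomorphic_fun_cderiv(1)[OF f z]]
    unfolding has_field_derivative_def by blast
  then show "\<exists>D. ((\<lambda>z. g (f z)) has_derivative D) (at z) \<and> (\<forall>c v. D (c *s v) = c * D v)"
    by (intro exI[of _ "\<lambda>v. g' * cderiv f z v"]) (auto simp: holomorphic_fun_cderiv(2)[OF f z])
qed

lemma holomorphic_fun_cong:
  assumes "holomorphic_fun \<Omega> f" "open \<Omega>" "\<And>z. z \<in> \<Omega> \<Longrightarrow> f z = g z"
  shows "holomorphic_fun \<Omega> g"
  unfolding holomorphic_fun_def
proof
  fix z assume z: "z \<in> \<Omega>"
  have "(g has_derivative cderiv f z) (at z)"
    by (rule has_derivative_transform_within_open[OF holomorphic_fun_cderiv(1)[OF assms(1) z] assms(2) z assms(3)])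
  then show "\<exists>D. (g has_derivative D) (at z) \<and> (\<forall>c v. D (c *s v) = c * D v)"
    using holomorphic_fun_cderiv(2)[OF assms(1) z] by auto
qed

lemma holomorphic_map_affine: "holomorphic_map \<Omega> (\<lambda>z. a + c *s z)"
  unfolding holomorphic_map_def
  by (auto intro!: holomorphic_fun_add holomorphic_fun_const holomorphic_fun_cmult holomorphic_fun_nth)

lemma line_has_field_derivative:
  assumes f: "holomorphic_fun \<Omega> f" and z: "z + \<zeta> *s v \<in> \<Omega>"
  shows "((\<lambda>\<zeta>. f (z + \<zeta> *s v)) has_field_derivative cderiv f (z + \<zeta> *s v) v) (at \<zeta>)"
proof -
  have "((\<lambda>\<zeta>. f (z + \<zeta> *s v)) has_derivative (\<lambda>h. cderiv f (z + \<zeta> *s v) (h *s v))) (at \<zeta>)"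
    using has_derivative_compose[OF has_derivative_smult_vec holomorphic_fun_cderiv(1)[OF f z]] by blast
  then show ?thesis
    by (simp add: has_field_derivative_def holomorphic_fun_cderiv(2)[OF f z] mult.commute[of _ "cderiv f (z + \<zeta> *s v) v"])
qed

lemma holomorphic_on_line:
  assumes f: "holomorphic_fun \<Omega> f" and "\<And>\<zeta>. \<zeta> \<in> S \<Longrightarrow> z + \<zeta> *s v \<in> \<Omega>"
  shows "(\<lambda>\<zeta>. f (z + \<zeta> *s v)) holomorphic_on S"
  unfolding holomorphic_on_def field_differentiable_def
  using line_has_field_derivative[OF f] assms(2) has_field_derivative_at_within by blast

lemma line_in_cball:
  fixes z :: "complex ^ 'n"
  assumes "norm \<zeta> * norm v \<le> r" shows "z + \<zeta> *s v \<in> cball z r"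
  using assms by (simp add: dist_norm norm_smult_vec)

lemma line_in_ball:
  fixes z :: "complex ^ 'n"
  assumes "norm \<zeta> * norm v < r" shows "z + \<zeta> *s v \<in> ball z r"
  using assms by (simp add: dist_norm norm_smult_vec)

text \<open>
  The restriction of \<open>f\<close> to the complex line through \<open>z\<close> in
  direction \<open>v\<close> is holomorphic on a disc of radius \<open>r / norm v\<close>,
  where the inequality of Cauchy in one variable applies.
\<close>

lemma Cauchy_estimate_cderiv:
  assumes f: "holomorphic_fun \<Omega> f" and sub: "cball z r \<subseteq> \<Omega>" and r: "r > 0"
    and M: "\<And>w. w \<in> cball z r \<Longrightarrow> norm (f w) \<le> M"
  shows "norm (cderiv f z v) \<le> M * norm v / r"
proof (cases "v = 0")
  case True
  have "z \<in> \<Omega>" using sub r by auto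
  then have "cderiv f z (0 *s 0) = 0" by (subst holomorphic_fun_cderiv(2)[OF f]) auto
  then show ?thesis using True by simp
next
  case False
  have zin: "z \<in> \<Omega>" using sub r by auto
  let ?R = "r / norm v" and ?h = "\<lambda>\<zeta>. f (z + \<zeta> *s v)"
  have R: "?R > 0" using r False by simp
  have in_cball: "z + \<zeta> *s v \<in> cball z r" if "norm \<zeta> \<le> ?R" for \<zeta>
    using that False by (intro line_in_cball) (simp add: field_simps)
  have hol: "?h holomorphic_on cball 0 ?R"
    using in_cball sub by (intro holomorphic_on_line[OF f]) auto
  have "norm ((deriv ^^ 1) ?h 0) \<le> fact 1 * M / ?R ^ 1"
    using hol R in_cball M
    by (intro Cauchy_inequality) (auto intro: holomorphic_on_subset holomorphic_on_imp_continuous_on)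
  moreover have "deriv ?h 0 = cderiv f z v"
    using line_has_field_derivative[OF f, of z 0 v] zin by (intro DERIV_imp_deriv) simp
  ultimately show ?thesis using False by (simp add: field_simps)
qed

text \<open>
  Taylor's theorem for the restriction to the complex line through \<open>z\<close> in
  direction \<open>v\<close>. It is holomorphic on a disc of radius \<open>R = r / norm v
  \<ge> 2\<close>, so the discs of radius \<open>R / 2\<close> around points of the unit disc
  lie in it and bound the second derivative.
\<close>

lemma second_order_estimate:
  assumes f: "holomorphic_fun \<Omega> f" and sub: "cball z r \<subseteq> \<Omega>" and r: "r > 0"
    and M: "\<And>w. w \<in> cball z r \<Longrightarrow> norm (f w) \<le> M" and v: "norm v \<le> r / 2"
  shows "norm (f (z + v) - f z - cderiv f z v) \<le> 8 * M * (norm v)\<^sup>2 / r\<^sup>2"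
proof (cases "v = 0")
  case True
  have "z \<in> \<Omega>" using sub r by auto
  then have "cderiv f z (0 *s 0) = 0" by (subst holomorphic_fun_cderiv(2)[OF f]) auto
  then show ?thesis using True by simp
next
  case False
  have zin: "z \<in> \<Omega>" using sub r by auto
  let ?R = "r / norm v" and ?h = "\<lambda>\<zeta>. f (z + \<zeta> *s v)"
  have R: "?R \<ge> 2" using v False by (simp add: field_simps)
  have in_cball: "z + \<zeta> *s v \<in> cball z r" if "norm \<zeta> \<le> ?R" for \<zeta>
    using that False by (intro line_in_cball) (simp add: field_simps)
  have hol: "?h holomorphic_on cball 0 ?R"
    using in_cball sub by (intro holomorphic_on_line[OF f]) auto
  have M0: "M \<ge> 0" using M[of z] r order_trans[OF norm_ge_zero] by auto
  have h2: "norm ((deriv ^^ 2) ?h \<zeta>) \<le> 8 * M / ?R\<^sup>2" if "\<zeta> \<in> cball 0 1" for \<zeta>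
  proof -
    have sub1: "cball \<zeta> (?R / 2) \<subseteq> cball 0 ?R"
    proof
      fix x assume "x \<in> cball \<zeta> (?R / 2)"
      then have "norm x \<le> norm \<zeta> + ?R / 2"
        using norm_triangle_sub[of x \<zeta>] by (simp add: dist_norm norm_minus_commute)
      then show "x \<in> cball 0 ?R" using that R by (simp add: dist_norm)
    qed
    have "norm ((deriv ^^ 2) ?h \<zeta>) \<le> fact 2 * M / (?R / 2) ^ 2"
    proof (rule Cauchy_inequality)
      show "?h holomorphic_on ball \<zeta> (?R / 2)" "continuous_on (cball \<zeta> (?R / 2)) ?h"
        using hol sub1 by (meson ball_subset_cball holomorphic_on_subset, meson holomorphic_on_imp_continuous_on holomorphic_on_subset)
      show "0 < ?R / 2" using R by simp
      fix x assume "norm (\<zeta> - x) = ?R / 2"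
      then have "x \<in> cball 0 ?R" using sub1 by (auto simp: dist_norm subset_iff)
      then show "norm (f (z + x *s v)) \<le> M" using M in_cball by (simp add: dist_norm)
    qed
    then show ?thesis by (simp add: power2_eq_square field_simps)
  qed
  define F where "F = (\<lambda>i. (deriv ^^ i) ?h)"
  have op: "?h holomorphic_on ball 0 ?R" using hol by (meson ball_subset_cball holomorphic_on_subset)
  have "norm (F 0 1 - (\<Sum>i\<le>1. F i 0 * (1 - 0) ^ i / fact i)) \<le> (8 * M / ?R\<^sup>2) * norm (1 - 0 :: complex) ^ Suc 1 / fact 1"
  proof (rule complex_Taylor[of "cball 0 1"])
    fix i and x :: complex assume x: "x \<in> cball 0 1"
    have "((deriv ^^ i) ?h) holomorphic_on ball 0 ?R"
      using op by (rule holomorphic_higher_deriv) auto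
    then have "((deriv ^^ i) ?h has_field_derivative deriv ((deriv ^^ i) ?h) x) (at x)"
      using x R by (intro holomorphic_derivI[of _ "ball 0 ?R"]) auto
    then show "(F i has_field_derivative F (Suc i) x) (at x within cball 0 1)"
      by (simp add: F_def has_field_derivative_at_within)
  next
    fix x :: complex assume "x \<in> cball 0 1"
    then show "norm (F (Suc 1) x) \<le> 8 * M / ?R\<^sup>2" using h2 by (simp add: F_def numeral_2_eq_2)
  qed (auto simp: F_def)
  moreover have "deriv ?h 0 = cderiv f z v"
    using line_has_field_derivative[OF f, of z 0 v] zin by (intro DERIV_imp_deriv) simp
  ultimately show ?thesis using False by (simp add: F_def field_simps)
qed

lemma holomorphic_local_lipschitz:
  assumes f: "holomorphic_fun \<Omega> f" and sub: "cball z r \<subseteq> \<Omega>" and r: "r > 0"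
    and M: "\<And>w. w \<in> cball z r \<Longrightarrow> norm (f w) \<le> M" and v: "norm v \<le> r / 2"
  shows "norm (f (z + v) - f z) \<le> 5 * M / r * norm v"
proof -
  have "norm (f z) \<le> M" using M[of z] r by simp
  then have M0: "M \<ge> 0" using norm_ge_zero order_trans by blast
  have "norm (f (z + v) - f z) \<le> norm (f (z + v) - f z - cderiv f z v) + norm (cderiv f z v)"
    using norm_triangle_ineq[of "f (z + v) - f z - cderiv f z v" "cderiv f z v"] by simp
  also have "\<dots> \<le> 8 * M * (norm v)\<^sup>2 / r\<^sup>2 + M * norm v / r"
    using M by (intro add_mono second_order_estimate[OF f sub r _ v] Cauchy_estimate_cderiv[OF f sub r]) auto
  also have "8 * M * (norm v)\<^sup>2 / r\<^sup>2 = 8 * M / r\<^sup>2 * norm v * norm v"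
    by (simp add: power2_eq_square)
  also have "\<dots> \<le> 8 * M / r\<^sup>2 * norm v * (r / 2)"
    using v M0 by (intro mult_left_mono) auto
  also have "8 * M / r\<^sup>2 * norm v * (r / 2) + M * norm v / r = 5 * M / r * norm v"
    using r by (simp add: power2_eq_square field_simps)
  finally show ?thesis by simp
qed

lemma cderiv_unique:
  assumes "(f has_derivative D) (at z)" shows "cderiv f z = D"
  unfolding cderiv_def using frechet_derivative_at[OF assms] by simp

lemma cderiv_diff:
  assumes "holomorphic_fun \<Omega> f" "holomorphic_fun \<Omega> g" "z \<in> \<Omega>"
  shows "cderiv (\<lambda>z. f z - g z) z v = cderiv f z v - cderiv g z v"
  using cderiv_unique[OF has_derivative_diff[OF holomorphic_fun_cderiv(1)[OF assms(1,3)] holomorphic_fun_cderiv(1)[OF assms(2,3)]]]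
  by simp

text \<open>
  By the Cauchy estimate the derivatives at a point form a Cauchy sequence. The second order
  estimate holds with a constant independent of \<open>n\<close>; its limit says that the
  limit of the derivatives is the derivative of the limit.
\<close>

lemma holomorphic_fun_limit:
  fixes f :: "nat \<Rightarrow> complex ^ 'n \<Rightarrow> complex"
  assumes hol: "\<And>n. holomorphic_fun \<Omega> (f n)"
    and conv: "\<And>z. z \<in> \<Omega> \<Longrightarrow> \<exists>r>0. cball z r \<subseteq> \<Omega> \<and> uniform_limit (cball z r) f g sequentially"
  shows "holomorphic_fun \<Omega> g"
  unfolding holomorphic_fun_def
proof
  fix z assume z: "z \<in> \<Omega>"
  obtain r where r: "r > 0" "cball z r \<subseteq> \<Omega>" and ul: "uniform_limit (cball z r) f g sequentially"
    using conv[OF z] by blast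
  have cont: "continuous_on (cball z r) (f n)" for n
    using holomorphic_fun_continuous_on[OF hol] r(2) continuous_on_subset by blast
  have "continuous_on (cball z r) g"
    by (rule uniform_limit_theorem[OF _ ul]) (simp_all add: cont)
  then have "bounded (g ` cball z r)"
    by (intro compact_imp_bounded compact_continuous_image) auto
  then obtain M where M: "\<And>w. w \<in> cball z r \<Longrightarrow> norm (g w) \<le> M"
    unfolding bounded_iff by blast
  have close: "\<forall>\<^sub>F n in sequentially. \<forall>w\<in>cball z r. norm (f n w - g w) < e" if "e > 0" for e
    using uniform_limitD[OF ul that] by (simp add: dist_norm)
  have bd: "\<forall>\<^sub>F n in sequentially. \<forall>w\<in>cball z r. norm (f n w) \<le> M + 1"
    using close[of 1, OF zero_less_one]
  proof eventually_elim
    case (elim n)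
    show ?case
    proof
      fix w assume w: "w \<in> cball z r"
      show "norm (f n w) \<le> M + 1"
        using bspec[OF elim w] M[OF w] norm_triangle_sub[of "f n w" "g w"] by linarith
    qed
  qed
  have "Cauchy (\<lambda>n. cderiv (f n) z v)" for v
  proof (rule metric_CauchyI)
    fix e :: real assume e: "e > 0"
    let ?d = "e * r / (4 * (norm v + 1))"
    have nv: "norm v + 1 > 0" using norm_ge_zero[of v] by linarith
    have d: "?d > 0" using e r(1) nv by simp
    obtain N where N: "\<And>n w. n \<ge> N \<Longrightarrow> w \<in> cball z r \<Longrightarrow> norm (f n w - g w) < ?d"
      using close[OF d] unfolding eventually_sequentially by blast
    have "dist (cderiv (f m) z v) (cderiv (f n) z v) < e" if "m \<ge> N" "n \<ge> N" for m n
    proof -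
      have "norm (f m w - f n w) \<le> 2 * ?d" if w: "w \<in> cball z r" for w
        using N[OF \<open>m \<ge> N\<close> w] N[OF \<open>n \<ge> N\<close> w]
          norm_triangle_ineq4[of "f m w - g w" "f n w - g w"] by simp
      then have "norm (cderiv (\<lambda>z. f m z - f n z) z v) \<le> 2 * ?d * norm v / r"
        by (intro Cauchy_estimate_cderiv[OF holomorphic_fun_diff[OF hol hol] r(2,1)])
      also have "\<dots> = e / 2 * (norm v / (norm v + 1))"
      proof -
        have "2 * (e * r / (4 * k)) * x / r = e / 2 * (x / k)" if "k > 0" for k x :: real
          using r(1) that by (simp add: field_simps)
        then show ?thesis using nv by blast
      qed
      also have "\<dots> \<le> e / 2 * 1"
        using e nv by (intro mult_left_mono) auto
      finally show ?thesis using e by (simp add: cderiv_diff[OF hol hol z] dist_norm)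
    qed
    then show "\<exists>N. \<forall>m\<ge>N. \<forall>n\<ge>N. dist (cderiv (f m) z v) (cderiv (f n) z v) < e" by blast
  qed
  then have "\<exists>l. (\<lambda>n. cderiv (f n) z v) \<longlonglongrightarrow> l" for v
    by (simp add: Cauchy_convergent_iff convergent_def)
  then obtain D where D: "\<And>v. (\<lambda>n. cderiv (f n) z v) \<longlonglongrightarrow> D v" by metis
  have Dlin: "linear (cderiv (f n) z)" for n
    using has_derivative_linear[OF holomorphic_fun_cderiv(1)[OF hol z]] .
  have Dadd: "D (v + w) = D v + D w" for v w
    using LIMSEQ_unique[OF D[of "v + w"]] tendsto_add[OF D[of v] D[of w]]
    by (simp add: linear_add[OF Dlin])
  have Dsmult: "D (c *s v) = c * D v" for c v
    using LIMSEQ_unique[OF D[of "c *s v"]] tendsto_mult_left[OF D[of v]]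
    by (simp add: holomorphic_fun_cderiv(2)[OF hol z])
  have Dlinear: "linear D"
  proof
    show "D (r *\<^sub>R b) = r *\<^sub>R D b" for r b
      using Dsmult[of "complex_of_real r" b] by (simp add: of_real_smult_vec scaleR_conv_of_real)
  qed (rule Dadd)
  have lim: "(\<lambda>n. f n w) \<longlonglongrightarrow> g w" if "w \<in> cball z r" for w
    using tendsto_uniform_limitI[OF ul that] .
  have est: "norm (g (z + v) - g z - D v) \<le> 8 * (M + 1) / r\<^sup>2 * (norm v)\<^sup>2" if v: "norm v \<le> r / 2" for v
  proof (rule tendsto_upperbound)
    have "norm v \<le> r" using v r(1) by linarith
    then have "z + v \<in> cball z r" by (simp add: dist_norm)
    then show "(\<lambda>n. norm (f n (z + v) - f n z - cderiv (f n) z v)) \<longlonglongrightarrow> norm (g (z + v) - g z - D v)"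
      using r(1) by (intro tendsto_norm tendsto_diff D lim) auto
    show "\<forall>\<^sub>F n in sequentially. norm (f n (z + v) - f n z - cderiv (f n) z v) \<le> 8 * (M + 1) / r\<^sup>2 * (norm v)\<^sup>2"
      using bd
    proof eventually_elim
      case (elim n)
      then show ?case using second_order_estimate[OF hol r(2,1) _ v, of n "M + 1"] by simp
    qed
  qed simp
  have "(g has_derivative D) (at z)"
    unfolding has_derivative_at_alt
  proof (intro conjI allI impI)
    show "bounded_linear D" using Dlinear by (simp add: linear_conv_bounded_linear)
    fix e :: real assume e: "e > 0"
    \<comment> \<open>The constant of the quadratic error; the derivative works within distance \<open>e /
      C\<close>.\<close>
    define C where "C = 8 * (M + 1) / r\<^sup>2"
    have "norm (g z) \<le> M" using M r(1) by simp
    then have "M \<ge> 0" using norm_ge_zero order_trans by blast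
    then have C: "C > 0" using r(1) by (simp add: C_def)
    show "\<exists>d>0. \<forall>y. norm (y - z) < d \<longrightarrow> norm (g y - g z - D (y - z)) \<le> e * norm (y - z)"
    proof (intro exI[of _ "min (r / 2) (e / C)"] conjI allI impI)
      fix y assume y: "norm (y - z) < min (r / 2) (e / C)"
      have "norm (g y - g z - D (y - z)) \<le> C * norm (y - z) * norm (y - z)"
        using est[of "y - z"] y by (simp add: C_def power2_eq_square mult.assoc)
      also have "\<dots> \<le> e * norm (y - z)"
        using y C by (intro mult_right_mono) (auto simp: field_simps)
      finally show "norm (g y - g z - D (y - z)) \<le> e * norm (y - z)" .
    qed (use e C r(1) in auto)
  qed
  then show "\<exists>D. (g has_derivative D) (at z) \<and> (\<forall>c v. D (c *s v) = c * D v)"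
    using Dsmult by blast
qed

text \<open>
  The difference quotients with steps \<open>v / N\<close> are holomorphic, and by the second
  order estimate they converge locally uniformly to the derivative in direction
  \<open>v\<close>.
\<close>

lemma holomorphic_fun_cderiv_direction:
  fixes f :: "complex ^ 'n \<Rightarrow> complex"
  assumes f: "holomorphic_fun \<Omega> f" and \<Omega>: "open \<Omega>"
  shows "holomorphic_fun \<Omega> (\<lambda>z. cderiv f z v)"
proof -
  have "\<exists>r>0. holomorphic_fun (ball z0 r) (\<lambda>z. cderiv f z v)" if z0: "z0 \<in> \<Omega>" for z0
  proof -
    obtain s where s: "s > 0" "cball z0 s \<subseteq> \<Omega>" using \<Omega> z0 open_contains_cball by blast
    define r where "r = s / 2"
    have r: "r > 0" using s by (simp add: r_def)
    have sub: "cball z r \<subseteq> cball z0 s" if "z \<in> ball z0 r" for z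
    proof
      fix x assume "x \<in> cball z r"
      then show "x \<in> cball z0 s"
        using that dist_triangle[of z0 x z] by (simp add: r_def)
    qed
    have ball_sub: "ball z0 r \<subseteq> \<Omega>"
      using s by (auto simp: r_def subset_iff)
    have "bounded (f ` cball z0 s)"
      using holomorphic_fun_continuous_on[OF f] s(2)
      by (intro compact_imp_bounded compact_continuous_image) (auto intro: continuous_on_subset)
    then obtain M where M: "\<And>w. w \<in> cball z0 s \<Longrightarrow> norm (f w) \<le> M"
      unfolding bounded_iff by blast
    obtain N0 :: nat where N0: "norm v / (r / 2) < real N0" using reals_Archimedean2 by blast
    define N where "N = (\<lambda>n. real (n + N0 + 1))"
    have Npos: "N n > 0" for n by (simp add: N_def)
    have Nv: "norm (complex_of_real (1 / N n) *s v) \<le> r / 2" for n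
    proof -
      have "norm v < real N0 * (r / 2)" using N0 r by (simp add: divide_less_eq)
      also have "\<dots> \<le> N n * (r / 2)" using r by (intro mult_right_mono) (auto simp: N_def)
      finally show ?thesis using Npos[of n]
        by (simp add: norm_smult_vec norm_divide field_simps)
    qed
    define q where "q = (\<lambda>n z. complex_of_real (N n) * (f (z + complex_of_real (1 / N n) *s v) - f z))"
    have "holomorphic_fun (ball z0 r) (\<lambda>z. cderiv f z v)"
    proof (rule holomorphic_fun_limit)
      fix n
      have fm: "holomorphic_map (ball z0 r) (\<lambda>z. complex_of_real (1 / N n) *s v + 1 *s z)"
        by (rule holomorphic_map_affine)
      have "(\<lambda>z. complex_of_real (1 / N n) *s v + 1 *s z) ` ball z0 r \<subseteq> \<Omega>"
      proof safe
        fix z assume z: "z \<in> ball z0 r"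
        have "dist z0 (complex_of_real (1 / N n) *s v + 1 *s z) \<le> dist z0 z + norm (complex_of_real (1 / N n) *s v)"
          using dist_triangle[of z0 "complex_of_real (1 / N n) *s v + 1 *s z" z] by (simp add: dist_norm norm_minus_commute)
        also have "\<dots> \<le> s" using z Nv[of n] r by (simp add: r_def)
        finally show "complex_of_real (1 / N n) *s v + 1 *s z \<in> \<Omega>" using s(2) by auto
      qed
      from holomorphic_fun_compose[OF f fm this]
      have "holomorphic_fun (ball z0 r) (\<lambda>z. f (z + complex_of_real (1 / N n) *s v))"
        by (simp add: add.commute)
      moreover have "holomorphic_fun (ball z0 r) f"
        by (rule holomorphic_fun_subset[OF f ball_sub])
      ultimately show "holomorphic_fun (ball z0 r) (q n)"
        unfolding q_def by (intro holomorphic_fun_cmult holomorphic_fun_diff)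
    next
      fix z assume z: "z \<in> ball z0 r"
      obtain t where t: "t > 0" "cball z t \<subseteq> ball z0 r" using z open_contains_cball open_ball by blast
      have "uniform_limit (cball z t) q (\<lambda>z. cderiv f z v) sequentially"
      proof (rule uniform_limitI)
        fix e :: real assume e: "e > 0"
        define C where "C = 8 * M * (norm v)\<^sup>2 / r\<^sup>2"
        have est: "norm (q n w - cderiv f w v) \<le> C / N n" if w: "w \<in> cball z t" for n w
        proof -
          let ?u = "complex_of_real (1 / N n) *s v"
          have wb: "w \<in> ball z0 r" using t w by blast
          then have w\<Omega>: "cball w r \<subseteq> \<Omega>" using sub s(2) by blast
          then have w1: "w \<in> \<Omega>" using r by auto
          have "norm (f (w + ?u) - f w - cderiv f w ?u) \<le> 8 * M * (norm ?u)\<^sup>2 / r\<^sup>2"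
            using sub[OF wb] M by (intro second_order_estimate[OF f w\<Omega> r _ Nv]) blast
          then have "N n * norm (f (w + ?u) - f w - cderiv f w ?u) \<le> N n * (8 * M * (norm ?u)\<^sup>2 / r\<^sup>2)"
            using Npos[of n] by (intro mult_left_mono) auto
          also have "N n * (8 * M * (norm ?u)\<^sup>2 / r\<^sup>2) = C / N n"
            using Npos[of n] by (simp add: C_def norm_smult_vec norm_divide power2_eq_square field_simps)
          also have "N n * norm (f (w + ?u) - f w - cderiv f w ?u) = norm (of_real (N n) * (f (w + ?u) - f w - cderiv f w ?u))"
            using Npos[of n] by (simp add: norm_mult)
          also have "of_real (N n) * (f (w + ?u) - f w - cderiv f w ?u) = q n w - cderiv f w v"
            using Npos[of n] holomorphic_fun_cderiv(2)[OF f w1, of "complex_of_real (1 / N n)" v]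
            by (simp add: q_def right_diff_distrib)
          finally show ?thesis .
        qed
        have "(\<lambda>n. C / N n) \<longlonglongrightarrow> 0"
          unfolding N_def by real_asymp
        then have "\<forall>\<^sub>F n in sequentially. C / N n < e" using e by (rule order_tendstoD(2))
        then show "\<forall>\<^sub>F n in sequentially. \<forall>w\<in>cball z t. dist (q n w) (cderiv f w v) < e"
        proof eventually_elim
          case (elim n)
          then show ?case using est[of _ n] le_less_trans unfolding dist_norm by blast
        qed
      qed
      with t show "\<exists>r'>0. cball z r' \<subseteq> ball z0 r \<and> uniform_limit (cball z r') q (\<lambda>z. cderiv f z v) sequentially"
        by blast
    qed
    with r show ?thesis by blast
  qed
  then show ?thesis unfolding holomorphic_fun_def by (meson centre_in_ball)
qed

text \<open>
  The interior of the zero set is closed in \<open>\<Omega>\<close>: a boundary point lies in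
  a ball around some point \<open>y\<close> of it, and the identity theorem in one variable on
  the complex lines through \<open>y\<close> makes \<open>f\<close> vanish on that ball.
\<close>

lemma holomorphic_fun_identity:
  fixes f :: "complex ^ 'n \<Rightarrow> complex"
  assumes f: "holomorphic_fun \<Omega> f" and \<Omega>: "open \<Omega>" "connected \<Omega>"
    and U: "open U" "U \<noteq> {}" "U \<subseteq> \<Omega>" "\<And>z. z \<in> U \<Longrightarrow> f z = 0" and z: "z \<in> \<Omega>"
  shows "f z = 0"
proof -
  define Z where "Z = interior {z \<in> \<Omega>. f z = 0}"
  have Z0: "f z = 0" "z \<in> \<Omega>" if "z \<in> Z" for z
    using that interior_subset[of "{z \<in> \<Omega>. f z = 0}"] by (auto simp: Z_def)
  have "openin (top_of_set \<Omega>) Z"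
  proof -
    have "open Z" by (simp add: Z_def)
    moreover have "Z \<subseteq> \<Omega>" using Z0(2) by blast
    ultimately show ?thesis by (simp add: open_subset)
  qed
  moreover have "closedin (top_of_set \<Omega>) Z"
    unfolding closedin_limpt
  proof (intro conjI allI impI)
    show "Z \<subseteq> \<Omega>" using Z0(2) by blast
    fix x assume x: "x islimpt Z \<and> x \<in> \<Omega>"
    obtain r where r: "r > 0" "ball x r \<subseteq> \<Omega>" using \<Omega>(1) x open_contains_ball by blast
    obtain y where y: "y \<in> Z" "dist y x < r / 2"
      using x r(1) unfolding islimpt_approachable by (meson half_gt_zero)
    have yb: "ball y (r / 2) \<subseteq> \<Omega>"
    proof
      fix w assume "w \<in> ball y (r / 2)"
      then have "w \<in> ball x r"
        using y dist_triangle[of x w y] by (simp add: dist_commute)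
      then show "w \<in> \<Omega>" using r by blast
    qed
    obtain e where e: "e > 0" "ball y e \<subseteq> Z"
      using y(1) open_contains_ball[of Z] by (auto simp: Z_def)
    have "f w = 0" if w: "w \<in> ball y (r / 2)" for w
    proof (cases "w = y")
      case True then show ?thesis using Z0 y by simp
    next
      case False
      let ?v = "w - y"
      let ?R = "r / 2 / norm ?v"
      have nv: "norm ?v > 0" using False by simp
      have R: "?R > 1" using w nv by (simp add: dist_norm norm_minus_commute field_simps)
      have "f (y + 1 *s ?v) = 0"
      proof (rule analytic_continuation_open[of "ball 0 (min ?R (e / norm ?v))" "ball 0 ?R" "\<lambda>\<zeta>. f (y + \<zeta> *s ?v)" "\<lambda>_. 0"])
        show "(\<lambda>\<zeta>. f (y + \<zeta> *s ?v)) holomorphic_on ball 0 ?R"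
        proof (rule holomorphic_on_line[OF f])
          fix \<zeta> :: complex assume "\<zeta> \<in> ball 0 ?R"
          then have "y + \<zeta> *s ?v \<in> ball y (r / 2)"
            using nv by (intro line_in_ball) (simp add: pos_less_divide_eq)
          then show "y + \<zeta> *s ?v \<in> \<Omega>" using yb by blast
        qed
        show "f (y + \<zeta> *s ?v) = 0" if "\<zeta> \<in> ball 0 (min ?R (e / norm ?v))" for \<zeta>
        proof -
          have "y + \<zeta> *s ?v \<in> ball y e"
            using that nv by (intro line_in_ball) (simp add: pos_less_divide_eq)
          then show ?thesis using e Z0 by blast
        qed
        have "0 \<in> ball (0::complex) (min ?R (e / norm ?v))" using r(1) e nv by simp
        then show "ball (0::complex) (min ?R (e / norm ?v)) \<noteq> {}" by blast
        show "1 \<in> ball (0::complex) ?R" using R by (simp only: mem_ball dist_norm) simp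
      qed auto
      then show ?thesis by simp
    qed
    then have "ball y (r / 2) \<subseteq> {z \<in> \<Omega>. f z = 0}" using yb by blast
    then have "ball y (r / 2) \<subseteq> Z" unfolding Z_def by (intro interior_maximal) auto
    then show "x \<in> Z" using y by auto
  qed
  moreover have "U \<subseteq> Z" unfolding Z_def using U by (intro interior_maximal) auto
  ultimately have "Z = \<Omega>" using \<Omega>(2) U(2) unfolding connected_clopen by blast
  then show ?thesis using Z0(1) z by blast
qed

text \<open>
  On a small disc through the origin \<open>f\<close> is constant along a circle, hence
  constant on the disc by the identity theorem in one variable. The discs fill a ball, and the
  identity theorem propagates the value to \<open>\<Omega>\<close>.
\<close>

lemma rotation_invariant_holomorphic_constant:
  fixes f :: "complex ^ 'n \<Rightarrow> complex"
  assumes f: "holomorphic_fun \<Omega> f" and \<Omega>: "open \<Omega>" "connected \<Omega>" "0 \<in> \<Omega>"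
    and inv: "\<And>z c. z \<in> \<Omega> \<Longrightarrow> norm c = 1 \<Longrightarrow> f (c *s z) = f z" and z: "z \<in> \<Omega>"
  shows "f z = f 0"
proof -
  obtain r where r: "r > 0" "ball 0 r \<subseteq> \<Omega>" using \<Omega> open_contains_ball by blast
  have "f w - f 0 = 0" if w: "w \<in> ball 0 r" for w
  proof (cases "w = 0")
    case False
    let ?R = "r / norm w"
    let ?h = "\<lambda>\<zeta>. f (0 + \<zeta> *s w)"
    have R: "?R > 1" using w False by (simp add: field_simps)
    have in_\<Omega>: "0 + \<zeta> *s w \<in> \<Omega>" if "\<zeta> \<in> ball 0 ?R" for \<zeta>
    proof -
      have "0 + \<zeta> *s w \<in> ball 0 r" using that False by (simp add: norm_smult_vec field_simps)
      then show ?thesis using r by blast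
    qed
    have hol: "?h holomorphic_on ball 0 ?R" by (rule holomorphic_on_line[OF f in_\<Omega>])
    have lim: "1 islimpt sphere (0::complex) 1"
    proof (rule connected_imp_perfect)
      show "connected (sphere (0::complex) 1)" by (rule connected_sphere) simp
      show "sphere (0::complex) 1 \<noteq> {x}" for x
      proof
        assume *: "sphere (0::complex) 1 = {x}"
        have "-1 \<in> sphere (0::complex) 1" "1 \<in> sphere (0::complex) 1" by simp_all
        then have "x = 1" "x = -1" unfolding * by simp_all
        then show False by simp
      qed
    qed simp
    have "(\<lambda>\<zeta>. ?h \<zeta> - ?h 1) 0 = 0"
    proof (rule analytic_continuation[where f = "\<lambda>\<zeta>. ?h \<zeta> - ?h 1", OF _ open_ball connected_ball _ _ lim])
      show "(\<lambda>\<zeta>. ?h \<zeta> - ?h 1) holomorphic_on ball 0 ?R"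
        by (intro holomorphic_intros hol)
      show "sphere (0::complex) 1 \<subseteq> ball 0 ?R" "1 \<in> ball (0::complex) ?R" "0 \<in> ball (0::complex) ?R"
        using R by auto
      have "w \<in> \<Omega>" using w r by blast
      then show "?h \<zeta> - ?h 1 = 0" if "\<zeta> \<in> sphere 0 1" for \<zeta> using inv that by simp
    qed
    then show ?thesis by simp
  qed simp
  then have "\<And>w. w \<in> ball 0 r \<Longrightarrow> f w - f 0 = 0" .
  moreover have "ball (0 :: complex ^ 'n) r \<noteq> {}" using r(1) by simp
  ultimately have "f z - f 0 = 0"
    using holomorphic_fun_identity[OF holomorphic_fun_diff[OF f holomorphic_fun_const[of _ "f 0"]] \<Omega>(1,2) open_ball _ r(2) _ z]
    by presburger
  then show ?thesis by simp
qed

section \<open>The complex Jacobian and change of variables\<close>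

text \<open>
  A bijection between the standard bases extends to a linear isometry that maps boxes to boxes
  of the same volume.
\<close>

lemma ex_lborel_isometry:
  assumes "DIM('a::euclidean_space) = DIM('b::euclidean_space)"
  shows "\<exists>f :: 'a \<Rightarrow> 'b. linear f \<and> (\<forall>x. norm (f x) = norm x) \<and> surj f \<and> distr lborel borel f = lborel"
proof -
  obtain \<pi> where \<pi>: "bij_betw \<pi> (Basis :: 'a set) (Basis :: 'b set)"
    using assms finite_same_card_bij[OF finite_Basis finite_Basis] by metis
  define f where "f = (\<lambda>x :: 'a. \<Sum>b\<in>Basis. (x \<bullet> b) *\<^sub>R \<pi> b)"
  define f' where "f' = (\<lambda>y :: 'b. \<Sum>b\<in>Basis. (y \<bullet> \<pi> b) *\<^sub>R b)"
  have \<pi>B: "\<pi> b \<in> Basis" if "b \<in> Basis" for b using \<pi> that by (auto simp: bij_betw_def)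
  have \<pi>inj: "\<pi> b = \<pi> c \<longleftrightarrow> b = c" if "b \<in> Basis" "c \<in> Basis" for b c
    using \<pi> that by (auto simp: bij_betw_def inj_on_def)
  have f_coord: "f x \<bullet> \<pi> b = x \<bullet> b" if b: "b \<in> Basis" for x b
  proof -
    have "f x \<bullet> \<pi> b = (\<Sum>c\<in>Basis. (x \<bullet> c) * (if c = b then 1 else 0))"
      unfolding f_def inner_sum_left using b by (intro sum.cong) (auto simp: inner_Basis \<pi>B \<pi>inj)
    also have "\<dots> = x \<bullet> b" using b by (simp add: if_distrib cong: if_cong)
    finally show ?thesis .
  qed
  have f'_coord: "f' y \<bullet> b = y \<bullet> \<pi> b" if "b \<in> Basis" for y b
    using that by (simp add: f'_def inner_sum_left inner_Basis if_distrib cong: if_cong)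
  have ff': "f (f' y) = y" for y
  proof (rule euclidean_eqI)
    fix c :: 'b assume "c \<in> Basis"
    then have "c \<in> \<pi> ` Basis" using \<pi> by (simp add: bij_betw_def)
    then obtain b where "b \<in> Basis" "c = \<pi> b" by blast
    then show "f (f' y) \<bullet> c = y \<bullet> c" by (simp add: f_coord f'_coord)
  qed
  have lin: "linear f"
    unfolding f_def by (intro linearI) (simp_all add: inner_add_left scaleR_add_left sum.distrib scaleR_sum_right)
  have f_expand: "f y = (\<Sum>b\<in>Basis. (y \<bullet> b) *\<^sub>R \<pi> b)" for y by (simp add: f_def)
  have inner_f: "f x \<bullet> f y = x \<bullet> y" for x y
  proof -
    have "f x \<bullet> f y = (\<Sum>b\<in>Basis. (y \<bullet> b) * (f x \<bullet> \<pi> b))"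
      by (simp add: f_expand[of y] inner_sum_right)
    also have "\<dots> = (\<Sum>b\<in>Basis. (x \<bullet> b) * (y \<bullet> b))" by (simp add: f_coord mult.commute)
    also have "\<dots> = x \<bullet> y" by (rule euclidean_inner[symmetric])
    finally show ?thesis .
  qed
  have meas: "f \<in> borel_measurable borel"
    using lin by (intro borel_measurable_continuous_onI linear_continuous_on) (simp add: linear_conv_bounded_linear)
  have "lborel = distr lborel borel f"
  proof (rule lborel_eqI)
    fix l u :: 'b assume le: "\<And>b. b \<in> Basis \<Longrightarrow> l \<bullet> b \<le> u \<bullet> b"
    have vim: "f -` box l u = box (f' l) (f' u)"
    proof (intro set_eqI iffI)
      fix x assume "x \<in> f -` box l u"
      then show "x \<in> box (f' l) (f' u)" by (auto simp: mem_box f'_coord \<pi>B simp flip: f_coord[of _ x])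
    next
      fix x assume x: "x \<in> box (f' l) (f' u)"
      have "l \<bullet> c < f x \<bullet> c \<and> f x \<bullet> c < u \<bullet> c" if "c \<in> Basis" for c
      proof -
        have "c \<in> \<pi> ` Basis" using \<pi> that by (simp add: bij_betw_def)
        then obtain b where "b \<in> Basis" "c = \<pi> b" by blast
        then show ?thesis using x by (auto simp: mem_box f'_coord f_coord)
      qed
      then show "x \<in> f -` box l u" by (simp add: mem_box)
    qed
    have "emeasure (distr lborel borel f) (box l u) = emeasure lborel (box (f' l) (f' u))"
      using meas by (simp add: emeasure_distr vim)
    also have "\<dots> = (\<Prod>b\<in>Basis. (f' u - f' l) \<bullet> b)"
      by (rule emeasure_lborel_box) (simp add: f'_coord le \<pi>B)
    also have "(\<Prod>b\<in>Basis. (f' u - f' l) \<bullet> b) = (\<Prod>b\<in>Basis. (u - l) \<bullet> \<pi> b)"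
      by (intro prod.cong) (simp_all add: inner_diff_left f'_coord)
    also have "\<dots> = (\<Prod>c\<in>Basis. (u - l) \<bullet> c)"
      by (rule prod.reindex_bij_betw[OF \<pi>])
    finally show "emeasure (distr lborel borel f) (box l u) = (\<Prod>b\<in>Basis. (u - l) \<bullet> b)" .
  qed simp
  then show ?thesis
    using lin inner_f ff' by (intro exI[of _ f]) (simp add: norm_eq_sqrt_inner surjI[of f f'])
qed

text \<open>
  Real coordinates on \<open>\<complex>\<^sup>n\<close>. The index type \<open>'n bit0\<close>
  has \<open>2 n\<close> elements and is well ordered, as the change of variables formula for
  real vectors demands.
\<close>

definition real_coords :: "real ^ ('n::finite) bit0 \<Rightarrow> complex ^ 'n" where
  "real_coords = (SOME f. linear f \<and> (\<forall>x. norm (f x) = norm x) \<and> surj f \<and> distr lborel borel f = lborel)"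

lemma
  shows linear_real_coords: "linear real_coords"
    and norm_real_coords [simp]: "norm (real_coords x) = norm x"
    and surj_real_coords: "surj real_coords"
    and distr_real_coords: "distr lborel borel real_coords = lborel"
proof -
  have "DIM(real ^ 'n bit0) = DIM(complex ^ 'n)" by simp
  from someI_ex[OF ex_lborel_isometry[OF this]] show "linear real_coords" "norm (real_coords x) = norm x"
    "surj real_coords" "distr lborel borel real_coords = lborel"
    unfolding real_coords_def by blast+
qed

lemma inj_real_coords: "inj real_coords"
  using linear_injective_0[OF linear_real_coords] norm_real_coords by (metis norm_eq_zero)

lemma real_coords_inv [simp]: "real_coords (inv real_coords y) = y" "inv real_coords (real_coords x) = x"
  by (simp_all add: surj_f_inv_f[OF surj_real_coords] inv_f_f[OF inj_real_coords])

lemma linear_inv_real_coords: "linear (inv real_coords)"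
proof (intro linearI injD[OF inj_real_coords])
qed (simp_all add: linear_add[OF linear_real_coords] linear_scale[OF linear_real_coords])

lemma norm_inv_real_coords [simp]: "norm (inv real_coords y) = norm y"
  using norm_real_coords[of "inv real_coords y"] by simp

text \<open>
  The factor by which a real linear map of \<open>\<complex>\<^sup>n\<close> scales the
  volume. For complex linear maps it turns out to be the squared modulus of the complex
  determinant; the proof uses only that it is multiplicative and known for isometries and for
  real homotheties.
\<close>

definition real_det :: "(complex ^ 'n \<Rightarrow> complex ^ 'n) \<Rightarrow> real" where
  "real_det L = \<bar>det (matrix (inv real_coords \<circ> L \<circ> real_coords))\<bar>"

lemma real_det_comp:
  assumes "linear L" "linear M" shows "real_det (L \<circ> M) = real_det L * real_det M"
proof -
  have "inv real_coords \<circ> (L \<circ> M) \<circ> real_coords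
      = (inv real_coords \<circ> L \<circ> real_coords) \<circ> (inv real_coords \<circ> M \<circ> real_coords)"
    by auto
  then show ?thesis
    using assms unfolding real_det_def
    by (simp add: matrix_compose linear_compose linear_real_coords linear_inv_real_coords det_mul abs_mult)
qed

lemma real_det_isometry:
  assumes "linear L" "\<And>x. norm (L x) = norm x" shows "real_det L = 1"
proof -
  have "orthogonal_transformation (inv real_coords \<circ> L \<circ> real_coords)"
    unfolding orthogonal_transformation using assms
    by (intro conjI allI linear_compose linear_real_coords linear_inv_real_coords) simp_all
  then show ?thesis by (simp add: real_det_def)
qed

lemma real_det_id: "real_det (\<lambda>x. x) = 1"
  by (rule real_det_isometry) (auto intro: linear_ident)

lemma real_det_scale: "real_det ((*\<^sub>R) r :: complex ^ 'n \<Rightarrow> _) = \<bar>r\<bar> ^ (2 * CARD('n))"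
proof -
  have *: "inv real_coords \<circ> (*\<^sub>R) r \<circ> real_coords = ((*\<^sub>R) r :: real ^ 'n bit0 \<Rightarrow> _)"
    by (auto simp: linear_scale[OF linear_inv_real_coords])
  show ?thesis
    unfolding real_det_def * det_matrix_scaleR by (simp add: power_abs)
qed

lemma linear_matrix_vector_mult: "linear ((*v) A)" for A :: "complex ^ 'n ^ 'm"
  by (intro linearI) (simp_all add: matrix_vector_right_distrib, simp add: vec_eq_iff matrix_vector_mult_def scaleR_sum_right)

text \<open>
  The linear map whose matrix is the identity with column \<open>j\<close> replaced by
  \<open>v\<close>. Gaussian elimination writes every invertible matrix as a product of such
  matrices.
\<close>

definition column_shear :: "'n \<Rightarrow> complex ^ 'n \<Rightarrow> complex ^ 'n \<Rightarrow> complex ^ 'n" where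
  "column_shear j v x = x + x $ j *s (v - axis j 1)"

lemma linear_column_shear: "linear (column_shear j v)"
  by (intro linearI) (simp_all add: column_shear_def vec_eq_iff algebra_simps)

lemma column_shear_comp:
  "column_shear j v \<circ> column_shear j w = column_shear j (w + w $ j *s (v - axis j 1))"
  by (auto simp: column_shear_def vec_eq_iff axis_def algebra_simps)

lemma column_shear_id: "column_shear j (axis j 1) = (\<lambda>x. x)"
  by (auto simp: column_shear_def)

text \<open>
  Conjugation with the doubling of coordinate \<open>j\<close> replaces \<open>u\<close> by
  \<open>2 u\<close>, and so does composing the map with itself. Hence the nonzero volume
  factor is equal to its own square.
\<close>

lemma real_det_column_shear_unipotent:
  fixes u :: "complex ^ 'n"
  assumes u: "u $ j = 0" shows "real_det (column_shear j (axis j 1 + u)) = 1"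
proof -
  let ?E = "column_shear j" and ?d = "\<lambda>v. real_det (column_shear j v)"
  note comp = real_det_comp[OF linear_column_shear[of j] linear_column_shear[of j], unfolded column_shear_comp]
  have "?E (axis j (1/2)) \<circ> ?E (axis j 2) = ?E (axis j 1)"
    unfolding column_shear_comp by (rule arg_cong[where f="column_shear j"]) (simp add: vec_eq_iff axis_def)
  then have d1: "?d (axis j (1/2)) * ?d (axis j 2) = 1"
    using real_det_comp[OF linear_column_shear[of j "axis j (1/2)"] linear_column_shear[of j "axis j 2"]]
    by (simp add: column_shear_id real_det_id)
  have "?E (axis j (1/2)) \<circ> (?E (axis j 1 + u) \<circ> ?E (axis j 2)) = ?E (axis j 1 + u) \<circ> ?E (axis j 1 + u)"
    unfolding column_shear_comp using u
    by (intro arg_cong[where f="column_shear j"]) (simp add: vec_eq_iff axis_def)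
  then have "?d (axis j (1/2)) * (?d (axis j 1 + u) * ?d (axis j 2)) = ?d (axis j 1 + u) * ?d (axis j 1 + u)"
    by (metis real_det_comp linear_column_shear linear_compose)
  then have "?d (axis j 1 + u) * (?d (axis j (1/2)) * ?d (axis j 2)) = ?d (axis j 1 + u) * ?d (axis j 1 + u)"
    by (simp only: mult_ac)
  then have *: "?d (axis j 1 + u) = ?d (axis j 1 + u) * ?d (axis j 1 + u)"
    unfolding d1 by simp
  have "?E (axis j 1 + u) \<circ> ?E (axis j 1 - u) = ?E (axis j 1)"
    unfolding column_shear_comp using u
    by (intro arg_cong[where f="column_shear j"]) (simp add: vec_eq_iff axis_def)
  then have "?d (axis j 1 + u) * ?d (axis j 1 - u) = 1"
    using real_det_comp[OF linear_column_shear[of j "axis j 1 + u"] linear_column_shear[of j "axis j 1 - u"]]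
    by (simp add: column_shear_id real_det_id)
  then have "?d (axis j 1 + u) \<noteq> 0" by auto
  with * show ?thesis by simp
qed

text \<open>
  The scalings of the single coordinates are conjugate to each other by swaps of coordinates,
  which are isometries, so they share one volume factor. Their product is the homothety by
  \<open>r\<close>, with factor \<open>r ^ (2 n)\<close>.
\<close>

lemma real_det_scale_coordinate:
  fixes j :: "'n :: finite"
  assumes r: "r > 0" shows "real_det (column_shear j (axis j (complex_of_real r))) = r\<^sup>2"
proof -
  define S where "S = (\<lambda>k :: 'n. column_shear k (axis k (complex_of_real r)))"
  have S: "S k x $ i = (if i = k then of_real r * x $ i else x $ i)" for k x i
    by (simp add: S_def column_shear_def axis_def algebra_simps)
  have linS: "linear (S k)" for k unfolding S_def by (rule linear_column_shear)
  have eq: "real_det (S k) = real_det (S j)" for k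
  proof -
    define \<sigma> where "\<sigma> = (\<lambda>x :: complex ^ 'n. \<chi> i. x $ Transposition.transpose j k i)"
    have lin\<sigma>: "linear \<sigma>" by (intro linearI) (simp_all add: \<sigma>_def vec_eq_iff)
    have "norm (\<sigma> x) = norm x" for x
      unfolding norm_vec_def L2_set_def \<sigma>_def
      using sum.reindex_bij_betw[OF bij_transpose, of "\<lambda>i. (norm (x $ i))\<^sup>2" j k]
      by simp
    then have d\<sigma>: "real_det \<sigma> = 1" by (intro real_det_isometry lin\<sigma>)
    have "S k = \<sigma> \<circ> (S j \<circ> \<sigma>)"
      by (auto simp: fun_eq_iff vec_eq_iff S \<sigma>_def Transposition.transpose_def)
    then show ?thesis by (simp add: real_det_comp lin\<sigma> linS linear_compose d\<sigma>)
  qed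
  define R where "R = (\<lambda>A (x :: complex ^ 'n). \<chi> i. if i \<in> A then of_real r * x $ i else x $ i)"
  have "linear (R A) \<and> real_det (R A) = real_det (S j) ^ card A" if "finite A" for A
    using that
  proof (induction A rule: finite_induct)
    case empty
    have "R {} = (\<lambda>x. x)" by (auto simp: R_def)
    then show ?case by (simp add: real_det_id linear_ident)
  next
    case (insert k A)
    have "R (insert k A) = S k \<circ> R A" using insert.hyps by (auto simp: R_def fun_eq_iff vec_eq_iff S)
    moreover have "linear (S k \<circ> R A)" using insert.IH linear_compose[OF _ linS] by blast
    moreover have "real_det (S k \<circ> R A) = real_det (S j) ^ card (insert k A)"
      using insert.IH insert.hyps real_det_comp[OF linS, of "R A" k] by (simp only: eq[of k]) simp
    ultimately show ?case by (simp only: simp_thms)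
  qed
  then have "real_det (R UNIV) = real_det (S j) ^ CARD('n)" by simp
  moreover have "R UNIV = (*\<^sub>R) r"
    by (simp add: R_def fun_eq_iff vec_eq_iff scaleR_conv_of_real[where 'a=complex])
  ultimately have "real_det (S j) ^ CARD('n) = (r\<^sup>2) ^ CARD('n)"
    using r by (simp add: real_det_scale power_mult)
  then have "real_det (S j) = r\<^sup>2"
    by (rule power_eq_imp_eq_base) (auto simp: real_det_def)
  then show ?thesis by (simp add: S_def)
qed

text \<open>
  The shear is the product of a unipotent one, a rotation of coordinate \<open>j\<close> by
  the phase of \<open>v $ j\<close>, and a real scaling of that coordinate.
\<close>

lemma real_det_column_shear:
  fixes v :: "complex ^ 'n"
  assumes "v $ j \<noteq> 0" shows "real_det (column_shear j v) = (cmod (v $ j))\<^sup>2"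
proof -
  define c where "c = v $ j"
  define r where "r = cmod c"
  define u where "u = inverse c *s (v - axis j c)"
  have c: "c \<noteq> 0" "r > 0" using assms by (auto simp: c_def r_def)
  let ?E = "column_shear j"
  have "?E v = ?E (axis j 1 + u) \<circ> (?E (axis j (c / of_real r)) \<circ> ?E (axis j (of_real r)))"
    unfolding column_shear_comp using c
    by (intro arg_cong[where f="column_shear j"]) (auto simp: vec_eq_iff axis_def u_def c_def field_simps)
  moreover have "real_det (?E (axis j (c / of_real r))) = 1"
  proof (rule real_det_isometry[OF linear_column_shear])
    fix x
    have "?E (axis j (c / of_real r)) x $ i = (if i = j then c / of_real r * x $ i else x $ i)" for i
      by (simp add: column_shear_def axis_def algebra_simps)
    then have "norm (?E (axis j (c / of_real r)) x $ i) = norm (x $ i)" for i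
      using c by (simp add: norm_mult norm_divide r_def)
    then show "norm (?E (axis j (c / of_real r)) x) = norm x" by (simp add: norm_vec_def)
  qed
  moreover have "real_det (?E (axis j 1 + u)) = 1"
    by (rule real_det_column_shear_unipotent) (simp add: u_def c_def)
  ultimately show ?thesis
    using real_det_scale_coordinate[OF c(2), of j]
    by (simp add: real_det_comp linear_column_shear linear_compose r_def c_def)
qed

definition column_matrix :: "'n \<Rightarrow> complex ^ 'n \<Rightarrow> complex ^ 'n ^ 'n" where
  "column_matrix j v = (\<chi> k l. if l = j then v $ k else mat 1 $ k $ l)"

lemma column_matrix_vector_mult: "(*v) (column_matrix j v) = column_shear j v"
proof (intro ext, subst vec_eq_iff, intro allI)
  fix x k
  have "(column_matrix j v *v x) $ k = (\<Sum>l\<in>UNIV. (if l = j then (v $ k - (if k = j then 1 else 0)) * x $ l else 0) + (if l = k then x $ l else 0))"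
    unfolding matrix_vector_mult_def column_matrix_def vec_lambda_beta
    by (intro sum.cong refl) (simp add: mat_def algebra_simps)
  then show "(column_matrix j v *v x) $ k = column_shear j v x $ k"
    by (simp add: sum.distrib column_shear_def axis_def algebra_simps)
qed

lemma det_column_matrix: "det (column_matrix j v) = v $ j"
  using cramer_lemma[of j "mat 1" v] by (simp only: column_matrix_def matrix_vector_mul_lid det_I mult_1_right)

text \<open>
  Gaussian elimination. The set \<open>R\<close> contains the columns that may still differ
  from those of the identity; splitting off a column matrix on the left removes one element
  from it.
\<close>

lemma real_det_matrix:
  fixes A :: "complex ^ 'n ^ 'n"
  assumes "det A \<noteq> 0" shows "real_det ((*v) A) = (cmod (det A))\<^sup>2"
proof -
  have mult: "real_det ((*v) (A ** B)) = real_det ((*v) A) * real_det ((*v) B)" for A B :: "complex ^ 'n ^ 'n"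
    using real_det_comp[OF linear_matrix_vector_mult[of A] linear_matrix_vector_mult[of B]]
    by (simp add: matrix_vector_mult_matrix_matrix_mult_compose)
  have col: "real_det ((*v) (column_matrix j v)) = (cmod (v $ j))\<^sup>2" if "v $ j \<noteq> 0" for j and v :: "complex ^ 'n"
    by (simp add: column_matrix_vector_mult real_det_column_shear that)
  have main: "\<forall>A :: complex ^ 'n ^ 'n. det A \<noteq> 0 \<longrightarrow> (\<forall>s. s \<notin> R \<longrightarrow> A *v axis s 1 = axis s 1) \<longrightarrow>
      real_det ((*v) A) = (cmod (det A))\<^sup>2" if "finite R" for R :: "'n set"
    using that
  proof (induction R rule: finite_induct)
    case empty
    show ?case
    proof (intro allI impI)
      fix A :: "complex ^ 'n ^ 'n" assume "\<forall>s. s \<notin> {} \<longrightarrow> A *v axis s 1 = axis s 1"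
      moreover have "(A *v axis s 1) $ i = A $ i $ s" for s i
        by (simp add: matrix_vector_mult_def axis_def if_distrib cong: if_cong)
      ultimately have "A $ i $ s = axis s 1 $ i" for i s by (metis empty_iff)
      then have "A = mat 1" by (simp add: vec_eq_iff mat_def axis_def)
      then have "(*v) A = (\<lambda>x. x)" by (simp add: fun_eq_iff)
      with \<open>A = mat 1\<close> show "real_det ((*v) A) = (cmod (det A))\<^sup>2" by (simp add: real_det_id)
    qed
  next
    case (insert j R)
    \<comment> \<open>A nonzero pivot: the column matrix with column \<open>j\<close> of \<open>A\<close>
      splits off on the left.\<close>
    have step: "real_det ((*v) A) = (cmod (det A))\<^sup>2"
      if A: "det A \<noteq> 0" "\<And>s. s \<notin> insert j R \<Longrightarrow> A *v axis s 1 = axis s 1" and Aj: "(A *v axis j 1) $ j \<noteq> 0"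
      for A :: "complex ^ 'n ^ 'n"
    proof -
      let ?M = "column_matrix j (A *v axis j 1)"
      have dM: "det ?M \<noteq> 0" using Aj by (simp add: det_column_matrix)
      then obtain N where N: "?M ** N = mat 1" "N ** ?M = mat 1"
        using invertible_det_nz[of ?M] unfolding invertible_def by blast
      have AN: "?M ** (N ** A) = A" using N by (simp add: matrix_mul_assoc)
      then have dNA: "det A = det ?M * det (N ** A)" by (metis det_mul)
      have "(N ** A) *v axis s 1 = axis s 1" if s: "s \<notin> R" for s
      proof -
        have "?M *v axis s 1 = A *v axis s 1"
          using s A(2)[of s] by (cases "s = j") (auto simp: column_matrix_vector_mult column_shear_def axis_def)
        then have "N *v (A *v axis s 1) = N *v (?M *v axis s 1)" by simp
        then show ?thesis using N by (simp add: matrix_vector_mul_assoc)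
      qed
      moreover have "det (N ** A) \<noteq> 0" using dNA A(1) by auto
      ultimately have "real_det ((*v) (N ** A)) = (cmod (det (N ** A)))\<^sup>2" using insert.IH by blast
      then have "real_det ((*v) (?M ** (N ** A))) = (cmod (det ?M))\<^sup>2 * (cmod (det (N ** A)))\<^sup>2"
        using col[OF Aj] by (simp add: mult det_column_matrix)
      then show ?thesis unfolding AN dNA by (simp add: norm_mult power_mult_distrib)
    qed
    show ?case
    proof (intro allI impI)
      fix A :: "complex ^ 'n ^ 'n"
      assume A: "det A \<noteq> 0" "\<forall>s. s \<notin> insert j R \<longrightarrow> A *v axis s 1 = axis s 1"
      show "real_det ((*v) A) = (cmod (det A))\<^sup>2"
      proof (cases "(A *v axis j 1) $ j = 0")
        case False then show ?thesis using step A by blast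
      next
        case True
        \<comment> \<open>With zero entries in all rows of \<open>insert j R\<close>, column \<open>j\<close>
          would be a combination of the finished columns, and \<open>A\<close> would have a
          kernel.\<close>
        obtain i where i: "i \<in> insert j R" "(A *v axis j 1) $ i \<noteq> 0"
        proof -
          define x where "x = axis j 1 - (\<Sum>s\<in>-insert j R. (A *v axis j 1) $ s *s axis s 1)"
          have "(\<Sum>s\<in>-insert j R. (A *v axis j 1) $ s *s axis s 1) $ j = 0"
            unfolding sum_component by (intro sum.neutral) (auto simp: axis_def)
          then have "x $ j = 1" by (simp add: x_def axis_def)
          then have "x \<noteq> 0" by auto
          moreover have "invertible A" using A(1) by (simp add: invertible_det_nz)
          ultimately have "A *v x \<noteq> 0"
            by (metis invertible_def matrix_vector_mul_assoc matrix_vector_mul_lid matrix_vector_mult_0_right)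
          moreover have "A *v x = A *v axis j 1 - (\<Sum>s\<in>-insert j R. (A *v axis j 1) $ s *s axis s 1)"
            unfolding x_def matrix_vector_mult_diff_distrib
            using A(2) by (simp add: linear_sum[OF linear_matrix_vector_mult] vector_scalar_commute)
          ultimately obtain i where "(A *v axis j 1) $ i \<noteq> (\<Sum>s\<in>-insert j R. (A *v axis j 1) $ s *s axis s 1) $ i"
            by (auto simp: vec_eq_iff)
          moreover have "(\<Sum>s\<in>-insert j R. (A *v axis j 1) $ s *s axis s 1) $ i = (if i \<in> -insert j R then (A *v axis j 1) $ i else 0)"
            by (simp add: axis_def if_distrib cong: if_cong)
          ultimately have "i \<in> insert j R" "(A *v axis j 1) $ i \<noteq> 0" by (auto split: if_splits)
          then show thesis by (rule that)
        qed
        have ij: "i \<noteq> j" using i True by auto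
        \<comment> \<open>Adding row \<open>i\<close> to row \<open>j\<close> creates a nonzero pivot and
          leaves the finished columns alone.\<close>
        let ?M = "column_matrix i (axis i 1 + axis j 1)"
        have M: "det ?M = 1" "real_det ((*v) ?M) = 1"
          using ij col[where j=i and v="axis i 1 + axis j 1"] by (auto simp: det_column_matrix axis_def)
        have Mv: "?M *v x = x + x $ i *s axis j 1" for x
          by (simp add: column_matrix_vector_mult column_shear_def)
        have "real_det ((*v) (?M ** A)) = (cmod (det (?M ** A)))\<^sup>2"
        proof (rule step)
          show "det (?M ** A) \<noteq> 0" using M A by (simp add: det_mul)
          show "(?M ** A) *v axis s 1 = axis s 1" if "s \<notin> insert j R" for s
          proof -
            have "s \<noteq> i" using that i by auto
            then have "axis s 1 $ i = (0::complex)" by (simp add: axis_def)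
            then show ?thesis using A(2) that by (simp add: matrix_vector_mul_assoc[symmetric] Mv)
          qed
          show "((?M ** A) *v axis j 1) $ j \<noteq> 0"
            using True i by (simp add: matrix_vector_mul_assoc[symmetric] Mv)
        qed
        then show ?thesis using M by (simp add: mult det_mul)
      qed
    qed
  qed
  then show ?thesis using assms main[of UNIV] by simp
qed

definition cjac :: "(complex ^ 'n \<Rightarrow> complex ^ 'n) \<Rightarrow> complex ^ 'n \<Rightarrow> complex" where
  "cjac g z = det (\<chi> i j. cderiv (\<lambda>z. g z $ i) z (axis j 1))"

text \<open>
  The determinant is a polynomial in the partial derivatives.
\<close>

lemma holomorphic_fun_cjac:
  fixes g :: "complex ^ 'n \<Rightarrow> complex ^ 'n"
  assumes "holomorphic_map \<Omega> g" "open \<Omega>" shows "holomorphic_fun \<Omega> (cjac g)"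
proof -
  have "holomorphic_fun \<Omega> (\<lambda>z. \<Sum>p | p permutes (UNIV :: 'n set).
      of_int (sign p) * (\<Prod>i\<in>UNIV. cderiv (\<lambda>z. g z $ i) z (axis (p i) 1)))"
    using assms unfolding holomorphic_map_def
    by (intro holomorphic_fun_sum holomorphic_fun_cmult holomorphic_fun_prod
        holomorphic_fun_cderiv_direction finite_permutations) auto
  then show ?thesis by (simp add: cjac_def[abs_def] det_def)
qed

lemma complex_linear_sum_axis:
  fixes D :: "complex ^ 'n \<Rightarrow> complex"
  assumes "linear D" "\<And>c v. D (c *s v) = c * D v"
  shows "(\<Sum>j\<in>UNIV. D (axis j 1) * v $ j) = D v"
proof -
  have "v = (\<Sum>j\<in>UNIV. v $ j *s axis j 1)"
    by (simp add: vec_eq_iff axis_def if_distrib cong: if_cong)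
  then have "D v = (\<Sum>j\<in>UNIV. D (v $ j *s axis j 1))"
    by (metis (no_types, lifting) linear_sum[OF assms(1)] sum.cong)
  then show ?thesis by (simp add: assms(2) mult.commute)
qed

lemma holomorphic_map_jacobian_matrix:
  fixes g :: "complex ^ 'n \<Rightarrow> complex ^ 'n"
  assumes g: "holomorphic_map \<Omega> g" and z: "z \<in> \<Omega>"
  shows "(g has_derivative (*v) (\<chi> i j. cderiv (\<lambda>z. g z $ i) z (axis j 1))) (at z)"
proof -
  have gi: "holomorphic_fun \<Omega> (\<lambda>z. g z $ i)" for i using g unfolding holomorphic_map_def by blast
  have "(\<Sum>j\<in>UNIV. cderiv (\<lambda>z. g z $ i) z (axis j 1) * v $ j) = cderiv (\<lambda>z. g z $ i) z v" for i v
    using complex_linear_sum_axis[OF has_derivative_linear[OF holomorphic_fun_cderiv(1)[OF gi z]]]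
      holomorphic_fun_cderiv(2)[OF gi z] by blast
  then have "(*v) (\<chi> i j. cderiv (\<lambda>z. g z $ i) z (axis j 1)) = (\<lambda>v. \<chi> i. cderiv (\<lambda>z. g z $ i) z v)"
    by (simp add: fun_eq_iff vec_eq_iff matrix_vector_mult_def)
  then show ?thesis using holomorphic_map_has_derivative[OF g z] by simp
qed

lemma cjac_compose:
  fixes g h :: "complex ^ 'n \<Rightarrow> complex ^ 'n"
  assumes h: "holomorphic_map S h" and g: "holomorphic_map \<Omega> g" and sub: "g ` \<Omega> \<subseteq> S" and z: "z \<in> \<Omega>"
  shows "cjac (\<lambda>z. h (g z)) z = cjac h (g z) * cjac g z"
proof -
  let ?A = "\<lambda>g z. \<chi> i j. cderiv (\<lambda>z. g z $ i) z (axis j 1)"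
  have "((\<lambda>z. h (g z)) has_derivative (\<lambda>v. ?A h (g z) *v (?A g z *v v))) (at z)"
    using has_derivative_compose[OF holomorphic_map_jacobian_matrix[OF g z] holomorphic_map_jacobian_matrix[OF h]] sub z
    by blast
  moreover have "((\<lambda>z. h (g z)) has_derivative (*v) (?A (\<lambda>z. h (g z)) z)) (at z)"
    by (rule holomorphic_map_jacobian_matrix[OF holomorphic_map_compose[OF h g sub] z])
  ultimately have "(\<lambda>v. ?A h (g z) *v (?A g z *v v)) = (*v) (?A (\<lambda>z. h (g z)) z)"
    by (rule has_derivative_unique)
  then have "?A (\<lambda>z. h (g z)) z *v v = (?A h (g z) ** ?A g z) *v v" for v
    unfolding matrix_vector_mul_assoc[symmetric] by (rule fun_cong[OF sym])
  then have "?A (\<lambda>z. h (g z)) z = ?A h (g z) ** ?A g z"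
    unfolding matrix_eq by blast
  then show ?thesis by (simp add: cjac_def det_mul)
qed

lemma cjac_ident: "cjac (\<lambda>z. z) z = 1"
proof -
  have "cderiv (\<lambda>z. z $ i) z = (\<lambda>v. v $ i)" for i
    by (intro cderiv_unique bounded_linear.has_derivative[OF bounded_linear_vec_nth]) simp
  then have "(\<chi> i j. cderiv (\<lambda>z. z $ i) z (axis j 1)) = mat 1"
    by (simp add: vec_eq_iff mat_def axis_def)
  then show ?thesis by (simp add: cjac_def)
qed

lemma cjac_cong:
  assumes "open \<Omega>" "z \<in> \<Omega>" "\<And>w. w \<in> \<Omega> \<Longrightarrow> g w = h w" "holomorphic_map \<Omega> g"
  shows "cjac g z = cjac h z"
proof -
  have "cderiv (\<lambda>z. h z $ i) z = cderiv (\<lambda>z. g z $ i) z" for i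
  proof (rule cderiv_unique)
    have "((\<lambda>z. g z $ i) has_derivative cderiv (\<lambda>z. g z $ i) z) (at z)"
      using assms unfolding holomorphic_map_def by (intro holomorphic_fun_cderiv(1)) auto
    then show "((\<lambda>z. h z $ i) has_derivative cderiv (\<lambda>z. g z $ i) z) (at z)"
      by (rule has_derivative_transform_within_open[OF _ assms(1,2)]) (simp add: assms(3))
  qed
  then show ?thesis by (simp add: cjac_def)
qed

text \<open>
  The real change of variables formula in the coordinates \<open>real_coords\<close>, with the
  real Jacobian rewritten through the complex one.
\<close>

lemma emeasure_biholomorphic_image:
  fixes g :: "complex ^ 'n \<Rightarrow> complex ^ 'n"
  assumes g: "holomorphic_map \<Omega> g" and \<Omega>: "open \<Omega>" and inj: "inj_on g \<Omega>"
    and nz: "\<And>z. z \<in> \<Omega> \<Longrightarrow> cjac g z \<noteq> 0"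
    and S: "S \<in> sets borel" "S \<subseteq> \<Omega>" and gS: "g ` S \<in> sets borel" "emeasure lborel (g ` S) < \<infinity>"
  shows "(\<integral>\<^sup>+ z. ennreal ((cmod (cjac g z))\<^sup>2) * indicator S z \<partial>lborel) = emeasure lborel (g ` S)"
proof -
  let ?r = "real_coords :: real ^ 'n bit0 \<Rightarrow> complex ^ 'n"
  let ?A = "\<lambda>z. \<chi> i j. cderiv (\<lambda>z. g z $ i) z (axis j 1)"
  have cont: "continuous_on UNIV ?r" "continuous_on UNIV (inv ?r)"
    by (simp_all add: linear_real_coords linear_inv_real_coords linear_continuous_on linear_linear linear_conv_bounded_linear[symmetric])
  have meas [measurable]: "?r \<in> borel_measurable borel" using cont by (intro borel_measurable_continuous_onI)
  have vim: "?r -` T = inv ?r ` T" for T by (force simp: image_iff)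
  define h where "h = inv ?r \<circ> g \<circ> ?r"
  define S' where "S' = ?r -` S"
  have S': "S' \<in> sets borel" unfolding S'_def using S(1) measurable_sets_borel[OF meas] by simp
  have hS': "h ` S' = ?r -` (g ` S)"
    unfolding h_def S'_def vim[of "g ` S"]
    by (simp only: image_comp[symmetric] surj_image_vimage_eq[OF surj_real_coords])
  have em: "emeasure lborel (?r -` T) = emeasure lborel T" if "T \<in> sets borel" for T
  proof -
    have "emeasure lborel T = emeasure (distr lborel borel ?r) T" by (simp add: distr_real_coords)
    also have "\<dots> = emeasure lborel (?r -` T)" using that by (subst emeasure_distr) auto
    finally show ?thesis by simp
  qed
  have hS'_borel: "h ` S' \<in> sets borel" unfolding hS' using gS(1) measurable_sets_borel[OF meas] by simp
  have em_h: "emeasure lborel (h ` S') = emeasure lborel (g ` S)" unfolding hS' by (rule em[OF gS(1)])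
  have lm: "h ` S' \<in> lmeasurable"
    using hS'_borel em_h gS(2) by (simp add: fmeasurable_def)
  define h' where "h' = (\<lambda>x. inv ?r \<circ> ((*v) (?A (?r x))) \<circ> ?r)"
  have der: "(h has_derivative h' x) (at x within S')" if x: "x \<in> S'" for x
  proof -
    have "?r x \<in> \<Omega>" using x S(2) by (auto simp: S'_def)
    then have dg: "(g has_derivative (*v) (?A (?r x))) (at (?r x))" by (rule holomorphic_map_jacobian_matrix[OF g])
    have dr: "(?r has_derivative ?r) (at x within S')"
      by (simp add: linear_imp_has_derivative linear_real_coords)
    have di: "(inv ?r has_derivative inv ?r) (at y)" for y
      by (simp add: linear_imp_has_derivative linear_inv_real_coords)
    show ?thesis unfolding h_def h'_def comp_def
      by (rule has_derivative_compose[OF has_derivative_compose[OF dr dg] di])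
  qed
  have inj_h: "inj_on h S'"
  proof (rule inj_onI)
    fix x y assume xy: "x \<in> S'" "y \<in> S'" "h x = h y"
    then have "g (?r x) = g (?r y)" unfolding h_def comp_def by (metis real_coords_inv(1))
    then have "?r x = ?r y" using inj S(2) xy by (auto simp: S'_def dest: inj_onD)
    then show "x = y" by (metis real_coords_inv(2))
  qed
  have "((\<lambda>x. \<bar>det (matrix (h' x))\<bar>) has_integral measure lebesgue (h ` S')) S'"
  proof -
    have "S' \<in> sets lebesgue" using S' by simp
    from has_measure_differentiable_image[OF this der inj_h] lm show ?thesis by blast
  qed
  then have "integral\<^sup>N lborel (\<lambda>x. ennreal \<bar>det (matrix (h' x))\<bar> * indicator S' x) = ennreal (measure lebesgue (h ` S'))"
    by (intro nn_integral_has_integral_lebesgue') auto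
  also have "ennreal (measure lebesgue (h ` S')) = emeasure lborel (g ` S)"
    using em_h gS(2) hS'_borel emeasure_eq_ennreal_measure[of lborel "h ` S'"] by auto
  also have "integral\<^sup>N lborel (\<lambda>x. ennreal \<bar>det (matrix (h' x))\<bar> * indicator S' x)
      = integral\<^sup>N lborel (\<lambda>x. ennreal ((cmod (cjac g (?r x)))\<^sup>2) * indicator S (?r x))"
  proof (intro nn_integral_cong)
    fix x
    have "\<bar>det (matrix (h' x))\<bar> = (cmod (cjac g (?r x)))\<^sup>2" if "?r x \<in> S"
      using real_det_matrix[of "?A (?r x)"] nz[of "?r x"] that S(2)
      unfolding real_det_def h'_def cjac_def by blast
    then show "ennreal \<bar>det (matrix (h' x))\<bar> * indicator S' x = ennreal ((cmod (cjac g (?r x)))\<^sup>2) * indicator S (?r x)"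
      by (auto simp: S'_def indicator_def)
  qed
  also have "\<dots> = integral\<^sup>N (distr lborel borel ?r) (\<lambda>z. ennreal ((cmod (cjac g z))\<^sup>2) * indicator S z)"
  proof (rule nn_integral_distr[where f="\<lambda>z. ennreal ((cmod (cjac g z))\<^sup>2) * indicator S z", symmetric])
    have "continuous_on \<Omega> (cjac g)" using holomorphic_fun_continuous_on[OF holomorphic_fun_cjac[OF g \<Omega>]] .
    then have "(\<lambda>z. indicator \<Omega> z *\<^sub>R cjac g z) \<in> borel_measurable borel"
      using \<Omega> by (intro borel_measurable_continuous_on_indicator) auto
    then have "(\<lambda>z. ennreal ((cmod (indicator \<Omega> z *\<^sub>R cjac g z))\<^sup>2) * indicator S z) \<in> borel_measurable borel"
      using S(1) by measurable
    moreover have "(\<lambda>z. ennreal ((cmod (indicator \<Omega> z *\<^sub>R cjac g z))\<^sup>2) * indicator S z) = (\<lambda>z. ennreal ((cmod (cjac g z))\<^sup>2) * indicator S z)"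
      using S(2) by (auto simp: fun_eq_iff indicator_def)
    ultimately show "(\<lambda>z. ennreal ((cmod (cjac g z))\<^sup>2) * indicator S z) \<in> borel_measurable (distr lborel borel ?r)"
      by simp
  qed simp
  finally show ?thesis by (simp add: distr_real_coords)
qed

section \<open>Hilbert spaces of functions and Schatten classes\<close>

text \<open>
  The Hilbert spaces on which the operators live. The norm \<open>ip_norm\<close> is derived
  from \<open>ip\<close>, so positivity and definiteness are assumptions on \<open>Re (ip f
  f)\<close>.
\<close>

locale function_hilbert_space =
  fixes H :: "('a \<Rightarrow> complex) set" and ip :: "'a inner_prod"
  assumes zero_mem: "(\<lambda>x. 0) \<in> H"
    and add_mem: "f \<in> H \<Longrightarrow> g \<in> H \<Longrightarrow> (\<lambda>x. f x + g x) \<in> H"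
    and scale_mem: "f \<in> H \<Longrightarrow> (\<lambda>x. c * f x) \<in> H"
    and ip_add_left: "f \<in> H \<Longrightarrow> g \<in> H \<Longrightarrow> h \<in> H \<Longrightarrow> ip (\<lambda>x. f x + g x) h = ip f h + ip g h"
    and ip_scale_left: "f \<in> H \<Longrightarrow> h \<in> H \<Longrightarrow> ip (\<lambda>x. c * f x) h = c * ip f h"
    and ip_commute: "f \<in> H \<Longrightarrow> g \<in> H \<Longrightarrow> ip g f = cnj (ip f g)"
    and ip_nonneg: "f \<in> H \<Longrightarrow> 0 \<le> Re (ip f f)"
    and ip_definite: "f \<in> H \<Longrightarrow> Re (ip f f) = 0 \<Longrightarrow> f = (\<lambda>x. 0)"
    and complete: "(\<And>n. F n \<in> H) \<Longrightarrow>
      (\<And>e. e > 0 \<Longrightarrow> \<exists>N. \<forall>m\<ge>N. \<forall>n\<ge>N. ip_norm ip (\<lambda>x. F m x - F n x) < e) \<Longrightarrow>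
      \<exists>g\<in>H. (\<lambda>n. ip_norm ip (\<lambda>x. F n x - g x)) \<longlonglongrightarrow> 0"
begin

lemma diff_mem: "f \<in> H \<Longrightarrow> g \<in> H \<Longrightarrow> (\<lambda>x. f x - g x) \<in> H"
  using add_mem[of f "\<lambda>x. -1 * g x"] scale_mem[of g "-1"] by simp

lemma sum_mem: "finite I \<Longrightarrow> (\<And>i. i \<in> I \<Longrightarrow> f i \<in> H) \<Longrightarrow> (\<lambda>x. \<Sum>i\<in>I. c i * f i x) \<in> H"
proof (induction I rule: finite_induct)
  case (insert i I)
  then have "(\<lambda>x. c i * f i x + (\<Sum>i\<in>I. c i * f i x)) \<in> H"
    by (intro add_mem scale_mem) auto
  with insert.hyps show ?case by simp
qed (simp add: zero_mem)

lemma ip_diff_left: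
  assumes "f \<in> H" "g \<in> H" "h \<in> H" shows "ip (\<lambda>x. f x - g x) h = ip f h - ip g h"
  using ip_add_left[of f "\<lambda>x. -1 * g x" h] ip_scale_left[of g h "-1"] scale_mem[of g "-1"] assms by simp

lemma ip_zero_left: "h \<in> H \<Longrightarrow> ip (\<lambda>x. 0) h = 0"
  using ip_scale_left[of "\<lambda>x. 0" h 0] zero_mem by simp

lemma ip_add_right: "f \<in> H \<Longrightarrow> g \<in> H \<Longrightarrow> h \<in> H \<Longrightarrow> ip h (\<lambda>x. f x + g x) = ip h f + ip h g"
  using ip_commute[OF add_mem, of f g h] ip_commute[of f h] ip_commute[of g h] by (simp add: ip_add_left)

lemma ip_diff_right: "f \<in> H \<Longrightarrow> g \<in> H \<Longrightarrow> h \<in> H \<Longrightarrow> ip h (\<lambda>x. f x - g x) = ip h f - ip h g"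
  using ip_commute[OF diff_mem, of f g h] ip_commute[of f h] ip_commute[of g h] by (simp add: ip_diff_left)

lemma ip_scale_right: "f \<in> H \<Longrightarrow> h \<in> H \<Longrightarrow> ip h (\<lambda>x. c * f x) = cnj c * ip h f"
  using ip_commute[OF scale_mem, of f h c] ip_commute[of f h] by (simp add: ip_scale_left)

lemma ip_sum_left:
  assumes "finite I" "\<And>i. i \<in> I \<Longrightarrow> f i \<in> H" "h \<in> H"
  shows "ip (\<lambda>x. \<Sum>i\<in>I. c i * f i x) h = (\<Sum>i\<in>I. c i * ip (f i) h)"
  using assms
  by (induction I rule: finite_induct)
     (simp_all add: ip_zero_left ip_add_left ip_scale_left sum_mem scale_mem)

lemma ip_sum_right:
  assumes "finite I" "\<And>i. i \<in> I \<Longrightarrow> f i \<in> H" "h \<in> H"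
  shows "ip h (\<lambda>x. \<Sum>i\<in>I. c i * f i x) = (\<Sum>i\<in>I. cnj (c i) * ip h (f i))"
proof -
  have "ip h (\<lambda>x. \<Sum>i\<in>I. c i * f i x) = cnj (ip (\<lambda>x. \<Sum>i\<in>I. c i * f i x) h)"
    using assms by (intro ip_commute sum_mem)
  also have "\<dots> = (\<Sum>i\<in>I. cnj (c i) * cnj (ip (f i) h))" using assms by (simp add: ip_sum_left)
  also have "\<dots> = (\<Sum>i\<in>I. cnj (c i) * ip h (f i))"
  proof (rule sum.cong[OF refl])
    fix i assume "i \<in> I"
    then show "cnj (c i) * cnj (ip (f i) h) = cnj (c i) * ip h (f i)"
      using assms ip_commute[of "f i" h] by simp
  qed
  finally show ?thesis .
qed

lemma ip_self: "f \<in> H \<Longrightarrow> ip f f = of_real (Re (ip f f))"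
  using ip_commute[of f f] by (simp add: complex_eq_iff)

lemma ip_norm_sq: "f \<in> H \<Longrightarrow> (ip_norm ip f)\<^sup>2 = Re (ip f f)"
  by (simp add: ip_norm_def ip_nonneg)

lemma ip_norm_nonneg: "f \<in> H \<Longrightarrow> 0 \<le> ip_norm ip f"
  by (simp add: ip_norm_def ip_nonneg)

lemma ip_norm_sq_add_scaled:
  assumes "f \<in> H" "g \<in> H"
  shows "(ip_norm ip (\<lambda>x. f x + t * g x))\<^sup>2
    = (ip_norm ip f)\<^sup>2 + 2 * Re (cnj t * ip f g) + (norm t)\<^sup>2 * (ip_norm ip g)\<^sup>2"
proof -
  note mem = assms scale_mem[OF assms(2), of t] add_mem[OF assms(1) scale_mem[OF assms(2), of t]]
  have "ip (\<lambda>x. f x + t * g x) (\<lambda>x. f x + t * g x)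
      = ip f f + (cnj t * ip f g + cnj (cnj t * ip f g)) + (t * cnj t) * ip g g"
    using mem ip_commute[of f g]
    by (simp add: ip_add_left ip_add_right ip_scale_left ip_scale_right algebra_simps)
  moreover have "t * cnj t * ip g g = of_real ((norm t)\<^sup>2 * Re (ip g g))"
    using ip_self[OF assms(2)] by (metis complex_norm_square of_real_mult)
  ultimately show ?thesis using mem by (simp add: ip_norm_sq)
qed

lemma ip_norm_scale: "f \<in> H \<Longrightarrow> ip_norm ip (\<lambda>x. c * f x) = norm c * ip_norm ip f"
  using ip_norm_sq_add_scaled[OF zero_mem, of f c] ip_zero_left[of f] ip_zero_left[OF zero_mem]
    ip_norm_nonneg[of f] ip_norm_nonneg[OF scale_mem, of f c]
  by (simp add: ip_norm_sq[OF zero_mem] flip: power_mult_distrib)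

lemma Cauchy_Schwarz:
  assumes "f \<in> H" "g \<in> H" shows "norm (ip f g) \<le> ip_norm ip f * ip_norm ip g"
proof (cases "Re (ip g g) = 0")
  case True
  then have "g = (\<lambda>x. 0)" using assms ip_definite by blast
  then have "ip f g = 0" using assms ip_commute[of g f] by (simp add: ip_zero_left)
  then show ?thesis using assms by (simp add: ip_norm_nonneg)
next
  case False
  let ?G = "(ip_norm ip g)\<^sup>2" and ?a = "ip f g"
  have G: "?G > 0" using False assms ip_nonneg[of g] by (simp add: ip_norm_sq)
  have "cnj (- ?a / of_real ?G) * ?a = of_real (- ((norm ?a)\<^sup>2 / ?G))"
    by (simp add: complex_norm_square mult.commute[of ?a] del: of_real_power)
  then have "0 \<le> (ip_norm ip f)\<^sup>2 + 2 * (- ((norm ?a)\<^sup>2 / ?G)) + (norm (- ?a / of_real ?G))\<^sup>2 * ?G"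
    using ip_norm_sq_add_scaled[OF assms, of "- ?a / of_real ?G"] by (metis Re_complex_of_real zero_le_power2)
  moreover have "(norm (- ?a / of_real ?G))\<^sup>2 * ?G = (norm ?a)\<^sup>2 / ?G"
    using G by (simp add: norm_divide power_divide power2_eq_square norm_mult)
  ultimately have "(norm ?a)\<^sup>2 \<le> (ip_norm ip f)\<^sup>2 * ?G"
    using G by (simp add: pos_divide_le_eq)
  then show ?thesis
    using assms by (simp add: power_mult_distrib[symmetric] abs_le_square_iff[symmetric] ip_norm_nonneg)
qed

lemma ip_norm_triangle:
  assumes "f \<in> H" "g \<in> H" shows "ip_norm ip (\<lambda>x. f x + g x) \<le> ip_norm ip f + ip_norm ip g"
proof (rule power2_le_imp_le)
  have "Re (ip f g) \<le> ip_norm ip f * ip_norm ip g"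
    using Cauchy_Schwarz[OF assms] complex_Re_le_cmod order_trans by blast
  then show "(ip_norm ip (\<lambda>x. f x + g x))\<^sup>2 \<le> (ip_norm ip f + ip_norm ip g)\<^sup>2"
    using ip_norm_sq_add_scaled[OF assms, of 1] by (simp add: power2_sum)
qed (simp add: ip_norm_nonneg assms)

text \<open>
  Otherwise a small step from \<open>v\<close> in direction \<open>- (ip v h) h\<close> would
  shorten it.
\<close>

lemma minimal_distance_imp_orthogonal:
  assumes "v \<in> H" "h \<in> H" and min: "\<And>t. ip_norm ip v \<le> ip_norm ip (\<lambda>x. v x + t * h x)"
  shows "ip v h = 0"
proof (rule ccontr)
  assume "ip v h \<noteq> 0"
  define a where "a = ip v h"
  define G where "G = (ip_norm ip h)\<^sup>2"
  define e where "e = 1 / (1 + G)"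
  define t where "t = - of_real e * a"
  have "G \<ge> 0" by (simp add: G_def)
  then have e: "e > 0" "e * G \<le> 1" by (simp_all add: e_def field_simps)
  have "a \<noteq> 0" using \<open>ip v h \<noteq> 0\<close> by (simp add: a_def)
  have "(ip_norm ip v)\<^sup>2 \<le> (ip_norm ip (\<lambda>x. v x + t * h x))\<^sup>2"
    using min[of t] assms by (intro power_mono) (auto simp: ip_norm_nonneg)
  then have "0 \<le> 2 * Re (cnj t * a) + (norm t)\<^sup>2 * G"
    using ip_norm_sq_add_scaled[OF assms(1,2), of t] by (simp add: a_def G_def)
  moreover have "Re (cnj t * a) = - e * (norm a)\<^sup>2"
    unfolding t_def cmod_power2 by (simp add: power2_eq_square algebra_simps)
  moreover have "(norm t)\<^sup>2 = e\<^sup>2 * (norm a)\<^sup>2"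
    by (simp add: t_def norm_mult power_mult_distrib)
  ultimately have "0 \<le> e * (norm a)\<^sup>2 * (e * G - 2)"
    by (simp add: power2_eq_square algebra_simps)
  also have "\<dots> < 0"
    using e \<open>a \<noteq> 0\<close> by (intro mult_pos_neg) auto
  finally show False by simp
qed

text \<open>
  By the parallelogram law a minimising sequence in a midpoint convex set is a Cauchy
  sequence. Its limit is approximated from the set but may lie outside of it, as happens for
  the errors of finite expansions in an orthonormal basis.
\<close>

lemma minimal_norm_limit:
  assumes A: "A \<subseteq> H" "A \<noteq> {}" and mid: "\<And>f g. f \<in> A \<Longrightarrow> g \<in> A \<Longrightarrow> (\<lambda>x. (f x + g x) / 2) \<in> A"
  obtains F v where "\<And>n. F n \<in> A" "v \<in> H" "(\<lambda>n. ip_norm ip (\<lambda>x. F n x - v x)) \<longlonglongrightarrow> 0"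
    "\<And>a. a \<in> A \<Longrightarrow> ip_norm ip v \<le> ip_norm ip a"
proof -
  let ?N = "\<lambda>f. (ip_norm ip f)\<^sup>2"
  define d where "d = Inf (?N ` A)"
  have bdd: "bdd_below (?N ` A)" by (intro bdd_belowI[of _ 0]) auto
  have d: "d \<le> ?N f" if "f \<in> A" for f unfolding d_def using bdd that by (intro cInf_lower) auto
  have "\<exists>f\<in>A. ?N f < d + 1 / real (Suc n)" for n
  proof -
    have "Inf (?N ` A) < d + 1 / real (Suc n)" by (simp add: d_def)
    then show ?thesis using cInf_lessD[of "?N ` A"] A(2) by blast
  qed
  then obtain F where F: "\<And>n. F n \<in> A" "\<And>n. ?N (F n) < d + 1 / real (Suc n)" by metis
  have FH: "F n \<in> H" for n using F A by blast
  have est: "?N (\<lambda>x. F m x - F n x) \<le> 2 / real (Suc m) + 2 / real (Suc n)" for m n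
  proof -
    have "?N (\<lambda>x. F m x + F n x) + ?N (\<lambda>x. F m x - F n x) = 2 * ?N (F m) + 2 * ?N (F n)"
      using ip_norm_sq_add_scaled[OF FH FH, of m 1 n] ip_norm_sq_add_scaled[OF FH FH, of m "-1" n] by simp
    moreover have "4 * d \<le> ?N (\<lambda>x. F m x + F n x)"
    proof -
      have "d \<le> ?N (\<lambda>x. (F m x + F n x) / 2)" by (intro d mid F)
      also have "(\<lambda>x. (F m x + F n x) / 2) = (\<lambda>x. (1 / 2) * (F m x + F n x))" by simp
      also have "?N \<dots> = ?N (\<lambda>x. F m x + F n x) / 4"
        by (subst ip_norm_scale) (auto intro: add_mem FH simp: power2_eq_square norm_divide)
      finally show ?thesis by simp
    qed
    ultimately show ?thesis using F(2)[of m] F(2)[of n] by simp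
  qed
  have "\<exists>v\<in>H. (\<lambda>n. ip_norm ip (\<lambda>x. F n x - v x)) \<longlonglongrightarrow> 0"
  proof (rule complete[OF FH])
    fix e :: real assume e: "e > 0"
    obtain N where N: "4 / e\<^sup>2 < real N" using reals_Archimedean2 by blast
    have "ip_norm ip (\<lambda>x. F m x - F n x) < e" if mn: "m \<ge> N" "n \<ge> N" for m n
    proof (rule power2_less_imp_less)
      have "0 < 4 / e\<^sup>2" using e by simp
      then have N0: "real N > 0" using N by linarith
      have le: "2 / real (Suc k) \<le> 2 / real N" if "k \<ge> N" for k
        using that N0 by (intro divide_left_mono) auto
      have "?N (\<lambda>x. F m x - F n x) \<le> 4 / real N"
        using est[of m n] le[OF mn(1)] le[OF mn(2)] by simp
      also have "\<dots> < e\<^sup>2" using N N0 e by (simp add: field_simps)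
      finally show "?N (\<lambda>x. F m x - F n x) < e\<^sup>2" .
    qed (use e in simp)
    then show "\<exists>N. \<forall>m\<ge>N. \<forall>n\<ge>N. ip_norm ip (\<lambda>x. F m x - F n x) < e" by blast
  qed
  then obtain v where v: "v \<in> H" "(\<lambda>n. ip_norm ip (\<lambda>x. F n x - v x)) \<longlonglongrightarrow> 0" by blast
  have "ip_norm ip v \<le> ip_norm ip a" if a: "a \<in> A" for a
  proof -
    have aH: "a \<in> H" using a A by blast
    have sq: "ip_norm ip (F n) \<le> sqrt (?N a + 1 / real (Suc n))" for n
      using F(2)[of n] d[OF a] by (intro real_le_rsqrt) simp
    have "ip_norm ip v \<le> ip_norm ip (\<lambda>x. F n x - v x) + sqrt (?N a + 1 / real (Suc n))" for n
    proof -
      have "ip_norm ip v = ip_norm ip (\<lambda>x. (-1) * (F n x - v x) + F n x)" by simp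
      also have "\<dots> \<le> ip_norm ip (\<lambda>x. (-1) * (F n x - v x)) + ip_norm ip (F n)"
        by (intro ip_norm_triangle scale_mem diff_mem FH v)
      also have "ip_norm ip (\<lambda>x. (-1) * (F n x - v x)) = ip_norm ip (\<lambda>x. F n x - v x)"
        by (subst ip_norm_scale) (auto intro: diff_mem FH v)
      finally show ?thesis using sq[of n] by linarith
    qed
    moreover have "(\<lambda>n. ip_norm ip (\<lambda>x. F n x - v x) + sqrt (?N a + 1 / real (Suc n))) \<longlonglongrightarrow> 0 + sqrt (?N a + 0)"
      by (intro tendsto_intros v LIMSEQ_Suc lim_1_over_n lim_inverse_n) 
    ultimately have "ip_norm ip v \<le> 0 + sqrt (?N a + 0)"
      by (intro LIMSEQ_le_const) auto
    then show ?thesis using aH by (simp add: ip_norm_nonneg)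
  qed
  with F v show thesis by (intro that) auto
qed

text \<open>
  A vector of least norm in the hyperplane \<open>\<phi> = 1\<close> is orthogonal to the
  kernel of \<open>\<phi>\<close>.
\<close>

lemma Riesz_representation:
  assumes add: "\<And>f g. f \<in> H \<Longrightarrow> g \<in> H \<Longrightarrow> \<phi> (\<lambda>x. f x + g x) = \<phi> f + \<phi> g"
    and scale: "\<And>f c. f \<in> H \<Longrightarrow> \<phi> (\<lambda>x. c * f x) = c * \<phi> f"
    and bound: "\<And>f. f \<in> H \<Longrightarrow> norm (\<phi> f) \<le> C * ip_norm ip f"
  shows "\<exists>u\<in>H. \<forall>f\<in>H. \<phi> f = ip f u"
proof (cases "\<forall>f\<in>H. \<phi> f = 0")
  case True
  then show ?thesis
    using zero_mem ip_commute[OF zero_mem] ip_zero_left by (intro bexI[of _ "\<lambda>x. 0"]) auto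
next
  case False
  then obtain f0 where f0: "f0 \<in> H" "\<phi> f0 \<noteq> 0" by blast
  have \<phi>diff: "\<phi> (\<lambda>x. f x - g x) = \<phi> f - \<phi> g" if "f \<in> H" "g \<in> H" for f g
    using add[OF that(1) scale_mem[OF that(2), of "-1"]] scale[OF that(2), of "-1"] by simp
  define A where "A = {f \<in> H. \<phi> f = 1}"
  have "(\<lambda>x. inverse (\<phi> f0) * f0 x) \<in> A" using f0 scale scale_mem by (simp add: A_def)
  then have A: "A \<subseteq> H" "A \<noteq> {}" by (auto simp: A_def)
  have mid: "(\<lambda>x. (f x + g x) / 2) \<in> A" if "f \<in> A" "g \<in> A" for f g
  proof -
    have fg: "f \<in> H" "g \<in> H" "\<phi> f = 1" "\<phi> g = 1" using that by (auto simp: A_def)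
    have "(\<lambda>x. (1/2) * (f x + g x)) \<in> A"
      using scale_mem[OF add_mem[OF fg(1,2)], of "1/2"] scale[OF add_mem[OF fg(1,2)], of "1/2"] add[OF fg(1,2)] fg by (simp add: A_def)
    then show ?thesis by simp
  qed
  \<comment> \<open>The boundedness of \<open>\<phi>\<close> keeps the limit \<open>v\<close> in the
    hyperplane.\<close>
  obtain F v where F: "\<And>n. F n \<in> A" and v: "v \<in> H"
    and lim: "(\<lambda>n. ip_norm ip (\<lambda>x. F n x - v x)) \<longlonglongrightarrow> 0"
    and min: "\<And>a. a \<in> A \<Longrightarrow> ip_norm ip v \<le> ip_norm ip a"
    using minimal_norm_limit[OF A mid] by blast
  have "norm (1 - \<phi> v) \<le> C * ip_norm ip (\<lambda>x. F n x - v x)" for n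
    using bound[OF diff_mem[OF _ v], of "F n"] \<phi>diff[OF _ v, of "F n"] F[of n] by (simp add: A_def)
  moreover have "(\<lambda>n. C * ip_norm ip (\<lambda>x. F n x - v x)) \<longlonglongrightarrow> C * 0" by (intro tendsto_intros lim)
  ultimately have "norm (1 - \<phi> v) \<le> C * 0" by (intro LIMSEQ_le_const) auto
  then have \<phi>v: "\<phi> v = 1" by simp
  have orth: "ip h v = 0" if h: "h \<in> H" "\<phi> h = 0" for h
  proof -
    have "ip v h = 0"
    proof (rule minimal_distance_imp_orthogonal[OF v h(1) min])
      show "(\<lambda>x. v x + t * h x) \<in> A" for t
        using add_mem[OF v scale_mem[OF h(1)]] add[OF v scale_mem[OF h(1)]] scale[OF h(1)] h \<phi>v by (simp add: A_def)
    qed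
    then show ?thesis using ip_commute[OF v h(1)] by simp
  qed
  have "Re (ip v v) \<noteq> 0"
  proof
    assume "Re (ip v v) = 0"
    then have "v = (\<lambda>x. 0)" using ip_definite v by blast
    then have "\<phi> v = 0" using scale[OF zero_mem, of 0] by simp
    then show False using \<phi>v by simp
  qed
  then have vv: "ip v v \<noteq> 0" by auto
  show ?thesis
  proof (intro bexI[of _ "\<lambda>x. cnj (inverse (ip v v)) * v x"] ballI)
    fix f assume f: "f \<in> H"
    have "ip (\<lambda>x. f x - \<phi> f * v x) v = 0"
      using diff_mem[OF f scale_mem[OF v, of "\<phi> f"]] \<phi>diff[OF f scale_mem[OF v, of "\<phi> f"]] scale[OF v] \<phi>v
      by (intro orth) auto
    then have "ip f v = \<phi> f * ip v v"
      using f v scale_mem[OF v] by (simp add: ip_diff_left ip_scale_left)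
    then show "\<phi> f = ip f (\<lambda>x. cnj (inverse (ip v v)) * v x)"
      using f v vv by (simp add: ip_scale_right)
  qed (use v in \<open>intro scale_mem\<close>)
qed

lemma orthogonal_sum_norm:
  assumes I: "finite I" and fH: "\<And>i. i \<in> I \<Longrightarrow> f i \<in> H"
    and ortho: "\<And>i j. i \<in> I \<Longrightarrow> j \<in> I \<Longrightarrow> ip (f i) (f j) = (if i = j then of_real (s i) else 0)"
  shows "(ip_norm ip (\<lambda>x. \<Sum>i\<in>I. c i * f i x))\<^sup>2 = (\<Sum>i\<in>I. (norm (c i))\<^sup>2 * s i)"
proof -
  have "ip (\<lambda>x. \<Sum>i\<in>I. c i * f i x) (\<lambda>x. \<Sum>i\<in>I. c i * f i x)
      = (\<Sum>i\<in>I. c i * (\<Sum>j\<in>I. cnj (c j) * ip (f i) (f j)))"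
    using I fH by (simp add: ip_sum_left ip_sum_right sum_mem)
  also have "\<dots> = (\<Sum>i\<in>I. of_real ((norm (c i))\<^sup>2 * s i))"
  proof (rule sum.cong[OF refl])
    fix i assume i: "i \<in> I"
    have "(\<Sum>j\<in>I. cnj (c j) * ip (f i) (f j)) = (\<Sum>j\<in>I. if j = i then cnj (c i) * of_real (s i) else 0)"
      using i ortho by (intro sum.cong) auto
    then have "(\<Sum>j\<in>I. cnj (c j) * ip (f i) (f j)) = cnj (c i) * of_real (s i)" using i I by simp
    then show "c i * (\<Sum>j\<in>I. cnj (c j) * ip (f i) (f j)) = of_real ((norm (c i))\<^sup>2 * s i)"
      unfolding of_real_mult complex_norm_square by (simp add: mult.assoc)
  qed
  also have "\<dots> = of_real (\<Sum>i\<in>I. (norm (c i))\<^sup>2 * s i)" by (rule of_real_sum[symmetric])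
  finally show ?thesis using sum_mem[OF I fH, where c=c] by (simp add: ip_norm_sq)
qed

lemma orthonormal_basis_sum_norm:
  assumes E: "orthonormal_basis H ip E" and I: "finite I" "I \<subseteq> E"
  shows "(ip_norm ip (\<lambda>x. \<Sum>e\<in>I. c e * e x))\<^sup>2 = (\<Sum>e\<in>I. (norm (c e))\<^sup>2)"
proof -
  have "e \<in> H" if "e \<in> I" for e using that E I unfolding orthonormal_basis_def by blast
  moreover have "ip e e' = (if e = e' then of_real 1 else 0)" if "e \<in> I" "e' \<in> I" for e e'
    using that E I(2) unfolding orthonormal_basis_def by (simp add: subset_iff)
  ultimately show ?thesis using orthogonal_sum_norm[OF I(1), of "\<lambda>e. e" "\<lambda>e. 1" c] by simp
qed

text \<open>
  Completing the square: the error is least for the Fourier coefficients \<open>ip f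
  e\<close>. The case \<open>c = ip f\<close> gives Bessel's inequality.
\<close>

lemma orthonormal_expansion_error:
  assumes E: "orthonormal_basis H ip E" and I: "finite I" "I \<subseteq> E" and f: "f \<in> H"
  shows "(ip_norm ip (\<lambda>x. f x - (\<Sum>e\<in>I. c e * e x)))\<^sup>2
    = (ip_norm ip f)\<^sup>2 - (\<Sum>e\<in>I. (norm (ip f e))\<^sup>2) + (\<Sum>e\<in>I. (norm (c e - ip f e))\<^sup>2)"
proof -
  have EH: "e \<in> H" if "e \<in> I" for e using that E I unfolding orthonormal_basis_def by blast
  let ?s = "\<lambda>x. \<Sum>e\<in>I. c e * e x"
  have s: "?s \<in> H" using I EH by (intro sum_mem[of I "\<lambda>e. e"]) auto
  have "(ip_norm ip (\<lambda>x. f x - ?s x))\<^sup>2 = (ip_norm ip f)\<^sup>2 - 2 * Re (ip f ?s) + (ip_norm ip ?s)\<^sup>2"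
    using ip_norm_sq_add_scaled[OF f s, of "-1"] by simp
  also have "ip f ?s = (\<Sum>e\<in>I. cnj (c e) * ip f e)"
    using I EH f by (simp add: ip_sum_right[of I "\<lambda>e. e"])
  also have "(ip_norm ip ?s)\<^sup>2 = (\<Sum>e\<in>I. (norm (c e))\<^sup>2)" by (rule orthonormal_basis_sum_norm[OF E I])
  also have "(ip_norm ip f)\<^sup>2 - 2 * Re (\<Sum>e\<in>I. cnj (c e) * ip f e) + (\<Sum>e\<in>I. (norm (c e))\<^sup>2)
     = (ip_norm ip f)\<^sup>2 + (\<Sum>e\<in>I. (norm (c e))\<^sup>2 - 2 * Re (cnj (c e) * ip f e))"
    by (simp add: sum_subtractf sum_distrib_left)
  also have "(\<Sum>e\<in>I. (norm (c e))\<^sup>2 - 2 * Re (cnj (c e) * ip f e))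
     = (\<Sum>e\<in>I. (norm (c e - ip f e))\<^sup>2 - (norm (ip f e))\<^sup>2)"
    unfolding cmod_power2 by (intro sum.cong) (simp_all add: power2_eq_square algebra_simps)
  finally show ?thesis by (simp add: sum_subtractf)
qed

lemma Bessel_inequality:
  assumes E: "orthonormal_basis H ip E" and I: "finite I" "I \<subseteq> E" and f: "f \<in> H"
  shows "(\<Sum>e\<in>I. (norm (ip f e))\<^sup>2) \<le> (ip_norm ip f)\<^sup>2"
  using orthonormal_expansion_error[OF E I f, of "ip f"]
    zero_le_power2[of "ip_norm ip (\<lambda>x. f x - (\<Sum>e\<in>I. ip f e * e x))"] by simp

text \<open>
  The set \<open>A\<close> of errors \<open>f - g\<close>, with \<open>g\<close> in the span
  of \<open>E\<close>, has a limit point \<open>v\<close> of least norm. It is orthogonal to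
  \<open>E\<close>, hence zero by the definition of an orthonormal basis.
\<close>

lemma orthonormal_basis_approx:
  assumes E: "orthonormal_basis H ip E" and f: "f \<in> H" and \<epsilon>: "\<epsilon> > 0"
  obtains I where "finite I" "I \<subseteq> E" "ip_norm ip (\<lambda>x. f x - (\<Sum>e\<in>I. ip f e * e x)) < \<epsilon>"
    "(ip_norm ip f)\<^sup>2 - \<epsilon>\<^sup>2 < (\<Sum>e\<in>I. (norm (ip f e))\<^sup>2)"
proof -
  have EH: "E \<subseteq> H" using E unfolding orthonormal_basis_def by blast
  define A where "A = {\<lambda>x. f x - (\<Sum>e\<in>I. c e * e x) | I c. finite I \<and> I \<subseteq> E}"
  have sumH: "(\<lambda>x. \<Sum>e\<in>I. c e * e x) \<in> H" if "finite I" "I \<subseteq> E" for I c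
    using that EH by (intro sum_mem[of I "\<lambda>e. e"]) auto
  have A: "A \<subseteq> H" "A \<noteq> {}" using f sumH by (auto simp: A_def intro!: diff_mem)
  have comb: "(\<lambda>x. (f x - (\<Sum>e\<in>I. c e * e x)) * s + (f x - (\<Sum>e\<in>J. d e * e x)) * (1 - s)) \<in> A"
    if IJ: "finite I" "I \<subseteq> E" "finite J" "J \<subseteq> E" for I J c d s
  proof -
    let ?b = "\<lambda>e. (if e \<in> I then c e else 0) * s + (if e \<in> J then d e else 0) * (1 - s)"
    have "(\<Sum>e\<in>I \<union> J. ?b e * e x) = (\<Sum>e\<in>I. c e * e x) * s + (\<Sum>e\<in>J. d e * e x) * (1 - s)" for x
    proof -
      have "(\<Sum>e\<in>I \<union> J. ?b e * e x)
          = (\<Sum>e\<in>I \<union> J. if e \<in> I then c e * e x * s else 0) + (\<Sum>e\<in>I \<union> J. if e \<in> J then d e * e x * (1 - s) else 0)"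
        unfolding sum.distrib[symmetric] by (intro sum.cong) (auto simp: algebra_simps)
      also have "(\<Sum>e\<in>I \<union> J. if e \<in> I then c e * e x * s else 0) = (\<Sum>e\<in>I. c e * e x * s)"
        using IJ by (intro sum.mono_neutral_cong_right) auto
      also have "(\<Sum>e\<in>I \<union> J. if e \<in> J then d e * e x * (1 - s) else 0) = (\<Sum>e\<in>J. d e * e x * (1 - s))"
        using IJ by (intro sum.mono_neutral_cong_right) auto
      finally show ?thesis by (simp add: sum_distrib_right)
    qed
    then have "(\<lambda>x. (f x - (\<Sum>e\<in>I. c e * e x)) * s + (f x - (\<Sum>e\<in>J. d e * e x)) * (1 - s))
        = (\<lambda>x. f x - (\<Sum>e\<in>I \<union> J. ?b e * e x))"
      by (simp add: fun_eq_iff algebra_simps)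
    then show ?thesis using IJ unfolding A_def
      by (intro CollectI exI[of _ "I \<union> J"] exI[of _ ?b] conjI) auto
  qed
  have mid: "(\<lambda>x. (g x + h x) / 2) \<in> A" if gh: "g \<in> A" "h \<in> A" for g h
  proof -
    obtain I c J d where *: "finite I" "I \<subseteq> E" "finite J" "J \<subseteq> E"
      "g = (\<lambda>x. f x - (\<Sum>e\<in>I. c e * e x))" "h = (\<lambda>x. f x - (\<Sum>e\<in>J. d e * e x))"
      using gh unfolding A_def by blast
    have "(\<lambda>x. (g x + h x) / 2) = (\<lambda>x. g x * (1/2) + h x * (1 - 1/2))" by (simp add: fun_eq_iff field_simps)
    then show ?thesis using comb[OF *(1-4), of c "1/2" d] unfolding *(5,6) by simp
  qed
  obtain F v where F: "\<And>n. F n \<in> A" and v: "v \<in> H"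
    and lim: "(\<lambda>n. ip_norm ip (\<lambda>x. F n x - v x)) \<longlonglongrightarrow> 0"
    and min: "\<And>a. a \<in> A \<Longrightarrow> ip_norm ip v \<le> ip_norm ip a"
    using minimal_norm_limit[OF A mid] by blast
  have "ip v e = 0" if e: "e \<in> E" for e
  proof (rule minimal_distance_imp_orthogonal[OF v])
    show eH: "e \<in> H" using e EH by blast
    fix t
    have "ip_norm ip v \<le> ip_norm ip (\<lambda>x. v x + t * e x) + ip_norm ip (\<lambda>x. F n x - v x)" for n
    proof -
      obtain I c where I: "finite I" "I \<subseteq> E" "F n = (\<lambda>x. f x - (\<Sum>e\<in>I. c e * e x))"
        using F[of n] unfolding A_def by blast
      let ?J = "insert e I" and ?d = "\<lambda>e'. (if e' \<in> I then c e' else 0) - (if e' = e then t else 0)"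
      have "(\<Sum>e'\<in>?J. ?d e' * e' x) = (\<Sum>e'\<in>I. c e' * e' x) - t * e x" for x
      proof -
        have "(\<Sum>e'\<in>?J. ?d e' * e' x)
            = (\<Sum>e'\<in>?J. if e' \<in> I then c e' * e' x else 0) - (\<Sum>e'\<in>?J. if e' = e then t * e x else 0)"
          unfolding sum_subtractf[symmetric] by (intro sum.cong) (auto simp: algebra_simps)
        also have "(\<Sum>e'\<in>?J. if e' \<in> I then c e' * e' x else 0) = (\<Sum>e'\<in>I. c e' * e' x)"
          using I by (intro sum.mono_neutral_cong_right) auto
        also have "(\<Sum>e'\<in>?J. if e' = e then t * e x else 0) = t * e x" using I by simp
        finally show ?thesis .
      qed
      then have "(\<lambda>x. F n x + t * e x) = (\<lambda>x. f x - (\<Sum>e'\<in>?J. ?d e' * e' x))"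
        unfolding I(3) by (simp add: fun_eq_iff)
      moreover have "finite ?J" "?J \<subseteq> E" using I e by auto
      ultimately have "(\<lambda>x. F n x + t * e x) \<in> A" unfolding A_def
        by (intro CollectI exI[of _ ?J] exI[of _ ?d] conjI)
      then have "ip_norm ip v \<le> ip_norm ip (\<lambda>x. F n x + t * e x)" by (rule min)
      also have "(\<lambda>x. F n x + t * e x) = (\<lambda>x. (v x + t * e x) + (F n x - v x))" by (simp add: algebra_simps)
      also have "ip_norm ip \<dots> \<le> ip_norm ip (\<lambda>x. v x + t * e x) + ip_norm ip (\<lambda>x. F n x - v x)"
        using F A v eH by (intro ip_norm_triangle add_mem scale_mem diff_mem) auto
      finally show ?thesis .
    qed
    moreover have "(\<lambda>n. ip_norm ip (\<lambda>x. v x + t * e x) + ip_norm ip (\<lambda>x. F n x - v x)) \<longlonglongrightarrow> ip_norm ip (\<lambda>x. v x + t * e x) + 0"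
      by (intro tendsto_intros lim)
    ultimately have "ip_norm ip v \<le> ip_norm ip (\<lambda>x. v x + t * e x) + 0"
      by (intro LIMSEQ_le_const) auto
    then show "ip_norm ip v \<le> ip_norm ip (\<lambda>x. v x + t * e x)" by simp
  qed
  then have "v = (\<lambda>x. 0)" using E v unfolding orthonormal_basis_def by blast
  then have "(\<lambda>n. ip_norm ip (F n)) \<longlonglongrightarrow> 0" using lim by simp
  then have "\<forall>\<^sub>F n in sequentially. ip_norm ip (F n) < \<epsilon>" using \<epsilon> by (rule order_tendstoD(2))
  then obtain n where n: "ip_norm ip (F n) < \<epsilon>" unfolding eventually_sequentially by blast
  obtain I c where I: "finite I" "I \<subseteq> E" "F n = (\<lambda>x. f x - (\<Sum>e\<in>I. c e * e x))"
    using F[of n] unfolding A_def by blast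
  have sq: "(ip_norm ip (F n))\<^sup>2 < \<epsilon>\<^sup>2"
    using n F A ip_norm_nonneg by (intro power_strict_mono) auto
  have le: "(ip_norm ip (\<lambda>x. f x - (\<Sum>e\<in>I. ip f e * e x)))\<^sup>2 \<le> (ip_norm ip (F n))\<^sup>2"
    unfolding I(3) orthonormal_expansion_error[OF E I(1,2) f] by (simp add: sum_nonneg)
  show thesis
  proof (rule that[OF I(1,2)])
    show "ip_norm ip (\<lambda>x. f x - (\<Sum>e\<in>I. ip f e * e x)) < \<epsilon>"
      by (rule power2_less_imp_less[OF le_less_trans[OF le sq]]) (use \<epsilon> in simp)
    show "(ip_norm ip f)\<^sup>2 - \<epsilon>\<^sup>2 < (\<Sum>e\<in>I. (norm (ip f e))\<^sup>2)"
      using le sq orthonormal_expansion_error[OF E I(1,2) f, of "ip f"] by simp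
  qed
qed

text \<open>
  Polarisation: the quadratic form of \<open>A\<close> is real at \<open>f + g\<close> and at
  \<open>f + \<i> g\<close>.
\<close>

lemma positive_op_symmetric:
  assumes A: "positive_op H ip A" and f: "f \<in> H" and g: "g \<in> H"
  shows "ip (A f) g = ip f (A g)"
proof -
  have lin: "linear_op H A" using A unfolding positive_op_def bounded_op_def by blast
  have AH: "A h \<in> H" if "h \<in> H" for h using lin that unfolding linear_op_def by blast
  have Aadd: "A (\<lambda>x. h x + k x) = (\<lambda>x. A h x + A k x)" if "h \<in> H" "k \<in> H" for h k
    using lin that unfolding linear_op_def by blast
  have Ascale: "A (\<lambda>x. c * h x) = (\<lambda>x. c * A h x)" if "h \<in> H" for h c
    using lin that unfolding linear_op_def by blast
  have real: "Im (ip (A h) h) = 0" if "h \<in> H" for h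
    using A that unfolding positive_op_def by (auto simp: complex_nonneg_Reals_iff)
  define a b where "a = ip (A f) g" and "b = ip (A g) f"
  have "ip (A (\<lambda>x. f x + c * g x)) (\<lambda>x. f x + c * g x)
      = ip (A f) f + cnj c * a + c * b + c * cnj c * ip (A g) g" for c
    using f g scale_mem[OF g, of c] AH[OF f] AH[OF g] scale_mem[OF AH[OF g], of c]
      add_mem[OF f scale_mem[OF g]] add_mem[OF AH[OF f] scale_mem[OF AH[OF g]]]
    by (simp add: Aadd Ascale ip_add_left ip_add_right ip_scale_left ip_scale_right a_def b_def algebra_simps)
  then have "Im (ip (A f) f + cnj c * a + c * b + c * cnj c * ip (A g) g) = 0" for c
    using real[OF add_mem[OF f scale_mem[OF g]], of c] by simp
  from this[of 1] this[of \<i>] have "b = cnj a"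
    using real[OF f] real[OF g] by (simp add: complex_eq_iff)
  then show ?thesis using ip_commute[OF AH[OF g] f] by (simp add: a_def b_def)
qed

lemma orthonormal_basis_eq:
  assumes E: "orthonormal_basis H ip E" and "f \<in> H" "g \<in> H" and eq: "\<And>e. e \<in> E \<Longrightarrow> ip f e = ip g e"
  shows "f = g"
proof -
  have EH: "e \<in> H" if "e \<in> E" for e using that E unfolding orthonormal_basis_def by blast
  have "ip (\<lambda>x. f x - g x) e = 0" if "e \<in> E" for e
    using assms that EH by (simp add: ip_diff_left)
  then have "(\<lambda>x. f x - g x) = (\<lambda>x. 0)"
    using E diff_mem[OF assms(2,3)] unfolding orthonormal_basis_def by blast
  then show ?thesis by (simp add: fun_eq_iff)
qed

text \<open>
  Uniqueness of the positive square root on an eigenvector. Since \<open>P\<close> is diagonal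
  with real eigenvalues, \<open>A (A e) = \<mu>\<^sup>2 e\<close>, so \<open>h = A e - \<mu>
  e\<close> satisfies \<open>A h = - \<mu> h\<close>; for \<open>\<mu> > 0\<close> positivity
  of \<open>A\<close> forces \<open>h = 0\<close>, and for \<open>\<mu> = 0\<close> symmetry
  does.
\<close>

lemma is_abs_diagonal:
  fixes \<mu> :: "('a \<Rightarrow> complex) \<Rightarrow> real"
  assumes E: "orthonormal_basis H ip E" and \<mu>: "\<And>e. e \<in> E \<Longrightarrow> 0 \<le> \<mu> e"
    and P: "\<And>e. e \<in> E \<Longrightarrow> P e = (\<lambda>x. of_real (\<mu> e) * e x)"
    and A: "is_abs H ip P A" and e: "e \<in> E"
  shows "A e = (\<lambda>x. of_real (\<mu> e) * e x)"
proof -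
  have EH: "e \<in> H" if "e \<in> E" for e using that E unfolding orthonormal_basis_def by blast
  have ortho: "ip e e' = (if e = e' then 1 else 0)" if "e \<in> E" "e' \<in> E" for e e'
    using that E unfolding orthonormal_basis_def by blast
  have pos: "positive_op H ip A" using A unfolding is_abs_def by blast
  obtain S where S: "is_adjoint H ip P S" and AA: "\<And>f. f \<in> H \<Longrightarrow> A (A f) = S (P f)"
    using A unfolding is_abs_def by blast
  have lin: "linear_op H A" using pos unfolding positive_op_def bounded_op_def by blast
  have linS: "linear_op H S" using S unfolding is_adjoint_def bounded_op_def by blast
  have AH: "A h \<in> H" if "h \<in> H" for h using lin that unfolding linear_op_def by blast
  have SH: "S h \<in> H" if "h \<in> H" for h using linS that unfolding linear_op_def by blast
  have Aadd: "A (\<lambda>x. h x + k x) = (\<lambda>x. A h x + A k x)" if "h \<in> H" "k \<in> H" for h k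
    using lin that unfolding linear_op_def by blast
  have Ascale: "A (\<lambda>x. c * h x) = (\<lambda>x. c * A h x)" if "h \<in> H" for h c
    using lin that unfolding linear_op_def by blast
  have Se: "S e = (\<lambda>x. of_real (\<mu> e) * e x)"
  proof (rule orthonormal_basis_eq[OF E SH[OF EH[OF e]] scale_mem[OF EH[OF e]]])
    fix e' assume e': "e' \<in> E"
    have "ip (S e) e' = cnj (ip e' (S e))" using ip_commute[OF EH[OF e'] SH[OF EH[OF e]]] .
    also have "ip e' (S e) = ip (P e') e" using S EH e e' unfolding is_adjoint_def by simp
    also have "cnj \<dots> = ip (\<lambda>x. of_real (\<mu> e) * e x) e'"
      using e e' EH by (simp add: P ip_scale_left ortho)
    finally show "ip (S e) e' = ip (\<lambda>x. of_real (\<mu> e) * e x) e'" .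
  qed
  have AAe: "A (A e) = (\<lambda>x. of_real ((\<mu> e)\<^sup>2) * e x)"
  proof -
    have "A (A e) = S (\<lambda>x. of_real (\<mu> e) * e x)" using AA EH e P by simp
    also have "\<dots> = (\<lambda>x. of_real (\<mu> e) * S e x)" using linS EH[OF e] unfolding linear_op_def by blast
    finally show ?thesis by (simp add: Se power2_eq_square mult.assoc)
  qed
  show ?thesis
  proof (cases "\<mu> e = 0")
    case True
    have "ip (A e) (A e) = ip (A (A e)) e"
      using positive_op_symmetric[OF pos AH[OF EH[OF e]] EH[OF e]] by simp
    also have "\<dots> = 0" using AAe True EH[OF e] by (simp add: ip_zero_left)
    finally have "A e = (\<lambda>x. 0)" using ip_definite[OF AH[OF EH[OF e]]] by simp
    then show ?thesis using True by simp
  next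
    case False
    then have \<mu>pos: "\<mu> e > 0" using \<mu>[OF e] by simp
    let ?h = "\<lambda>x. A e x + (- of_real (\<mu> e)) * e x"
    have hH: "?h \<in> H" by (intro add_mem scale_mem AH EH e)
    have "A ?h = (\<lambda>x. A (A e) x + (- of_real (\<mu> e)) * A e x)"
      unfolding Aadd[OF AH[OF EH[OF e]] scale_mem[OF EH[OF e]]] Ascale[OF EH[OF e]] by (rule refl)
    also have "\<dots> = (\<lambda>x. (- of_real (\<mu> e)) * ?h x)"
      by (simp add: AAe power2_eq_square algebra_simps fun_eq_iff)
    finally have "ip (A ?h) ?h = - of_real (\<mu> e) * ip ?h ?h"
      using hH by (simp only: ip_scale_left)
    moreover have "ip (A ?h) ?h \<in> \<real>\<^sub>\<ge>\<^sub>0" using pos hH unfolding positive_op_def by blast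
    ultimately have "0 \<le> Re (- of_real (\<mu> e) * ip ?h ?h)" by (metis complex_nonneg_Reals_iff)
    then have "\<mu> e * Re (ip ?h ?h) \<le> 0" by simp
    then have "Re (ip ?h ?h) = 0"
      using \<mu>pos ip_nonneg[OF hH] by (simp add: mult_le_0_iff)
    then have "?h = (\<lambda>x. 0)" by (rule ip_definite[OF hH])
    then show ?thesis by (simp add: fun_eq_iff)
  qed
qed

text \<open>
  Split \<open>f\<close> into its projection to the span of \<open>I\<close> and a remainder.
  The mixed terms vanish because \<open>A\<close> is symmetric and maps that span to itself,
  and the remainder contributes a nonnegative number.
\<close>

lemma positive_diagonal_lower_bound:
  fixes \<mu> :: "('a \<Rightarrow> complex) \<Rightarrow> real"
  assumes E: "orthonormal_basis H ip E" and pos: "positive_op H ip A"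
    and A: "\<And>e. e \<in> E \<Longrightarrow> A e = (\<lambda>x. of_real (\<mu> e) * e x)"
    and I: "finite I" "I \<subseteq> E" and f: "f \<in> H"
  shows "(\<Sum>e\<in>I. \<mu> e * (norm (ip f e))\<^sup>2) \<le> Re (ip (A f) f)"
proof -
  have EH: "e \<in> H" if "e \<in> E" for e using that E unfolding orthonormal_basis_def by blast
  have IH: "e \<in> H" if "e \<in> I" for e using that I EH by blast
  have ortho: "ip e e' = (if e = e' then 1 else 0)" if "e \<in> E" "e' \<in> E" for e e'
    using that E unfolding orthonormal_basis_def by blast
  have lin: "linear_op H A" using pos unfolding positive_op_def bounded_op_def by blast
  have AH: "A h \<in> H" if "h \<in> H" for h using lin that unfolding linear_op_def by blast
  have Aadd: "A (\<lambda>x. h x + k x) = (\<lambda>x. A h x + A k x)" if "h \<in> H" "k \<in> H" for h k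
    using lin that unfolding linear_op_def by blast
  let ?s = "\<lambda>x. \<Sum>e\<in>I. ip f e * e x"
  let ?r = "\<lambda>x. f x - ?s x"
  have s: "?s \<in> H" using I IH by (intro sum_mem[of I "\<lambda>e. e"]) auto
  have r: "?r \<in> H" by (rule diff_mem[OF f s])
  have "ip (A ?r) e = 0" if e: "e \<in> I" for e
  proof -
    have eE: "e \<in> E" using e I by blast
    have "ip ?s e = (\<Sum>e'\<in>I. ip f e' * (if e' = e then 1 else 0))"
    proof -
      have "ip ?s e = (\<Sum>e'\<in>I. ip f e' * ip e' e)"
        using I IH EH eE by (intro ip_sum_left[of I "\<lambda>e. e"]) auto
      also have "\<dots> = (\<Sum>e'\<in>I. ip f e' * (if e' = e then 1 else 0))"
        using I eE ortho by (intro sum.cong) auto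
      finally show ?thesis .
    qed
    also have "\<dots> = ip f e" using e I by (simp add: if_distrib cong: if_cong)
    finally have "ip ?r e = 0" using ip_diff_left[OF f s EH[OF eE]] by simp
    then show ?thesis
      using positive_op_symmetric[OF pos r EH[OF eE]] ip_scale_right[OF EH[OF eE] r] by (simp add: A eE)
  qed
  then have "ip (A ?r) ?s = 0"
    using I IH AH[OF r] by (simp add: ip_sum_right[of I "\<lambda>e. e"])
  moreover have "ip (A ?s) f = of_real (\<Sum>e\<in>I. \<mu> e * (norm (ip f e))\<^sup>2)"
  proof -
    have "ip (A ?s) f = (\<Sum>e\<in>I. ip f e * ip e (A f))"
      using positive_op_symmetric[OF pos s f] I IH AH[OF f] by (simp add: ip_sum_left[of I "\<lambda>e. e"])
    also have "\<dots> = (\<Sum>e\<in>I. of_real (\<mu> e * (norm (ip f e))\<^sup>2))"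
    proof (rule sum.cong[OF refl])
      fix e assume e: "e \<in> I"
      then have eE: "e \<in> E" using I by blast
      have "ip e (A f) = of_real (\<mu> e) * ip e f"
        using positive_op_symmetric[OF pos EH[OF eE] f] ip_scale_left[OF EH[OF eE] f] by (simp add: A eE)
      also have "ip e f = cnj (ip f e)" by (rule ip_commute[OF f EH[OF eE]])
      finally show "ip f e * ip e (A f) = of_real (\<mu> e * (norm (ip f e))\<^sup>2)"
        unfolding of_real_mult complex_norm_square by (simp add: mult_ac)
    qed
    finally show ?thesis by simp
  qed
  moreover have "ip (A f) f = ip (A ?r) ?r + ip (A ?r) ?s + ip (A ?s) f"
  proof -
    have "A f = A (\<lambda>x. ?r x + ?s x)" by simp
    also have "\<dots> = (\<lambda>x. A ?r x + A ?s x)" by (rule Aadd[OF r s])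
    finally have "ip (A f) f = ip (A ?r) f + ip (A ?s) f"
      using ip_add_left[OF AH[OF r] AH[OF s] f] by simp
    moreover have "ip (A ?r) f = ip (A ?r) ?r + ip (A ?r) ?s"
      using ip_add_right[OF r s AH[OF r]] by simp
    ultimately show ?thesis by simp
  qed
  moreover have "0 \<le> Re (ip (A ?r) ?r)"
    using pos r unfolding positive_op_def by (auto simp: complex_nonneg_Reals_iff)
  ultimately show ?thesis by simp
qed

text \<open>
  The trace of \<open>A = \<bar>P\<bar>\<close> is finite in some orthonormal basis
  \<open>E'\<close>, which may differ from \<open>E\<close>. For a finite part
  \<open>I\<close> of \<open>E\<close> there is a finite part of \<open>E'\<close> that
  carries at least half of the squared norm of every vector in \<open>I\<close>; this costs
  the factor 2 in the bound.
\<close>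

lemma trace_class_diagonal_bound:
  fixes \<mu> :: "('a \<Rightarrow> complex) \<Rightarrow> real"
  assumes E: "orthonormal_basis H ip E" and \<mu>: "\<And>e. e \<in> E \<Longrightarrow> 0 \<le> \<mu> e"
    and P: "\<And>e. e \<in> E \<Longrightarrow> P e = (\<lambda>x. of_real (\<mu> e) * e x)"
    and tr: "trace_class H ip P"
  obtains B where "\<And>I. finite I \<Longrightarrow> I \<subseteq> E \<Longrightarrow> (\<Sum>e\<in>I. \<mu> e) \<le> B"
proof -
  have EH: "e \<in> H" if "e \<in> E" for e using that E unfolding orthonormal_basis_def by blast
  have ortho: "ip e e' = (if e = e' then 1 else 0)" if "e \<in> E" "e' \<in> E" for e e'
    using that E unfolding orthonormal_basis_def by blast
  obtain A E' where A: "is_abs H ip P A" and E': "orthonormal_basis H ip E'"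
    and sm: "(\<lambda>e. ip (A e) e) summable_on E'"
    using tr unfolding trace_class_def by blast
  have E'H: "e \<in> H" if "e \<in> E'" for e using that E' unfolding orthonormal_basis_def by blast
  have pos: "positive_op H ip A" using A unfolding is_abs_def by blast
  note Ae = is_abs_diagonal[OF E \<mu> P A]
  have nonneg: "0 \<le> Re (ip (A e) e)" if "e \<in> E'" for e
    using pos E'H[OF that] unfolding positive_op_def by (auto simp: complex_nonneg_Reals_iff)
  have smRe: "(\<lambda>e. Re (ip (A e) e)) summable_on E'" using sm by (rule summable_on_Re)
  define B where "B = (\<Sum>\<^sub>\<infinity>e\<in>E'. Re (ip (A e) e))"
  have "(\<Sum>e\<in>I. \<mu> e) \<le> 2 * B" if I: "finite I" "I \<subseteq> E" for I
  proof -
    have "\<exists>J. finite J \<and> J \<subseteq> E' \<and> 1 / 2 \<le> (\<Sum>e'\<in>J. (norm (ip e e'))\<^sup>2)" if e: "e \<in> I" for e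
    proof -
      have eE: "e \<in> E" using e I by blast
      have n1: "(ip_norm ip e)\<^sup>2 = 1" using EH[OF eE] ortho[OF eE eE] by (simp add: ip_norm_sq)
      obtain J where J: "finite J" "J \<subseteq> E'" "(ip_norm ip e)\<^sup>2 - (1 / 2)\<^sup>2 < (\<Sum>e'\<in>J. (norm (ip e e'))\<^sup>2)"
        by (rule orthonormal_basis_approx[OF E' EH[OF eE] half_gt_zero[OF zero_less_one]])
      have "1 / 2 \<le> (\<Sum>e'\<in>J. (norm (ip e e'))\<^sup>2)"
        using J(3) n1 by (simp add: power2_eq_square)
      then show ?thesis using J by blast
    qed
    then obtain J where J: "\<And>e. e \<in> I \<Longrightarrow> finite (J e) \<and> J e \<subseteq> E' \<and> 1 / 2 \<le> (\<Sum>e'\<in>J e. (norm (ip e e'))\<^sup>2)"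
      by metis
    define K where "K = (\<Union>e\<in>I. J e)"
    have K: "finite K" "K \<subseteq> E'" using J I by (auto simp: K_def)
    have "(\<Sum>e\<in>I. \<mu> e) = 2 * (\<Sum>e\<in>I. \<mu> e * (1 / 2))" by (simp flip: sum_divide_distrib)
    also have "(\<Sum>e\<in>I. \<mu> e * (1 / 2)) \<le> (\<Sum>e\<in>I. \<mu> e * (\<Sum>e'\<in>K. (norm (ip e e'))\<^sup>2))"
    proof (rule sum_mono)
      fix e assume e: "e \<in> I"
      have "(\<Sum>e'\<in>J e. (norm (ip e e'))\<^sup>2) \<le> (\<Sum>e'\<in>K. (norm (ip e e'))\<^sup>2)"
        using K e by (intro sum_mono2) (auto simp: K_def)
      then have "1 / 2 \<le> (\<Sum>e'\<in>K. (norm (ip e e'))\<^sup>2)" using J[OF e] by linarith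
      then show "\<mu> e * (1 / 2) \<le> \<mu> e * (\<Sum>e'\<in>K. (norm (ip e e'))\<^sup>2)"
        using \<mu> e I by (intro mult_left_mono) auto
    qed
    also have "(\<Sum>e\<in>I. \<mu> e * (\<Sum>e'\<in>K. (norm (ip e e'))\<^sup>2)) = (\<Sum>e'\<in>K. \<Sum>e\<in>I. \<mu> e * (norm (ip e e'))\<^sup>2)"
      unfolding sum_distrib_left by (rule sum.swap)
    also have "\<dots> \<le> (\<Sum>e'\<in>K. Re (ip (A e') e'))"
    proof (rule sum_mono)
      fix e' assume "e' \<in> K"
      then have e': "e' \<in> H" using K E'H by blast
      have "(\<Sum>e\<in>I. \<mu> e * (norm (ip e e'))\<^sup>2) = (\<Sum>e\<in>I. \<mu> e * (norm (ip e' e))\<^sup>2)"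
      proof (rule sum.cong[OF refl])
        fix e assume "e \<in> I"
        then have "ip e e' = cnj (ip e' e)" using ip_commute[OF e', of e] EH I by blast
        then show "\<mu> e * (norm (ip e e'))\<^sup>2 = \<mu> e * (norm (ip e' e))\<^sup>2" by simp
      qed
      also have "\<dots> \<le> Re (ip (A e') e')"
        by (rule positive_diagonal_lower_bound[OF E pos Ae I e'])
      finally show "(\<Sum>e\<in>I. \<mu> e * (norm (ip e e'))\<^sup>2) \<le> Re (ip (A e') e')" .
    qed
    also have "\<dots> \<le> B"
      unfolding B_def using K nonneg by (intro finite_sum_le_infsum smRe) auto
    finally show ?thesis by simp
  qed
  then show thesis by (rule that)
qed

text \<open>
  The basis \<open>E\<close> diagonalises \<open>T\<^sup>* T\<close>, so the images of its
  elements are orthogonal, and the eigenvalues \<open>s e\<close> are their squared norms.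
\<close>

lemma schatten_class_singular_values:
  assumes T: "schatten_class H ip p T"
  obtains E s B where "orthonormal_basis H ip E" "\<And>e. e \<in> E \<Longrightarrow> 0 \<le> s e"
    "\<And>e e'. e \<in> E \<Longrightarrow> e' \<in> E \<Longrightarrow> ip (T e) (T e') = (if e = e' then of_real (s e) else 0)"
    "\<And>I. finite I \<Longrightarrow> I \<subseteq> E \<Longrightarrow> (\<Sum>e\<in>I. s e powr (p / 2)) \<le> B"
proof -
  obtain S P where S: "is_adjoint H ip T S" and P: "is_power H ip (S \<circ> T) (p / 2) P"
    and tr: "trace_class H ip P" and co: "compact_op H ip T"
    using T unfolding schatten_class_def by blast
  obtain E s where E: "orthonormal_basis H ip E"
    and s: "\<And>e. e \<in> E \<Longrightarrow> 0 \<le> s e" "\<And>e. e \<in> E \<Longrightarrow> S (T e) = (\<lambda>x. complex_of_real (s e) * e x)"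
      "\<And>e. e \<in> E \<Longrightarrow> P e = (\<lambda>x. complex_of_real (s e powr (p / 2)) * e x)"
    using P unfolding is_power_def comp_def by blast
  have EH: "e \<in> H" if "e \<in> E" for e using that E unfolding orthonormal_basis_def by blast
  have ortho: "ip e e' = (if e = e' then 1 else 0)" if "e \<in> E" "e' \<in> E" for e e'
    using that E unfolding orthonormal_basis_def by blast
  have TH: "T f \<in> H" if "f \<in> H" for f using co that unfolding compact_op_def linear_op_def by blast
  obtain B where B: "\<And>I. finite I \<Longrightarrow> I \<subseteq> E \<Longrightarrow> (\<Sum>e\<in>I. s e powr (p / 2)) \<le> B"
    using trace_class_diagonal_bound[OF E _ s(3) tr] by (metis powr_ge_zero)
  have "ip (T e) (T e') = (if e = e' then of_real (s e) else 0)" if e: "e \<in> E" "e' \<in> E" for e e'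
  proof -
    have "ip (T e) (T e') = ip e (S (T e'))" using S EH TH e unfolding is_adjoint_def by blast
    also have "\<dots> = of_real (s e') * ip e e'"
      using s(2)[OF e(2)] ip_scale_right[OF EH[OF e(2)] EH[OF e(1)]] by simp
    finally show ?thesis using ortho[OF e] by simp
  qed
  then show thesis using that[OF E s(1) _ B] by blast
qed

end

section \<open>Automorphisms and the mean value inequality\<close>

text \<open>
  The inverse map is part of the data, so that both directions are known to be holomorphic.
\<close>

definition automorphism where
  "automorphism \<Omega> g h \<longleftrightarrow> holomorphic_map \<Omega> g \<and> holomorphic_map \<Omega> h \<and> g ` \<Omega> \<subseteq> \<Omega> \<and> h ` \<Omega> \<subseteq> \<Omega> \<and>
     (\<forall>z\<in>\<Omega>. h (g z) = z \<and> g (h z) = z)"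

lemma automorphismD:
  assumes "automorphism \<Omega> g h"
  shows "holomorphic_map \<Omega> g" "holomorphic_map \<Omega> h" "z \<in> \<Omega> \<Longrightarrow> g z \<in> \<Omega>" "z \<in> \<Omega> \<Longrightarrow> h z \<in> \<Omega>"
    "z \<in> \<Omega> \<Longrightarrow> h (g z) = z" "z \<in> \<Omega> \<Longrightarrow> g (h z) = z" "g ` \<Omega> \<subseteq> \<Omega>" "h ` \<Omega> \<subseteq> \<Omega>"
  using assms unfolding automorphism_def by auto

lemma automorphism_inverse: "automorphism \<Omega> g h \<Longrightarrow> automorphism \<Omega> h g"
  unfolding automorphism_def by auto

lemma automorphism_ident: "automorphism \<Omega> (\<lambda>z. z) (\<lambda>z. z)"
  unfolding automorphism_def holomorphic_map_def by (auto intro: holomorphic_fun_nth)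

lemma automorphism_compose:
  assumes "automorphism \<Omega> g h" "automorphism \<Omega> g' h'"
  shows "automorphism \<Omega> (\<lambda>z. g' (g z)) (\<lambda>z. h (h' z))"
  using automorphismD[OF assms(1)] automorphismD[OF assms(2)] unfolding automorphism_def
  by (auto intro!: holomorphic_map_compose[of \<Omega> g'] holomorphic_map_compose[of \<Omega> h])

lemma cjac_inverse:
  assumes "automorphism \<Omega> g h" "open \<Omega>" "z \<in> \<Omega>"
  shows "cjac h (g z) * cjac g z = 1"
proof -
  have "cjac h (g z) * cjac g z = cjac (\<lambda>z. h (g z)) z"
    using automorphismD[OF assms(1)] assms(3) by (intro cjac_compose[symmetric, of \<Omega> h \<Omega> g])
  also have "\<dots> = cjac (\<lambda>z. z) z"
    using automorphismD[OF assms(1)] by (intro cjac_cong[OF assms(2,3)] holomorphic_map_compose[of \<Omega> h \<Omega> g])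
  finally show ?thesis by (simp add: cjac_ident)
qed

lemma measurable_restrict_continuous:
  assumes "continuous_on \<Omega> f" shows "f \<in> borel_measurable (restrict_space lborel \<Omega>)"
  using borel_measurable_continuous_on_restrict[OF assms]
  by (simp add: measurable_restrict_space1 cong: measurable_cong_sets sets_restrict_space_cong)

lemma automorphism_distr:
  fixes \<Omega> :: "(complex ^ 'n) set"
  assumes \<Omega>: "open \<Omega>" "bounded \<Omega>" and g: "automorphism \<Omega> g h"
  shows "distr (density (restrict_space lborel \<Omega>) (\<lambda>z. ennreal ((cmod (cjac g z))\<^sup>2))) (restrict_space lborel \<Omega>) g
    = restrict_space lborel \<Omega>"
proof (rule measure_eqI)
  let ?R = "restrict_space lborel \<Omega>"
  note gD = automorphismD[OF g]
  have cont_g: "continuous_on \<Omega> g" by (rule holomorphic_map_continuous_on[OF gD(1)])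
  have meas_g: "g \<in> measurable ?R ?R"
    using measurable_restrict_continuous[OF cont_g] gD(3)
    by (intro measurable_restrict_space2) (auto simp: space_restrict_space)
  have meas_J: "(\<lambda>z. ennreal ((cmod (cjac g z))\<^sup>2)) \<in> borel_measurable ?R"
    using measurable_restrict_continuous[OF holomorphic_fun_continuous_on[OF holomorphic_fun_cjac[OF gD(1) \<Omega>(1)]]]
    by measurable
  fix A assume "A \<in> sets (distr (density ?R (\<lambda>z. ennreal ((cmod (cjac g z))\<^sup>2))) ?R g)"
  then have A: "A \<in> sets ?R" by simp
  then have A': "A \<in> sets borel" "A \<subseteq> \<Omega>" using \<Omega>(1) by (auto simp: sets_restrict_space)
  let ?S = "g -` A \<inter> \<Omega>"
  have S: "?S \<in> sets ?R" using measurable_sets[OF meas_g A] by (simp add: space_restrict_space)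
  then have S': "?S \<in> sets borel" using \<Omega>(1) by (auto simp: sets_restrict_space)
  have img: "g ` ?S = A"
  proof (intro equalityI subsetI)
    fix a assume a: "a \<in> A"
    then have "g (h a) = a" "h a \<in> \<Omega>" using gD(4,6) A'(2) by blast+
    then show "a \<in> g ` ?S" using a by (intro image_eqI[of _ _ "h a"]) auto
  qed auto
  have "emeasure (distr (density ?R (\<lambda>z. ennreal ((cmod (cjac g z))\<^sup>2))) ?R g) A
      = emeasure (density ?R (\<lambda>z. ennreal ((cmod (cjac g z))\<^sup>2))) ?S"
    using meas_g A by (subst emeasure_distr) (simp_all add: space_restrict_space)
  also have "\<dots> = (\<integral>\<^sup>+ z. ennreal ((cmod (cjac g z))\<^sup>2) * indicator ?S z \<partial>?R)"
    using meas_J S by (rule emeasure_density)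
  also have "\<dots> = (\<integral>\<^sup>+ z. ennreal ((cmod (cjac g z))\<^sup>2) * indicator ?S z * indicator \<Omega> z \<partial>lborel)"
    using \<Omega>(1) by (subst nn_integral_restrict_space) auto
  also have "\<dots> = (\<integral>\<^sup>+ z. ennreal ((cmod (cjac g z))\<^sup>2) * indicator ?S z \<partial>lborel)"
    by (intro nn_integral_cong) (auto simp: indicator_def)
  also have "\<dots> = emeasure lborel (g ` ?S)"
  proof (rule emeasure_biholomorphic_image[OF gD(1) \<Omega>(1)])
    show "inj_on g \<Omega>" using gD(5) by (metis inj_onI)
    show "cjac g z \<noteq> 0" if "z \<in> \<Omega>" for z using cjac_inverse[OF g \<Omega>(1) that] by auto
    show "emeasure lborel (g ` ?S) < \<infinity>"
      unfolding img using A'(2) \<Omega>(2) by (intro emeasure_bounded_finite bounded_subset[OF \<Omega>(2)])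
  qed (use S' A' img in auto)
  also have "\<dots> = emeasure ?R A"
    unfolding img using A' \<Omega>(1) by (subst emeasure_restrict_space) auto
  finally show "emeasure (distr (density ?R (\<lambda>z. ennreal ((cmod (cjac g z))\<^sup>2))) ?R g) A = emeasure ?R A" .
qed simp

lemma automorphism_measurable:
  assumes "open \<Omega>" "automorphism \<Omega> g h"
  shows "g \<in> measurable (restrict_space lborel \<Omega>) (restrict_space lborel \<Omega>)"
    "(\<lambda>z. cjac g z) \<in> borel_measurable (restrict_space lborel \<Omega>)"
  using automorphismD[OF assms(2)] assms(1)
  by (auto simp: space_restrict_space
      intro!: measurable_restrict_space2 measurable_restrict_continuous holomorphic_map_continuous_on
        holomorphic_fun_continuous_on holomorphic_fun_cjac)

lemma automorphism_nn_integral: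
  assumes \<Omega>: "open \<Omega>" "bounded \<Omega>" and g: "automorphism \<Omega> g h"
    and F: "F \<in> borel_measurable (restrict_space lborel \<Omega>)"
  shows "(\<integral>\<^sup>+ z. ennreal ((cmod (cjac g z))\<^sup>2) * F (g z) \<partial>restrict_space lborel \<Omega>) = (\<integral>\<^sup>+ z. F z \<partial>restrict_space lborel \<Omega>)"
proof -
  let ?R = "restrict_space lborel \<Omega>"
  note [measurable] = automorphism_measurable[OF \<Omega>(1) g] F
  have "(\<integral>\<^sup>+ z. F z \<partial>?R) = (\<integral>\<^sup>+ z. F z \<partial>distr (density ?R (\<lambda>z. ennreal ((cmod (cjac g z))\<^sup>2))) ?R g)"
    by (simp only: automorphism_distr[OF \<Omega> g])
  also have "\<dots> = (\<integral>\<^sup>+ z. F (g z) \<partial>density ?R (\<lambda>z. ennreal ((cmod (cjac g z))\<^sup>2)))"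
    by (rule nn_integral_distr) simp_all
  also have "\<dots> = (\<integral>\<^sup>+ z. ennreal ((cmod (cjac g z))\<^sup>2) * F (g z) \<partial>?R)"
    by (rule nn_integral_density) simp_all
  finally show ?thesis by simp
qed

lemma cjac_affine:
  fixes a z :: "complex ^ 'n"
  shows "cjac (\<lambda>z. a + c *s z) z = c ^ CARD('n)"
proof -
  have "cderiv (\<lambda>z. (a + c *s z) $ i) z = (\<lambda>v. c * v $ i)" for i
    by (rule cderiv_unique) (auto intro!: derivative_eq_intros bounded_linear.has_derivative[OF bounded_linear_vec_nth])
  then have "cjac (\<lambda>z. a + c *s z) z = det (\<chi> i j. c * (if i = j then 1 else 0) :: complex ^ 'n ^ 'n)"
    by (simp add: cjac_def axis_def)
  also have "\<dots> = (\<Prod>i\<in>(UNIV :: 'n set). c)"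
    by (subst det_diagonal) auto
  finally show ?thesis by simp
qed

lemma rotation_automorphism:
  fixes z :: "complex ^ 'n"
  assumes c: "norm c = 1" and rot: "\<And>w c. w \<in> \<Omega> \<Longrightarrow> norm c = 1 \<Longrightarrow> (z - c *s z) + c *s w \<in> \<Omega>"
  shows "automorphism \<Omega> (\<lambda>w. (z - c *s z) + c *s w) (\<lambda>w. (z - inverse c *s z) + inverse c *s w)"
proof -
  have "c \<noteq> 0" using c by auto
  then show ?thesis
    using rot c unfolding automorphism_def
    by (auto simp: holomorphic_map_affine norm_inverse vector_smult_assoc vector_ssub_ldistrib vector_add_ldistrib)
qed

text \<open>
  Cauchy's integral formula for \<open>h\<^sup>2\<close> gives the mean value inequality for
  \<open>\<bar>h\<bar>\<^sup>2\<close> at once.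
\<close>

lemma norm_sq_le_circle_average:
  assumes h: "h holomorphic_on S" "open S" "cball 0 1 \<subseteq> S"
  shows "ennreal ((cmod (h 0))\<^sup>2) \<le> (\<integral>\<^sup>+ t. ennreal ((cmod (h (exp (2 * of_real pi * \<i> * of_real t))))\<^sup>2) * indicator {0..1} t \<partial>lborel)"
proof -
  let ?c = "\<lambda>t. exp (2 * of_real pi * \<i> * of_real t) :: complex"
  let ?g = "\<lambda>\<zeta>. (h \<zeta>)\<^sup>2"
  have "((\<lambda>u. ?g u / (u - 0)) has_contour_integral (2 * of_real pi * \<i> * ?g 0)) (circlepath 0 1)"
    using h by (intro Cauchy_integral_circlepath_simple holomorphic_intros) (auto intro: holomorphic_on_subset)
  then have "((\<lambda>t. ?g (?c t) / ?c t * (2 * of_real pi * \<i> * ?c t)) has_integral (2 * of_real pi * \<i> * ?g 0)) {0..1}"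
    unfolding has_contour_integral_def
    by (rule has_integral_eq[rotated]) (simp add: vector_derivative_circlepath01 circlepath[THEN fun_cong])
  then have "((\<lambda>t. (1 / (2 * of_real pi * \<i>)) * (?g (?c t) / ?c t * (2 * of_real pi * \<i> * ?c t)))
      has_integral (1 / (2 * of_real pi * \<i>)) * (2 * of_real pi * \<i> * ?g 0)) {0..1}"
    by (rule has_integral_mult_right)
  then have int: "((\<lambda>t. ?g (?c t)) has_integral ?g 0) {0..1}"
    by simp
  have cont: "continuous_on {0..1} (\<lambda>t. (cmod (h (?c t)))\<^sup>2)"
  proof -
    have "continuous_on {0..1} (\<lambda>t. h (?c t))"
    proof (rule continuous_on_compose2[OF holomorphic_on_imp_continuous_on[OF h(1)]])
      show "?c ` {0..1} \<subseteq> S" using h(3) by (auto simp: subset_iff norm_exp_eq_Re)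
    qed (intro continuous_intros)
    then show ?thesis by (intro continuous_intros)
  qed
  then have hi: "((\<lambda>t. (cmod (h (?c t)))\<^sup>2) has_integral integral {0..1} (\<lambda>t. (cmod (h (?c t)))\<^sup>2)) {0..1}"
    by (intro integrable_integral integrable_continuous_real)
  have "(cmod (h 0))\<^sup>2 = norm (?g 0)" by (simp add: norm_power)
  also have "\<dots> \<le> integral {0..1} (\<lambda>t. (cmod (h (?c t)))\<^sup>2)"
    using integral_norm_bound_integral[of "\<lambda>t. ?g (?c t)" "{0..1}" "\<lambda>t. (cmod (h (?c t)))\<^sup>2"] int hi
    by (simp add: has_integral_integrable_integral norm_power)
  finally have "ennreal ((cmod (h 0))\<^sup>2) \<le> ennreal (integral {0..1} (\<lambda>t. (cmod (h (?c t)))\<^sup>2))"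
    by (rule ennreal_leI)
  also have "\<dots> = (\<integral>\<^sup>+ t. ennreal ((cmod (h (?c t)))\<^sup>2) * indicator {0..1} t \<partial>lborel)"
    using hi by (intro nn_integral_has_integral_lebesgue'[symmetric]) auto
  finally show ?thesis .
qed

text \<open>
  Average the inequality in one variable over the complex lines through \<open>z\<close>: the
  ball and its volume are invariant under the rotations \<open>w \<mapsto> z + c (w -
  z)\<close>, so by Tonelli's theorem the average over \<open>c\<close> does not change the
  integral.
\<close>

lemma mean_value_ball:
  fixes f :: "complex ^ 'n \<Rightarrow> complex"
  assumes f: "holomorphic_fun (ball z r) f"
  shows "ennreal ((cmod (f z))\<^sup>2) * emeasure lborel (ball z r) \<le> (\<integral>\<^sup>+ x. ennreal ((cmod (f x))\<^sup>2) * indicator (ball z r) x \<partial>lborel)"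
proof -
  let ?B = "ball z r"
  let ?c = "\<lambda>t. exp (2 * of_real pi * \<i> * of_real t) :: complex"
  let ?R = "\<lambda>c x. (z - c *s z) + c *s x"
  have R_eq: "?R c x = z + c *s (x - z)" for c x by (simp add: vec_eq_iff algebra_simps)
  have nc: "norm (?c t) = 1" for t by (simp add: norm_exp_eq_Re)
  have rot: "?R c w \<in> ?B" if "w \<in> ?B" "norm c = 1" for w c
    unfolding R_eq using that by (intro line_in_ball) (simp add: dist_norm norm_minus_commute)
  have contf: "continuous_on ?B f" by (rule holomorphic_fun_continuous_on[OF f])
  define G where "G = (\<lambda>(t, x). ennreal ((cmod (f (?R (?c t) x)))\<^sup>2) * indicator ?B x * indicator {0..1} t)"
  have G: "G \<in> borel_measurable (lborel \<Otimes>\<^sub>M lborel)"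
  proof -
    have cont: "continuous_on (UNIV \<times> ?B) (\<lambda>p. f (?R (?c (fst p)) (snd p)))"
    proof (rule continuous_on_compose2[OF contf])
      show "continuous_on (UNIV \<times> ?B) (\<lambda>p. ?R (?c (fst p)) (snd p))"
        by (intro continuous_intros)
      show "(\<lambda>p. ?R (?c (fst p)) (snd p)) ` (UNIV \<times> ?B) \<subseteq> ?B" using rot nc by auto
    qed
    define q where "q = (\<lambda>p. indicator (UNIV \<times> ?B) p *\<^sub>R f (?R (?c (fst p)) (snd p)))"
    have [measurable]: "UNIV \<times> ?B \<in> sets (borel :: (real \<times> (complex ^ 'n)) measure)"
      "{0..1} \<times> UNIV \<in> sets (borel :: (real \<times> (complex ^ 'n)) measure)"
      by (intro borel_open open_Times open_UNIV open_ball, intro borel_closed closed_Times closed_UNIV closed_atLeastAtMost)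
    have [measurable]: "q \<in> borel_measurable borel"
      unfolding q_def by (intro borel_measurable_continuous_on_indicator cont) measurable
    have "(\<lambda>p. ennreal ((cmod (q p))\<^sup>2) * indicator (UNIV \<times> ?B) p * indicator ({0..1} \<times> UNIV) p) \<in> borel_measurable borel"
      by measurable
    also have "(\<lambda>p. ennreal ((cmod (q p))\<^sup>2) * indicator (UNIV \<times> ?B) p * indicator ({0..1} \<times> UNIV) p) = G"
      by (auto simp: G_def q_def fun_eq_iff indicator_def)
    finally show ?thesis by (simp add: lborel_prod)
  qed
  have rotint: "(\<integral>\<^sup>+ x. G (t, x) \<partial>lborel) = (\<integral>\<^sup>+ x. ennreal ((cmod (f x))\<^sup>2) * indicator ?B x \<partial>lborel) * indicator {0..1} t" for t
  proof -
    have meas: "(\<lambda>x. ennreal ((cmod (f x))\<^sup>2)) \<in> borel_measurable (restrict_space lborel ?B)"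
      using measurable_restrict_continuous[OF contf] by measurable
    have "(\<integral>\<^sup>+ x. ennreal ((cmod (cjac (?R (?c t)) x))\<^sup>2) * ennreal ((cmod (f (?R (?c t) x)))\<^sup>2) \<partial>restrict_space lborel ?B)
        = (\<integral>\<^sup>+ x. ennreal ((cmod (f x))\<^sup>2) \<partial>restrict_space lborel ?B)"
      by (rule automorphism_nn_integral[OF open_ball bounded_ball rotation_automorphism[OF nc[of t] rot] meas])
    then have "(\<integral>\<^sup>+ x. ennreal ((cmod (f (?R (?c t) x)))\<^sup>2) * indicator ?B x \<partial>lborel)
        = (\<integral>\<^sup>+ x. ennreal ((cmod (f x))\<^sup>2) * indicator ?B x \<partial>lborel)"
      by (simp add: cjac_affine norm_power nc nn_integral_restrict_space)
    then show ?thesis by (cases "t \<in> {0..1}") (simp_all add: G_def)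
  qed
  have "ennreal ((cmod (f z))\<^sup>2) * emeasure lborel ?B = (\<integral>\<^sup>+ x. ennreal ((cmod (f z))\<^sup>2) * indicator ?B x \<partial>lborel)"
    by (simp add: nn_integral_cmult_indicator)
  also have "\<dots> \<le> (\<integral>\<^sup>+ x. (\<integral>\<^sup>+ t. G (t, x) \<partial>lborel) \<partial>lborel)"
  proof (rule nn_integral_mono)
    fix x :: "complex ^ 'n"
    show "ennreal ((cmod (f z))\<^sup>2) * indicator ?B x \<le> (\<integral>\<^sup>+ t. G (t, x) \<partial>lborel)"
    proof (cases "x \<in> ?B")
      case True
      define S where "S = {\<zeta> :: complex. norm \<zeta> * norm (x - z) < r}"
      have S: "open S" "cball 0 1 \<subseteq> S"
      proof -
        show "open S" unfolding S_def by (intro open_Collect_less continuous_intros)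
        show "cball 0 1 \<subseteq> S"
        proof
          fix \<zeta> :: complex assume "\<zeta> \<in> cball 0 1"
          then have "norm \<zeta> * norm (x - z) \<le> 1 * norm (x - z)" by (intro mult_right_mono) auto
          then show "\<zeta> \<in> S" using True by (simp add: S_def dist_norm norm_minus_commute)
        qed
      qed
      have "(\<lambda>\<zeta>. f (z + \<zeta> *s (x - z))) holomorphic_on S"
        by (rule holomorphic_on_line[OF f line_in_ball]) (simp add: S_def)
      from norm_sq_le_circle_average[OF this S]
      show ?thesis using True by (simp add: G_def R_eq)
    qed simp
  qed
  also have "\<dots> = (\<integral>\<^sup>+ t. (\<integral>\<^sup>+ x. G (t, x) \<partial>lborel) \<partial>lborel)"
    by (rule lborel_pair.Fubini[OF G])
  also have "\<dots> = (\<integral>\<^sup>+ x. ennreal ((cmod (f x))\<^sup>2) * indicator ?B x \<partial>lborel)"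
    unfolding rotint by (simp add: nn_integral_cmult_indicator)
  finally show ?thesis .
qed

section \<open>Weighted Bergman spaces\<close>

text \<open>
  Local boundedness of the point evaluations makes norm convergence locally uniform;
  completeness and the reproducing kernel follow from it.
\<close>

locale bergman_measure =
  fixes \<Omega> :: "(complex ^ 'n) set" and M :: "(complex ^ 'n) measure"
  assumes open_\<Omega>: "open \<Omega>" and space_M: "space M = \<Omega>" and sets_M: "sets M = sets (restrict_space lborel \<Omega>)"
    and local_bound: "a \<in> \<Omega> \<Longrightarrow> \<exists>r>0. \<exists>C. cball a r \<subseteq> \<Omega> \<and>
      (\<forall>f z. f \<in> bergman_space \<Omega> M \<longrightarrow> z \<in> cball a r \<longrightarrow> (norm (f z))\<^sup>2 \<le> C * (LINT x|M. (norm (f x))\<^sup>2))"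
begin

abbreviation "A2 \<equiv> bergman_space \<Omega> M"
abbreviation "A2_norm \<equiv> ip_norm (L2_inner M)"

lemma holomorphic_measurable: "holomorphic_fun \<Omega> f \<Longrightarrow> f \<in> borel_measurable M"
  using measurable_restrict_continuous[OF holomorphic_fun_continuous_on[of \<Omega> f]]
  by (simp add: measurable_cong_sets[OF sets_M refl])

lemma A2D:
  assumes "f \<in> A2"
  shows "holomorphic_fun \<Omega> f" "z \<notin> \<Omega> \<Longrightarrow> f z = 0" "integrable M (\<lambda>z. (norm (f z))\<^sup>2)" "f \<in> borel_measurable M"
  using assms holomorphic_measurable unfolding bergman_space_def by auto

lemma A2I:
  assumes "holomorphic_fun \<Omega> f" "\<And>z. z \<notin> \<Omega> \<Longrightarrow> f z = 0"
    and "(\<integral>\<^sup>+ z. ennreal ((norm (f z))\<^sup>2) \<partial>M) < \<infinity>"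
  shows "f \<in> A2"
proof -
  have [measurable]: "f \<in> borel_measurable M" by (rule holomorphic_measurable[OF assms(1)])
  have "integrable M (\<lambda>z. (norm (f z))\<^sup>2)"
    using assms(3) by (intro integrableI_nonneg) auto
  then show ?thesis using assms unfolding bergman_space_def by auto
qed

lemma A2_zero: "(\<lambda>x. 0) \<in> A2"
  by (auto simp: bergman_space_def holomorphic_fun_const)

lemma A2_scale: "f \<in> A2 \<Longrightarrow> (\<lambda>x. c * f x) \<in> A2"
  by (auto simp: bergman_space_def holomorphic_fun_cmult norm_mult power_mult_distrib)

lemma A2_add:
  assumes "f \<in> A2" "g \<in> A2" shows "(\<lambda>x. f x + g x) \<in> A2"
proof -
  note [measurable] = A2D(4)[OF assms(1)] A2D(4)[OF assms(2)]
  have "integrable M (\<lambda>x. 2 * (norm (f x))\<^sup>2 + 2 * (norm (g x))\<^sup>2)"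
    using A2D(3) assms by auto
  then have "integrable M (\<lambda>x. (norm (f x + g x))\<^sup>2)"
  proof (rule Bochner_Integration.integrable_bound)
    have *: "(norm (f x + g x))\<^sup>2 \<le> 2 * (norm (f x))\<^sup>2 + 2 * (norm (g x))\<^sup>2" for x
    proof -
      have "(norm (f x + g x))\<^sup>2 \<le> (norm (f x) + norm (g x))\<^sup>2"
        by (intro power_mono norm_triangle_ineq) auto
      also have "\<dots> \<le> 2 * (norm (f x))\<^sup>2 + 2 * (norm (g x))\<^sup>2"
        using sum_squares_bound[of "norm (f x)" "norm (g x)"] by (simp add: power2_sum)
      finally show ?thesis .
    qed
    show "AE x in M. norm ((norm (f x + g x))\<^sup>2) \<le> norm (2 * (norm (f x))\<^sup>2 + 2 * (norm (g x))\<^sup>2)"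
    proof (rule AE_I2)
      show "norm ((norm (f x + g x))\<^sup>2) \<le> norm (2 * (norm (f x))\<^sup>2 + 2 * (norm (g x))\<^sup>2)" for x
        using *[of x] by simp
    qed
  qed simp
  then show ?thesis
    using A2D[OF assms(1)] A2D[OF assms(2)] by (auto simp: bergman_space_def intro: holomorphic_fun_add)
qed

lemma A2_inner_integrable:
  assumes "f \<in> A2" "g \<in> A2" shows "integrable M (\<lambda>x. f x * cnj (g x))"
proof (rule Bochner_Integration.integrable_bound)
  note [measurable] = A2D(4)[OF assms(1)] A2D(4)[OF assms(2)]
  show "integrable M (\<lambda>x. (norm (f x))\<^sup>2 + (norm (g x))\<^sup>2)" using A2D(3) assms by auto
  show "(\<lambda>x. f x * cnj (g x)) \<in> borel_measurable M"
  proof -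
    have "cnj \<in> borel_measurable borel" by (intro borel_measurable_continuous_onI continuous_intros)
    from measurable_compose[OF A2D(4)[OF assms(2)] this] show ?thesis by measurable
  qed
  have *: "norm (f x * cnj (g x)) \<le> (norm (f x))\<^sup>2 + (norm (g x))\<^sup>2" for x
  proof -
    have "0 \<le> norm (f x) * norm (g x)" by simp
    then show ?thesis
      using sum_squares_bound[of "norm (f x)" "norm (g x)"] unfolding norm_mult complex_mod_cnj by linarith
  qed
  show "AE x in M. norm (f x * cnj (g x)) \<le> norm ((norm (f x))\<^sup>2 + (norm (g x))\<^sup>2)"
    by (intro AE_I2 order_trans[OF *]) simp
qed

lemma A2_inner_self:
  "Re (L2_inner M f f) = (LINT x|M. (norm (f x))\<^sup>2)"
proof -
  have "L2_inner M f f = (LINT x|M. complex_of_real ((norm (f x))\<^sup>2))"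
    unfolding L2_inner_def by (simp only: complex_norm_square)
  then show ?thesis by (simp only: integral_complex_of_real Re_complex_of_real)
qed

lemma A2_norm_sq: "(A2_norm f)\<^sup>2 = (LINT x|M. (norm (f x))\<^sup>2)"
  unfolding ip_norm_def A2_inner_self by (simp add: integral_nonneg_AE)

lemma A2_norm_nonneg: "0 \<le> A2_norm f"
  by (simp add: ip_norm_def A2_inner_self integral_nonneg_AE)

lemma A2_nn_norm: "f \<in> A2 \<Longrightarrow> (\<integral>\<^sup>+ z. ennreal ((norm (f z))\<^sup>2) \<partial>M) = ennreal ((A2_norm f)\<^sup>2)"
  unfolding A2_norm_sq by (intro nn_integral_eq_integral A2D) auto

lemma evaluation_bound:
  assumes "a \<in> \<Omega>"
  obtains r C where "r > 0" "cball a r \<subseteq> \<Omega>" "C > 0" "\<And>f z. f \<in> A2 \<Longrightarrow> z \<in> cball a r \<Longrightarrow> norm (f z) \<le> C * A2_norm f"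
proof -
  obtain r C where rC: "r > 0" "cball a r \<subseteq> \<Omega>"
    "\<And>f z. f \<in> A2 \<Longrightarrow> z \<in> cball a r \<Longrightarrow> (norm (f z))\<^sup>2 \<le> C * (LINT x|M. (norm (f x))\<^sup>2)"
    using local_bound[OF assms] by blast
  have "norm (f z) \<le> (sqrt \<bar>C\<bar> + 1) * A2_norm f" if f: "f \<in> A2" "z \<in> cball a r" for f z
  proof (rule power2_le_imp_le)
    have "(norm (f z))\<^sup>2 \<le> C * (A2_norm f)\<^sup>2" using rC(3)[OF f] by (simp add: A2_norm_sq)
    also have "\<dots> \<le> (sqrt \<bar>C\<bar> + 1)\<^sup>2 * (A2_norm f)\<^sup>2"
    proof (rule mult_right_mono)
      have "C \<le> (sqrt \<bar>C\<bar>)\<^sup>2" by simp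
      also have "\<dots> \<le> (sqrt \<bar>C\<bar> + 1)\<^sup>2" by (intro power_mono) auto
      finally show "C \<le> (sqrt \<bar>C\<bar> + 1)\<^sup>2" .
    qed simp
    finally show "(norm (f z))\<^sup>2 \<le> ((sqrt \<bar>C\<bar> + 1) * A2_norm f)\<^sup>2" by (simp add: power_mult_distrib)
  qed (simp add: A2_norm_nonneg)
  moreover have "sqrt \<bar>C\<bar> + 1 > 0" by (smt (verit) real_sqrt_ge_zero abs_ge_zero)
  ultimately show thesis using that[OF rC(1,2)] by blast
qed

text \<open>
  A Cauchy sequence converges locally uniformly by the bound on point evaluations, so its
  limit is holomorphic; Fatou's lemma shows that it is also the limit in norm.
\<close>

lemma A2_complete:
  assumes F: "\<And>n. F n \<in> A2"
    and Cau: "\<And>e. e > 0 \<Longrightarrow> \<exists>N. \<forall>m\<ge>N. \<forall>n\<ge>N. A2_norm (\<lambda>x. F m x - F n x) < e"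
  shows "\<exists>g\<in>A2. (\<lambda>n. A2_norm (\<lambda>x. F n x - g x)) \<longlonglongrightarrow> 0"
proof -
  have diff: "(\<lambda>x. F m x - F n x) \<in> A2" for m n
    using A2_add[OF F A2_scale[OF F, of "-1"], of m n] by simp
  define g where "g = (\<lambda>x. lim (\<lambda>n. F n x))"
  have loc: "\<exists>r>0. cball a r \<subseteq> \<Omega> \<and> uniform_limit (cball a r) F g sequentially" if a: "a \<in> \<Omega>" for a
  proof -
    obtain r C where rC: "r > 0" "cball a r \<subseteq> \<Omega>" "C > 0"
      "\<And>f z. f \<in> A2 \<Longrightarrow> z \<in> cball a r \<Longrightarrow> norm (f z) \<le> C * A2_norm f"
      using evaluation_bound[OF a] by metis
    have "uniformly_Cauchy_on (cball a r) F"
    proof (rule uniformly_Cauchy_onI)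
      fix e :: real assume e: "e > 0"
      then have "e / C > 0" using rC by simp
      then obtain N where N: "\<And>m n. m \<ge> N \<Longrightarrow> n \<ge> N \<Longrightarrow> A2_norm (\<lambda>x. F m x - F n x) < e / C"
        using Cau by blast
      have "dist (F m x) (F n x) < e" if "x \<in> cball a r" "m \<ge> N" "n \<ge> N" for x m n
      proof -
        have "norm (F m x - F n x) \<le> C * A2_norm (\<lambda>x. F m x - F n x)"
          using rC(4)[OF diff that(1)] .
        also have "\<dots> < C * (e / C)" using N[OF that(2,3)] rC(3) by (intro mult_strict_left_mono)
        finally show ?thesis using rC(3) by (simp add: dist_norm)
      qed
      then show "\<exists>N. \<forall>x\<in>cball a r. \<forall>m\<ge>N. \<forall>n\<ge>N. dist (F m x) (F n x) < e" by blast
    qed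
    then have "uniformly_convergent_on (cball a r) F" by (rule Cauchy_uniformly_convergent)
    then have "uniform_limit (cball a r) F g sequentially"
      unfolding g_def by (simp add: uniformly_convergent_uniform_limit_iff)
    then show ?thesis using rC by blast
  qed
  have hol: "holomorphic_fun \<Omega> g" by (rule holomorphic_fun_limit[OF A2D(1)[OF F] loc])
  have pt: "(\<lambda>n. F n x) \<longlonglongrightarrow> g x" for x
  proof (cases "x \<in> \<Omega>")
    case True
    then obtain r where "r > 0" "uniform_limit (cball x r) F g sequentially" using loc by blast
    then show ?thesis by (intro tendsto_uniform_limitI) auto
  next
    case False
    then have "F n x = 0" for n using A2D(2)[OF F] by blast
    then show ?thesis by (simp add: g_def)
  qed
  have g0: "g z = 0" if "z \<notin> \<Omega>" for z
    using that A2D(2)[OF F] by (simp add: g_def)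
  have g_meas: "g \<in> borel_measurable M" by (rule holomorphic_measurable[OF hol])
  note [measurable] = g_meas A2D(4)[OF F]
  have est: "(\<integral>\<^sup>+ x. ennreal ((norm (F n x - g x))\<^sup>2) \<partial>M) \<le> ennreal (e\<^sup>2)"
    if N: "\<And>m n. m \<ge> N \<Longrightarrow> n \<ge> N \<Longrightarrow> A2_norm (\<lambda>x. F m x - F n x) < e" and n: "n \<ge> N" for e N n
  proof -
    have "liminf (\<lambda>m. ennreal ((norm (F n x - F m x))\<^sup>2)) = ennreal ((norm (F n x - g x))\<^sup>2)" for x
      by (intro lim_imp_Liminf sequentially_bot tendsto_intros tendsto_ennrealI pt)
    then have "(\<integral>\<^sup>+ x. ennreal ((norm (F n x - g x))\<^sup>2) \<partial>M)
        = (\<integral>\<^sup>+ x. liminf (\<lambda>m. ennreal ((norm (F n x - F m x))\<^sup>2)) \<partial>M)"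
      by simp
    also have "\<dots> \<le> liminf (\<lambda>m. \<integral>\<^sup>+ x. ennreal ((norm (F n x - F m x))\<^sup>2) \<partial>M)"
      by (rule nn_integral_liminf) measurable
    also have "\<dots> \<le> ennreal (e\<^sup>2)"
    proof (rule Liminf_le)
      show "\<forall>\<^sub>F m in sequentially. (\<integral>\<^sup>+ x. ennreal ((norm (F n x - F m x))\<^sup>2) \<partial>M) \<le> ennreal (e\<^sup>2)"
        unfolding eventually_sequentially
      proof (intro exI[of _ N] allI impI)
        fix m assume m: "N \<le> m"
        have "(A2_norm (\<lambda>x. F n x - F m x))\<^sup>2 \<le> e\<^sup>2"
          using N[OF n m] by (intro power_mono) (auto simp: A2_norm_nonneg)
        then show "(\<integral>\<^sup>+ x. ennreal ((norm (F n x - F m x))\<^sup>2) \<partial>M) \<le> ennreal (e\<^sup>2)"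
          using A2_nn_norm[OF diff, of n m] by (simp add: ennreal_leI)
      qed
    qed simp
    finally show ?thesis .
  qed
  have dg: "(\<lambda>x. F n x - g x) \<in> A2" if "(\<integral>\<^sup>+ x. ennreal ((norm (F n x - g x))\<^sup>2) \<partial>M) < \<infinity>" for n
    using that g0 A2D(2)[OF F]
    by (intro A2I holomorphic_fun_diff hol A2D(1)[OF F]) auto
  have "g \<in> A2"
  proof -
    obtain N where N: "\<And>m n. m \<ge> N \<Longrightarrow> n \<ge> N \<Longrightarrow> A2_norm (\<lambda>x. F m x - F n x) < 1"
      using Cau[of 1] by auto
    have "(\<integral>\<^sup>+ x. ennreal ((norm (F N x - g x))\<^sup>2) \<partial>M) < \<infinity>"
      by (rule le_less_trans[OF est[OF N order_refl]]) auto
    from A2_add[OF F[of N] A2_scale[OF dg[OF this], of "-1"]] show ?thesis by simp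
  qed
  moreover have "(\<lambda>n. A2_norm (\<lambda>x. F n x - g x)) \<longlonglongrightarrow> 0"
  proof (rule LIMSEQ_I)
    fix e :: real assume e: "e > 0"
    obtain N where N: "\<And>m n. m \<ge> N \<Longrightarrow> n \<ge> N \<Longrightarrow> A2_norm (\<lambda>x. F m x - F n x) < e / 2"
      using Cau[of "e / 2"] e by auto
    have "norm (A2_norm (\<lambda>x. F n x - g x) - 0) < e" if n: "n \<ge> N" for n
    proof -
      have le: "(\<integral>\<^sup>+ x. ennreal ((norm (F n x - g x))\<^sup>2) \<partial>M) \<le> ennreal ((e / 2)\<^sup>2)" by (rule est[OF N n])
      then have "(\<integral>\<^sup>+ x. ennreal ((norm (F n x - g x))\<^sup>2) \<partial>M) < \<infinity>" by (rule le_less_trans) simp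
      then have "ennreal ((A2_norm (\<lambda>x. F n x - g x))\<^sup>2) \<le> ennreal ((e / 2)\<^sup>2)"
        using le A2_nn_norm[OF dg] by simp
      then have "(A2_norm (\<lambda>x. F n x - g x))\<^sup>2 \<le> (e / 2)\<^sup>2" by (simp add: ennreal_le_iff)
      then have "A2_norm (\<lambda>x. F n x - g x) \<le> e / 2" by (rule power2_le_imp_le) (use e in simp)
      then show ?thesis using e A2_norm_nonneg[of "\<lambda>x. F n x - g x"] by simp
    qed
    then show "\<exists>no. \<forall>n\<ge>no. norm (A2_norm (\<lambda>x. F n x - g x) - 0) < e" by blast
  qed
  ultimately show ?thesis by blast
qed

sublocale function_hilbert_space A2 "L2_inner M"
proof
  show "L2_inner M (\<lambda>x. f x + g x) h = L2_inner M f h + L2_inner M g h"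
    if "f \<in> A2" "g \<in> A2" "h \<in> A2" for f g h
    unfolding L2_inner_def using A2_inner_integrable that by (simp add: distrib_right)
  show "L2_inner M (\<lambda>x. c * f x) h = c * L2_inner M f h" if "f \<in> A2" "h \<in> A2" for f h c
    unfolding L2_inner_def by (simp add: mult.assoc)
  show "L2_inner M g f = cnj (L2_inner M f g)" if "f \<in> A2" "g \<in> A2" for f g
  proof -
    have "cnj (LINT z|M. f z * cnj (g z)) = (LINT z|M. cnj (f z * cnj (g z)))"
      by (rule Bochner_Integration.integral_bounded_linear[OF bounded_linear_cnj, symmetric])
        (rule A2_inner_integrable[OF that])
    then show ?thesis unfolding L2_inner_def by (simp add: mult.commute)
  qed
  show "0 \<le> Re (L2_inner M f f)" for f
    unfolding A2_inner_self by (simp add: integral_nonneg_AE)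
  show "f = (\<lambda>x. 0)" if f: "f \<in> A2" "Re (L2_inner M f f) = 0" for f
  proof
    fix x
    show "f x = 0"
    proof (cases "x \<in> \<Omega>")
      case True
      obtain r C where "r > 0" "\<And>f z. f \<in> A2 \<Longrightarrow> z \<in> cball x r \<Longrightarrow> norm (f z) \<le> C * A2_norm f"
        using evaluation_bound[OF True] by metis
      then have "norm (f x) \<le> C * A2_norm f" using f by simp
      also have "A2_norm f = 0" using f by (simp add: ip_norm_def)
      finally show ?thesis by simp
    qed (use A2D(2)[OF f(1)] in simp)
  qed
qed (use A2_zero A2_add A2_scale A2_complete in auto)

lemma reproducing_kernel_exists:
  assumes "a \<in> \<Omega>" shows "\<exists>!k. k \<in> A2 \<and> (\<forall>f\<in>A2. f a = L2_inner M f k)"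
proof -
  obtain r C where "r > 0" "\<And>f z. f \<in> A2 \<Longrightarrow> z \<in> cball a r \<Longrightarrow> norm (f z) \<le> C * A2_norm f"
    using evaluation_bound[OF assms] by metis
  then have "\<exists>k\<in>A2. \<forall>f\<in>A2. f a = L2_inner M f k"
    by (intro Riesz_representation[of "\<lambda>f. f a" C]) auto
  then obtain k where k: "k \<in> A2" "\<forall>f\<in>A2. f a = L2_inner M f k" by blast
  show ?thesis
  proof (rule ex1I[of _ k])
    fix k' assume k': "k' \<in> A2 \<and> (\<forall>f\<in>A2. f a = L2_inner M f k')"
    have d: "(\<lambda>x. k' x - k x) \<in> A2" using k k' by (intro diff_mem) auto
    let ?d = "\<lambda>x. k' x - k x"
    have "L2_inner M ?d k' = ?d a" "L2_inner M ?d k = ?d a"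
      using bspec[OF k(2) d] bspec[OF conjunct2[OF k'] d] by simp_all
    then have "L2_inner M ?d ?d = 0"
      using ip_diff_right[OF _ k(1) d, of k'] k' by simp
    then have "(\<lambda>x. k' x - k x) = (\<lambda>x. 0)" by (intro ip_definite[OF d]) simp
    then show "k' = k" by (simp add: fun_eq_iff)
  qed (use k in blast)
qed

end

text \<open>
  On a compact ball the weight is bounded below, so the mean value inequality for volume
  measure controls point evaluations.
\<close>

lemma bergman_measure_density:
  fixes \<Omega> :: "(complex ^ 'n) set"
  assumes \<Omega>: "open \<Omega>" and w: "continuous_on \<Omega> w" "\<And>z. z \<in> \<Omega> \<Longrightarrow> 0 < w z"
  shows "bergman_measure \<Omega> (density (restrict_space lborel \<Omega>) (\<lambda>z. ennreal (w z)))" (is "bergman_measure \<Omega> ?M")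
proof
  show "open \<Omega>" by fact
  show "space ?M = \<Omega>" "sets ?M = sets (restrict_space lborel \<Omega>)" by (simp_all add: space_restrict_space)
  fix a assume a: "a \<in> \<Omega>"
  obtain r' where r': "r' > 0" "cball a r' \<subseteq> \<Omega>" using \<Omega> a open_contains_cball by blast
  define r where "r = r' / 2"
  have r: "r > 0" using r' by (simp add: r_def)
  obtain x where x: "x \<in> cball a r'" "\<And>y. y \<in> cball a r' \<Longrightarrow> w x \<le> w y"
    using continuous_attains_inf[of "cball a r'" w] continuous_on_subset[OF w(1) r'(2)] r'(1) by auto
  define m where "m = w x"
  have m: "m > 0" using x r'(2) w(2) by (auto simp: m_def)
  define V where "V = measure lborel (ball a r)"
  have V: "V > 0" using r content_ball_pos[of r a] by (simp add: V_def)
  have ballV: "emeasure lborel (ball z r) = ennreal V" for z :: "complex ^ 'n"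
  proof -
    have "measure lborel (ball z r) = V"
      unfolding V_def using r by (simp add: content_ball)
    then show ?thesis
      using emeasure_lborel_ball_finite[of z r] emeasure_eq_ennreal_measure[of lborel "ball z r"] by auto
  qed
  have "(norm (f z))\<^sup>2 \<le> 1 / (m * V) * (LINT x|?M. (norm (f x))\<^sup>2)"
    if f: "f \<in> bergman_space \<Omega> ?M" and z: "z \<in> cball a r" for f z
  proof -
    have sub: "ball z r \<subseteq> cball a r'"
    proof
      fix y assume "y \<in> ball z r"
      then show "y \<in> cball a r'" using z dist_triangle[of a y z] by (simp add: r_def)
    qed
    have hol: "holomorphic_fun \<Omega> f" and int: "integrable ?M (\<lambda>z. (norm (f z))\<^sup>2)"
      using f unfolding bergman_space_def by auto
    have [measurable]: "f \<in> borel_measurable (restrict_space lborel \<Omega>)" "w \<in> borel_measurable (restrict_space lborel \<Omega>)"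
      using measurable_restrict_continuous holomorphic_fun_continuous_on[OF hol] w(1) by blast+
    have "ennreal (m * ((norm (f z))\<^sup>2 * V)) = ennreal m * (ennreal ((norm (f z))\<^sup>2) * emeasure lborel (ball z r))"
      using m V by (simp add: ballV ennreal_mult)
    also have "\<dots> \<le> ennreal m * (\<integral>\<^sup>+ x. ennreal ((norm (f x))\<^sup>2) * indicator (ball z r) x \<partial>lborel)"
      using sub r' by (intro mult_left_mono mean_value_ball holomorphic_fun_subset[OF hol]) auto
    also have "(\<integral>\<^sup>+ x. ennreal ((norm (f x))\<^sup>2) * indicator (ball z r) x \<partial>lborel)
        = (\<integral>\<^sup>+ x. ennreal ((norm (f x))\<^sup>2) * indicator (ball z r) x \<partial>restrict_space lborel \<Omega>)"
      using \<Omega> by (subst nn_integral_restrict_space) (use sub r' in \<open>auto intro!: nn_integral_cong simp: indicator_def subset_iff\<close>)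
    also have "ennreal m * \<dots> = (\<integral>\<^sup>+ x. ennreal m * (ennreal ((norm (f x))\<^sup>2) * indicator (ball z r) x) \<partial>restrict_space lborel \<Omega>)"
    proof (rule nn_integral_cmult[symmetric])
      have "ball z r \<inter> \<Omega> \<in> sets (restrict_space lborel \<Omega>)" by (auto simp: sets_restrict_space)
      then have "(\<lambda>x. indicator (ball z r) x :: ennreal) \<in> borel_measurable (restrict_space lborel \<Omega>)"
        by (subst borel_measurable_indicator_iff) (simp add: space_restrict_space)
      then show "(\<lambda>x. ennreal ((norm (f x))\<^sup>2) * indicator (ball z r) x) \<in> borel_measurable (restrict_space lborel \<Omega>)"
        by measurable
    qed
    also have "\<dots> \<le> (\<integral>\<^sup>+ x. ennreal (w x) * ennreal ((norm (f x))\<^sup>2) \<partial>restrict_space lborel \<Omega>)"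
    proof (rule nn_integral_mono)
      fix x
      show "ennreal m * (ennreal ((norm (f x))\<^sup>2) * indicator (ball z r) x) \<le> ennreal (w x) * ennreal ((norm (f x))\<^sup>2)"
      proof (cases "x \<in> ball z r")
        case True
        then have "m \<le> w x" using x(2)[of x] sub by (auto simp: m_def)
        then show ?thesis using True by (auto intro!: mult_right_mono ennreal_leI)
      qed simp
    qed
    also have "\<dots> = (\<integral>\<^sup>+ x. ennreal ((norm (f x))\<^sup>2) \<partial>?M)"
      by (subst nn_integral_density) measurable
    also have "\<dots> = ennreal (LINT x|?M. (norm (f x))\<^sup>2)"
      using int by (rule nn_integral_eq_integral) auto
    finally have "m * ((norm (f z))\<^sup>2 * V) \<le> (LINT x|?M. (norm (f x))\<^sup>2)"
      by (simp add: ennreal_le_iff integral_nonneg_AE)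
    then show ?thesis using m V by (simp add: field_simps)
  qed
  moreover have "cball a r \<subseteq> \<Omega>" using r' by (auto simp: r_def subset_iff)
  ultimately show "\<exists>r>0. \<exists>C. cball a r \<subseteq> \<Omega> \<and> (\<forall>f z. f \<in> bergman_space \<Omega> ?M \<longrightarrow> z \<in> cball a r \<longrightarrow>
      (norm (f z))\<^sup>2 \<le> C * (LINT x|?M. (norm (f x))\<^sup>2))"
    using r by blast
qed

section \<open>The Bergman kernel of a circular domain\<close>

context bergman_measure
begin

lemma indicator_mem:
  assumes "emeasure M \<Omega> < \<infinity>" shows "(\<lambda>z. if z \<in> \<Omega> then 1 else 0) \<in> A2"
proof (rule A2I)
  show "holomorphic_fun \<Omega> (\<lambda>z. if z \<in> \<Omega> then 1 else 0)"
    by (rule holomorphic_fun_cong[OF holomorphic_fun_const[of _ 1] open_\<Omega>]) simp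
  have "(\<integral>\<^sup>+ z. ennreal ((norm (if z \<in> \<Omega> then 1 else 0 :: complex))\<^sup>2) \<partial>M) \<le> (\<integral>\<^sup>+ z. 1 \<partial>M)"
    by (rule nn_integral_mono) auto
  also have "\<dots> < \<infinity>" using assms by (simp add: space_M)
  finally show "(\<integral>\<^sup>+ z. ennreal ((norm (if z \<in> \<Omega> then 1 else 0 :: complex))\<^sup>2) \<partial>M) < \<infinity>" .
qed simp

text \<open>
  The reproducing kernel at the origin is invariant under rotations by uniqueness, therefore
  constant, and the constant is 1 because the total mass is 1.
\<close>

lemma circular_mean_value:
  assumes mass: "emeasure M \<Omega> = 1" and conn: "connected \<Omega>" and zero: "0 \<in> \<Omega>"
    and circ: "\<And>z c. z \<in> \<Omega> \<Longrightarrow> norm c = 1 \<Longrightarrow> c *s z \<in> \<Omega>"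
    and rot: "\<And>c. norm c = 1 \<Longrightarrow> distr M M (\<lambda>z. c *s z) = M"
    and f: "f \<in> A2"
  shows "f 0 = L2_inner M f (\<lambda>z. if z \<in> \<Omega> then 1 else 0)"
proof -
  let ?one = "\<lambda>z. if z \<in> \<Omega> then 1 else 0 :: complex"
  have one: "?one \<in> A2" by (rule indicator_mem) (simp add: mass)
  obtain k where k: "k \<in> A2" and rep: "\<And>f. f \<in> A2 \<Longrightarrow> f 0 = L2_inner M f k"
    and unique: "\<And>k'. k' \<in> A2 \<Longrightarrow> (\<And>f. f \<in> A2 \<Longrightarrow> f 0 = L2_inner M f k') \<Longrightarrow> k' = k"
    using reproducing_kernel_exists[OF zero] by metis
  have meas_rot: "(\<lambda>z. c *s z) \<in> measurable M M" if "norm c = 1" for c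
  proof -
    have "(\<lambda>z. c *s z) \<in> measurable (restrict_space lborel \<Omega>) (restrict_space lborel \<Omega>)"
    proof (rule measurable_restrict_space2)
      have "(\<lambda>z. c *s z) \<in> borel_measurable (restrict_space lborel \<Omega>)"
        by (intro measurable_restrict_continuous continuous_on_smult_vec continuous_on_const continuous_on_id)
      then show "(\<lambda>z. c *s z) \<in> measurable (restrict_space lborel \<Omega>) lborel" by simp
    qed (use circ that in \<open>auto simp: space_restrict_space\<close>)
    then show ?thesis by (simp add: measurable_cong_sets[OF sets_M sets_M])
  qed
  have rot_mem: "(\<lambda>z. f (c *s z)) \<in> A2" if f: "f \<in> A2" and c: "norm c = 1" for f c
  proof (rule A2I)
    have c0: "c \<noteq> 0" using c by auto
    have "holomorphic_map \<Omega> (\<lambda>z. c *s z)" using holomorphic_map_affine[of \<Omega> 0 c] by simp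
    then show "holomorphic_fun \<Omega> (\<lambda>z. f (c *s z))"
      using circ c by (intro holomorphic_fun_compose[OF A2D(1)[OF f]]) auto
    show "f (c *s z) = 0" if z: "z \<notin> \<Omega>" for z
    proof (rule A2D(2)[OF f])
      show "c *s z \<notin> \<Omega>"
      proof
        assume cz: "c *s z \<in> \<Omega>"
        have "norm (inverse c) = 1" using c by (simp add: norm_inverse)
        then have "inverse c *s (c *s z) \<in> \<Omega>" by (rule circ[OF cz])
        then show False using z c0 by (simp add: vector_smult_assoc)
      qed
    qed
    note [measurable] = A2D(4)[OF f] meas_rot[OF c]
    have "(\<integral>\<^sup>+ z. ennreal ((norm (f (c *s z)))\<^sup>2) \<partial>M) = (\<integral>\<^sup>+ z. ennreal ((norm (f z))\<^sup>2) \<partial>distr M M (\<lambda>z. c *s z))"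
      by (subst nn_integral_distr) simp_all
    also have "\<dots> < \<infinity>" unfolding rot[OF c] A2_nn_norm[OF f] by simp
    finally show "(\<integral>\<^sup>+ z. ennreal ((norm (f (c *s z)))\<^sup>2) \<partial>M) < \<infinity>" .
  qed
  have krot: "(\<lambda>z. k (c *s z)) = k" if c: "norm c = 1" for c
  proof (rule unique[OF rot_mem[OF k c]])
    fix f assume f: "f \<in> A2"
    have c0: "c \<noteq> 0" using c by auto
    have ci: "norm (inverse c) = 1" using c by (simp add: norm_inverse)
    note meas = rot_mem[OF f ci] k
    have "L2_inner M f (\<lambda>z. k (c *s z)) = (LINT z|M. f (inverse c *s (c *s z)) * cnj (k (c *s z)))"
      unfolding L2_inner_def using c0 by (simp add: vector_smult_assoc)
    also have "\<dots> = (LINT z|distr M M (\<lambda>z. c *s z). f (inverse c *s z) * cnj (k z))"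
      using A2_inner_integrable[OF meas] by (intro integral_distr[symmetric] meas_rot[OF c]) simp
    also have "\<dots> = L2_inner M (\<lambda>z. f (inverse c *s z)) k"
      unfolding rot[OF c] L2_inner_def ..
    also have "\<dots> = f (inverse c *s 0)" using rep[OF rot_mem[OF f ci]] by simp
    finally show "f 0 = L2_inner M f (\<lambda>z. k (c *s z))" by simp
  qed
  have const: "k z = k 0" if z: "z \<in> \<Omega>" for z
    by (rule rotation_invariant_holomorphic_constant[OF A2D(1)[OF k] open_\<Omega> conn zero _ z])
       (use krot in \<open>simp add: fun_eq_iff\<close>)
  have keq: "k = (\<lambda>z. k 0 * ?one z)"
    using const A2D(2)[OF k] by (auto simp: fun_eq_iff)
  have "L2_inner M ?one ?one = 1"
  proof -
    have "L2_inner M ?one ?one = (LINT z|M. 1)"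
      unfolding L2_inner_def by (intro Bochner_Integration.integral_cong) (auto simp: space_M)
    then show ?thesis using mass by (simp add: measure_def space_M)
  qed
  moreover have "?one 0 = cnj (k 0) * L2_inner M ?one ?one"
    using rep[OF one] ip_scale_right[OF one one, of "k 0"] keq by metis
  ultimately have "cnj (k 0) = 1" using zero by simp
  then have k0: "k 0 = 1" by (metis complex_cnj_cnj complex_cnj_one)
  have "k = ?one"
    by (rule trans[OF keq]) (simp add: k0)
  then show ?thesis using rep[OF f] by simp
qed

end

locale circular_domain =
  fixes \<Omega> :: "(complex ^ 'n) set"
  assumes open_\<Omega>: "open \<Omega>" and connected_\<Omega>: "connected \<Omega>" and bounded_\<Omega>: "bounded \<Omega>"
    and zero_mem_\<Omega>: "0 \<in> \<Omega>" and circular: "z \<in> \<Omega> \<Longrightarrow> norm c = 1 \<Longrightarrow> c *s z \<in> \<Omega>"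
begin

abbreviation "V \<equiv> normalized_volume \<Omega>"
abbreviation "R \<equiv> restrict_space lborel \<Omega>"
abbreviation "K \<equiv> bergman_kernel \<Omega>"
abbreviation "d \<equiv> bergman_diag \<Omega>"
abbreviation "one \<equiv> \<lambda>z. if z \<in> \<Omega> then 1 else 0 :: complex"

definition vol :: real where "vol = measure lborel \<Omega>"

lemma emeasure_\<Omega>: "emeasure lborel \<Omega> = ennreal vol"
  using emeasure_bounded_finite[OF bounded_\<Omega>] emeasure_eq_ennreal_measure[of lborel \<Omega>] by (auto simp: vol_def)

lemma vol_pos: "vol > 0"
proof -
  obtain r where r: "r > 0" "ball 0 r \<subseteq> \<Omega>" using open_\<Omega> zero_mem_\<Omega> open_contains_ball by blast
  have "0 < measure lborel (ball (0 :: complex ^ 'n) r)" by (rule content_ball_pos[OF r(1)])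
  then have "0 < emeasure lborel (ball (0 :: complex ^ 'n) r)"
    using measure_def[of lborel "ball (0 :: complex ^ 'n) r"] by (auto intro: gr_zeroI)
  also have "\<dots> \<le> ennreal vol" unfolding emeasure_\<Omega>[symmetric] using r open_\<Omega> by (intro emeasure_mono) auto
  finally show ?thesis by simp
qed

lemma V_density: "V = density R (\<lambda>_. ennreal (1 / vol))"
  unfolding normalized_volume_def uniform_measure_def
proof (rule density_cong)
  have "\<Omega> \<in> sets R" using open_\<Omega> by (auto simp: sets_restrict_space intro: image_eqI[of _ _ \<Omega>])
  then show "(\<lambda>x. indicator \<Omega> x / emeasure R \<Omega>) \<in> borel_measurable R" by measurable
  have "emeasure R \<Omega> = ennreal vol" using open_\<Omega> by (subst emeasure_restrict_space) (auto simp: emeasure_\<Omega>)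
  then show "AE x in R. indicator \<Omega> x / emeasure R \<Omega> = ennreal (1 / vol)"
    using vol_pos by (intro AE_I2) (simp add: space_restrict_space divide_ennreal flip: ennreal_1)
qed simp

lemma space_V: "space V = \<Omega>" and sets_V: "sets V = sets R"
  by (simp_all add: V_density space_restrict_space)

lemma mass_V: "emeasure V \<Omega> = 1"
proof -
  have "emeasure V \<Omega> = ennreal (1 / vol) * emeasure R \<Omega>"
    unfolding V_density using open_\<Omega> by (subst emeasure_density_const) (auto simp: sets_restrict_space)
  also have "emeasure R \<Omega> = ennreal vol" using open_\<Omega> by (subst emeasure_restrict_space) (auto simp: emeasure_\<Omega>)
  finally show ?thesis using vol_pos by (simp add: ennreal_mult[symmetric])
qed

lemma measurable_V: "continuous_on \<Omega> f \<Longrightarrow> f \<in> borel_measurable V"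
  using measurable_restrict_continuous by (simp add: measurable_cong_sets[OF sets_V refl])

lemma nn_integral_V: "F \<in> borel_measurable V \<Longrightarrow> (\<integral>\<^sup>+ z. F z \<partial>V) = ennreal (1 / vol) * (\<integral>\<^sup>+ z. F z \<partial>R)"
  unfolding V_density by (subst nn_integral_density) (auto simp: nn_integral_cmult)

sublocale A: bergman_measure \<Omega> V
  unfolding V_density using vol_pos by (intro bergman_measure_density open_\<Omega> continuous_intros) auto

lemma automorphism_measurable_V:
  assumes "automorphism \<Omega> g h"
  shows "g \<in> measurable V V" "(\<lambda>z. cjac g z) \<in> borel_measurable V"
  using automorphism_measurable[OF open_\<Omega> assms]
  unfolding measurable_cong_sets[OF sets_V sets_V] measurable_cong_sets[OF sets_V refl, of borel] by simp_all

lemma automorphism_distr_V: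
  assumes g: "automorphism \<Omega> g h"
  shows "distr (density V (\<lambda>z. ennreal ((cmod (cjac g z))\<^sup>2))) V g = V"
proof (rule measure_eqI)
  note [measurable] = automorphism_measurable_V[OF g]
  note [measurable] = automorphism_measurable[OF open_\<Omega> g]
  fix A assume "A \<in> sets (distr (density V (\<lambda>z. ennreal ((cmod (cjac g z))\<^sup>2))) V g)"
  then have A [measurable]: "A \<in> sets V" by simp
  have A' [measurable]: "A \<in> sets R" using A by (simp add: sets_V)
  have "emeasure (distr (density V (\<lambda>z. ennreal ((cmod (cjac g z))\<^sup>2))) V g) A
      = (\<integral>\<^sup>+ z. ennreal ((cmod (cjac g z))\<^sup>2) * indicator A (g z) \<partial>V)"
  proof -
    have "g -` A \<inter> space V \<in> sets V" by measurable
    then have "emeasure (distr (density V (\<lambda>z. ennreal ((cmod (cjac g z))\<^sup>2))) V g) A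
        = (\<integral>\<^sup>+ z. ennreal ((cmod (cjac g z))\<^sup>2) * indicator (g -` A \<inter> space V) z \<partial>V)"
      by (simp add: emeasure_distr emeasure_density)
    also have "\<dots> = (\<integral>\<^sup>+ z. ennreal ((cmod (cjac g z))\<^sup>2) * indicator A (g z) \<partial>V)"
      by (intro nn_integral_cong) (auto simp: indicator_def)
    finally show ?thesis .
  qed
  also have "\<dots> = ennreal (1 / vol) * (\<integral>\<^sup>+ z. ennreal ((cmod (cjac g z))\<^sup>2) * indicator A (g z) \<partial>R)"
    by (rule nn_integral_V) measurable
  also have "(\<integral>\<^sup>+ z. ennreal ((cmod (cjac g z))\<^sup>2) * indicator A (g z) \<partial>R) = (\<integral>\<^sup>+ z. indicator A z \<partial>R)"
    by (rule automorphism_nn_integral[OF open_\<Omega> bounded_\<Omega> g]) measurable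
  also have "ennreal (1 / vol) * (\<integral>\<^sup>+ z. indicator A z \<partial>R) = emeasure V A"
    using nn_integral_V[of "indicator A"] by simp
  finally show "emeasure (distr (density V (\<lambda>z. ennreal ((cmod (cjac g z))\<^sup>2))) V g) A = emeasure V A" .
qed simp

lemma automorphism_nn_integral_V:
  assumes g: "automorphism \<Omega> g h" and F [measurable]: "F \<in> borel_measurable V"
  shows "(\<integral>\<^sup>+ z. ennreal ((cmod (cjac g z))\<^sup>2) * F (g z) \<partial>V) = (\<integral>\<^sup>+ z. F z \<partial>V)"
proof -
  note [measurable] = automorphism_measurable_V[OF g]
  have "(\<integral>\<^sup>+ z. F z \<partial>V) = (\<integral>\<^sup>+ z. F z \<partial>distr (density V (\<lambda>z. ennreal ((cmod (cjac g z))\<^sup>2))) V g)"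
    by (simp only: automorphism_distr_V[OF g])
  also have "\<dots> = (\<integral>\<^sup>+ z. F (g z) \<partial>density V (\<lambda>z. ennreal ((cmod (cjac g z))\<^sup>2)))"
    by (rule nn_integral_distr) simp_all
  also have "\<dots> = (\<integral>\<^sup>+ z. ennreal ((cmod (cjac g z))\<^sup>2) * F (g z) \<partial>V)"
    by (rule nn_integral_density) simp_all
  finally show ?thesis by simp
qed

lemma automorphism_integral_V:
  fixes F :: "complex ^ 'n \<Rightarrow> complex"
  assumes g: "automorphism \<Omega> g h" and F [measurable]: "F \<in> borel_measurable V"
  shows "(LINT z|V. (cmod (cjac g z))\<^sup>2 *\<^sub>R F (g z)) = (LINT z|V. F z)"
proof -
  note [measurable] = automorphism_measurable_V[OF g]
  have "(LINT z|V. F z) = (LINT z|distr (density V (\<lambda>z. ennreal ((cmod (cjac g z))\<^sup>2))) V g. F z)"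
    by (simp only: automorphism_distr_V[OF g])
  also have "\<dots> = (LINT z|density V (\<lambda>z. ennreal ((cmod (cjac g z))\<^sup>2)). F (g z))"
    by (rule integral_distr) simp_all
  also have "\<dots> = (LINT z|V. (cmod (cjac g z))\<^sup>2 *\<^sub>R F (g z))"
    by (rule integral_density) simp_all
  finally show ?thesis by simp
qed

lemma kernel:
  assumes "w \<in> \<Omega>"
  shows "(\<lambda>z. K z w) \<in> A.A2" "f \<in> A.A2 \<Longrightarrow> f w = L2_inner V f (\<lambda>z. K z w)"
  using theI'[OF A.reproducing_kernel_exists[OF assms]] unfolding bergman_kernel_def by auto

lemma kernel_unique:
  assumes "w \<in> \<Omega>" "k \<in> A.A2" "\<And>f. f \<in> A.A2 \<Longrightarrow> f w = L2_inner V f k"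
  shows "k = (\<lambda>z. K z w)"
  using A.reproducing_kernel_exists[OF assms(1)] kernel[OF assms(1)] assms(2,3) by blast

lemma kernel_commute: "z \<in> \<Omega> \<Longrightarrow> w \<in> \<Omega> \<Longrightarrow> K z w = cnj (K w z)"
  using kernel(2)[OF _ kernel(1), of z w] kernel(2)[OF _ kernel(1), of w z] A.ip_commute[OF kernel(1) kernel(1), of w z]
  by simp

lemma kernel_diag: "z \<in> \<Omega> \<Longrightarrow> K z z = of_real (d z)"
  using kernel_commute[of z z] by (simp add: bergman_diag_def complex_eq_iff)

lemma diag_norm: "z \<in> \<Omega> \<Longrightarrow> d z = (A.A2_norm (\<lambda>x. K x z))\<^sup>2"
  using kernel(2)[OF _ kernel(1), of z z] A.ip_norm_sq[OF kernel(1), of z] by (simp add: bergman_diag_def)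

lemma evaluation_le:
  assumes "f \<in> A.A2" "z \<in> \<Omega>" shows "(norm (f z))\<^sup>2 \<le> (A.A2_norm f)\<^sup>2 * d z"
proof -
  have "norm (f z) \<le> A.A2_norm f * A.A2_norm (\<lambda>x. K x z)"
    using A.Cauchy_Schwarz[OF assms(1) kernel(1)[OF assms(2)]] kernel(2)[OF assms(2,1)] by simp
  then have "(norm (f z))\<^sup>2 \<le> (A.A2_norm f * A.A2_norm (\<lambda>x. K x z))\<^sup>2" by (intro power_mono) auto
  then show ?thesis using diag_norm[OF assms(2)] by (simp add: power_mult_distrib)
qed

lemma one_mem: "one \<in> A.A2"
  by (rule A.indicator_mem) (simp add: mass_V)

lemma one_norm: "A.A2_norm one = 1"
proof -
  have "(A.A2_norm one)\<^sup>2 = (LINT z|V. 1)"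
    unfolding A.A2_norm_sq by (intro Bochner_Integration.integral_cong) (auto simp: space_V)
  then have "(A.A2_norm one)\<^sup>2 = 1\<^sup>2" using mass_V by (simp add: measure_def space_V)
  then show ?thesis using A.A2_norm_nonneg[of one] by (rule power2_eq_imp_eq) simp
qed

lemma diag_ge_1: "z \<in> \<Omega> \<Longrightarrow> 1 \<le> d z"
  using evaluation_le[OF one_mem, of z] by (simp add: one_norm)

lemma kernel_le: "z \<in> \<Omega> \<Longrightarrow> w \<in> \<Omega> \<Longrightarrow> (norm (K z w))\<^sup>2 \<le> d z * d w"
  using evaluation_le[OF kernel(1), of w z] by (simp add: diag_norm[of w] mult.commute)

text \<open>
  The bound on point evaluations, applied to the kernel function at \<open>z\<close> itself,
  reads \<open>d z \<le> C * sqrt (d z)\<close>.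
\<close>

lemma diag_locally_bounded:
  assumes "a \<in> \<Omega>" obtains r C where "r > 0" "cball a r \<subseteq> \<Omega>" "\<And>z. z \<in> cball a r \<Longrightarrow> d z \<le> C"
proof -
  obtain r C where rC: "r > 0" "cball a r \<subseteq> \<Omega>" "C > 0"
    "\<And>f z. f \<in> A.A2 \<Longrightarrow> z \<in> cball a r \<Longrightarrow> norm (f z) \<le> C * A.A2_norm f"
    using A.evaluation_bound[OF assms] by metis
  have "d z \<le> C\<^sup>2" if z: "z \<in> cball a r" for z
  proof -
    have z\<Omega>: "z \<in> \<Omega>" using z rC by blast
    let ?n = "A.A2_norm (\<lambda>x. K x z)"
    have "?n\<^sup>2 \<le> C * ?n"
      using rC(4)[OF kernel(1)[OF z\<Omega>] z] diag_ge_1[OF z\<Omega>] diag_norm[OF z\<Omega>] by (simp add: kernel_diag[OF z\<Omega>] norm_power)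
    then have "?n \<le> C"
      using A.A2_norm_nonneg[of "\<lambda>x. K x z"] rC(3) by (cases "?n = 0") (auto simp: power2_eq_square mult_le_cancel_right)
    then show ?thesis using A.A2_norm_nonneg[of "\<lambda>x. K x z"] unfolding diag_norm[OF z\<Omega>] by (intro power_mono)
  qed
  then show thesis using that rC by blast
qed

lemma kernel_holomorphic: "w \<in> \<Omega> \<Longrightarrow> holomorphic_fun \<Omega> (\<lambda>z. K z w)"
  using kernel(1) A.A2D(1) by blast

text \<open>
  The kernel is holomorphic in the first variable and locally bounded, which gives a Lipschitz
  bound that is locally uniform in the second variable; continuity in the second variable
  alone comes from the Hermitian symmetry.
\<close>

lemma kernel_continuous: "continuous_on (\<Omega> \<times> \<Omega>) (\<lambda>p. K (fst p) (snd p))"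
  unfolding continuous_on_eq_continuous_within continuous_within
proof
  fix p assume "p \<in> \<Omega> \<times> \<Omega>"
  then obtain a b where p: "p = (a, b)" "a \<in> \<Omega>" "b \<in> \<Omega>" by auto
  obtain r C where r: "r > 0" "cball a r \<subseteq> \<Omega>" "\<And>z. z \<in> cball a r \<Longrightarrow> d z \<le> C"
    using diag_locally_bounded[OF p(2)] by blast
  obtain s D where s: "s > 0" "cball b s \<subseteq> \<Omega>" "\<And>z. z \<in> cball b s \<Longrightarrow> d z \<le> D"
    using diag_locally_bounded[OF p(3)] by blast
  define B where "B = sqrt (C * D)"
  have KB: "norm (K z w) \<le> B" if "z \<in> cball a r" "w \<in> cball b s" for z w
  proof -
    have z: "z \<in> \<Omega>" and w: "w \<in> \<Omega>" using that r s by auto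
    have "(norm (K z w))\<^sup>2 \<le> d z * d w" by (rule kernel_le[OF z w])
    also have "\<dots> \<le> C * D"
      using r(3)[OF that(1)] s(3)[OF that(2)] diag_ge_1[OF z] diag_ge_1[OF w] by (intro mult_mono) auto
    finally show ?thesis unfolding B_def by (rule real_le_rsqrt)
  qed
  have lip: "norm (K z w - K a w) \<le> 5 * B / r * norm (z - a)" if z: "norm (z - a) \<le> r / 2" and w: "w \<in> cball b s" for z w
  proof -
    have hol: "holomorphic_fun \<Omega> (\<lambda>z. K z w)" using w s by (intro kernel_holomorphic) auto
    have "norm (K (a + (z - a)) w - K a w) \<le> 5 * B / r * norm (z - a)"
      using KB w by (intro holomorphic_local_lipschitz[OF hol r(2,1) _ z]) auto
    then show ?thesis by simp
  qed
  have "((\<lambda>p. K (fst p) (snd p) - K a b) \<longlongrightarrow> 0) (at (a, b) within \<Omega> \<times> \<Omega>)"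
  proof (rule Lim_null_comparison)
    have "\<forall>\<^sub>F p in at (a, b) within \<Omega> \<times> \<Omega>. p \<in> ball a (r / 2) \<times> ball b s"
      using r s by (intro eventually_at_in_open' [THEN filter_leD[OF at_le, rotated]]) (auto intro: open_Times)
    moreover have "\<forall>\<^sub>F p in at (a, b) within \<Omega> \<times> \<Omega>. p \<in> \<Omega> \<times> \<Omega>"
      by (simp add: eventually_at_filter)
    ultimately show "\<forall>\<^sub>F p in at (a, b) within \<Omega> \<times> \<Omega>. norm (K (fst p) (snd p) - K a b)
        \<le> 5 * B / r * norm (fst p - a) + norm (K (snd p) a - K b a)"
    proof eventually_elim
      case (elim p)
      have "norm (K (fst p) (snd p) - K a (snd p)) \<le> 5 * B / r * norm (fst p - a)"
        using elim by (intro lip) (auto simp: dist_norm norm_minus_commute)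
      moreover have "norm (K a (snd p) - K a b) = norm (K (snd p) a - K b a)"
        using elim p kernel_commute[of a "snd p"] kernel_commute[of a b] by (auto simp flip: complex_cnj_diff)
      ultimately show ?case
        using norm_triangle_ineq[of "K (fst p) (snd p) - K a (snd p)" "K a (snd p) - K a b"] by simp
    qed
    have "((\<lambda>z. K z a) \<longlongrightarrow> K b a) (at b)"
      using has_derivative_continuous[OF holomorphic_fun_cderiv(1)[OF kernel_holomorphic[OF p(2)] p(3)]]
      unfolding isCont_def .
    then have "((\<lambda>p. K (snd p) a) \<longlongrightarrow> K b a) (at (a, b) within \<Omega> \<times> \<Omega>)"
      using isCont_tendsto_compose[of "snd (a, b)" "\<lambda>z. K z a" snd "at (a, b) within \<Omega> \<times> \<Omega>"]
        tendsto_snd[OF tendsto_ident_at, of "(a, b)" "\<Omega> \<times> \<Omega>"] unfolding isCont_def by simp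
    then have "((\<lambda>p. 5 * B / r * norm (fst p - a) + norm (K (snd p) a - K b a)) \<longlongrightarrow> 5 * B / r * norm (fst (a, b) - a) + norm (K b a - K b a)) (at (a, b) within \<Omega> \<times> \<Omega>)"
      by (intro tendsto_intros)
    then show "((\<lambda>p. 5 * B / r * norm (fst p - a) + norm (K (snd p) a - K b a)) \<longlongrightarrow> 0) (at (a, b) within \<Omega> \<times> \<Omega>)"
      by simp
  qed
  then show "((\<lambda>p. K (fst p) (snd p)) \<longlongrightarrow> K (fst p) (snd p)) (at p within \<Omega> \<times> \<Omega>)"
    unfolding p(1) using Lim_null by fastforce
qed

lemma diag_continuous: "continuous_on \<Omega> d"
proof -
  have "continuous_on \<Omega> (\<lambda>z. K (fst (z, z)) (snd (z, z)))"
    by (rule continuous_on_compose2[OF kernel_continuous]) (auto intro!: continuous_intros)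
  then show ?thesis unfolding bergman_diag_def[abs_def] by (auto intro!: continuous_intros)
qed

text \<open>
  The map \<open>f \<mapsto> (f \<circ> g) J\<^sub>g\<close>, with \<open>J\<^sub>g\<close>
  the complex Jacobian, is unitary on the Bergman space. The left hand side is the pull-back
  of a reproducing kernel, hence itself reproducing, and the kernel is unique.
\<close>

lemma kernel_transformation:
  assumes g: "automorphism \<Omega> g h" and z: "z \<in> \<Omega>" and w: "w \<in> \<Omega>"
  shows "K (g z) (g w) * cjac g z * cnj (cjac g w) = K z w"
proof -
  note gD = automorphismD[OF g] and g' = automorphism_inverse[OF g]
  note hD = automorphismD[OF g']
  have gw: "g w \<in> \<Omega>" by (rule gD(3)[OF w])
  have pull: "(\<lambda>z. if z \<in> \<Omega> then f (g z) * cjac g z else 0) \<in> A.A2" if f: "f \<in> A.A2" and g: "automorphism \<Omega> g h" for f g h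
  proof (rule A.A2I)
    note [measurable] = A.A2D(4)[OF f] automorphism_measurable_V[OF g]
    note gD = automorphismD[OF g]
    show "holomorphic_fun \<Omega> (\<lambda>z. if z \<in> \<Omega> then f (g z) * cjac g z else 0)"
      by (rule holomorphic_fun_cong[OF holomorphic_fun_mult[OF holomorphic_fun_compose[OF A.A2D(1)[OF f] gD(1,7)] holomorphic_fun_cjac[OF gD(1) open_\<Omega>]] open_\<Omega>]) simp
    have "(\<integral>\<^sup>+ z. ennreal ((norm (if z \<in> \<Omega> then f (g z) * cjac g z else 0))\<^sup>2) \<partial>V)
       = (\<integral>\<^sup>+ z. ennreal ((cmod (cjac g z))\<^sup>2) * ennreal ((norm (f (g z)))\<^sup>2) \<partial>V)"
      by (intro nn_integral_cong) (simp add: space_V norm_mult power_mult_distrib ennreal_mult mult.commute)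
    also have "\<dots> = (\<integral>\<^sup>+ z. ennreal ((norm (f z))\<^sup>2) \<partial>V)"
      by (rule automorphism_nn_integral_V[OF g]) measurable
    also have "\<dots> < \<infinity>" unfolding A.A2_nn_norm[OF f] by simp
    finally show "(\<integral>\<^sup>+ z. ennreal ((norm (if z \<in> \<Omega> then f (g z) * cjac g z else 0))\<^sup>2) \<partial>V) < \<infinity>" .
  qed simp
  let ?u = "\<lambda>z. if z \<in> \<Omega> then K (g z) (g w) * cjac g z else 0"
  have u: "?u \<in> A.A2" by (rule pull[OF kernel(1)[OF gw] g])
  have "(\<lambda>z. cnj (cjac g w) * ?u z) = (\<lambda>z. K z w)"
  proof (rule kernel_unique[OF w A.A2_scale[OF u]])
    fix f assume f: "f \<in> A.A2"
    let ?f = "\<lambda>z. if z \<in> \<Omega> then f (h z) * cjac h z else 0"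
    have f1: "?f \<in> A.A2" by (rule pull[OF f g'])
    note [measurable] = A.A2D(4)[OF f1] A.A2D(4)[OF kernel(1)[OF gw]]
    have meas: "(\<lambda>z. ?f z * cnj (K z (g w))) \<in> borel_measurable V"
      using A.A2_inner_integrable[OF f1 kernel(1)[OF gw]] by (rule borel_measurable_integrable)
    have "L2_inner V f (\<lambda>z. cnj (cjac g w) * ?u z) = cjac g w * L2_inner V f ?u"
      using A.ip_scale_right[OF u f] by simp
    also have "L2_inner V f ?u = (LINT z|V. (cmod (cjac g z))\<^sup>2 *\<^sub>R (?f (g z) * cnj (K (g z) (g w))))"
      unfolding L2_inner_def
    proof (intro Bochner_Integration.integral_cong refl)
      fix z assume "z \<in> space V"
      then have z: "z \<in> \<Omega>" by (simp add: space_V)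
      have "(cmod (cjac g z))\<^sup>2 *\<^sub>R (?f (g z) * cnj (K (g z) (g w)))
          = cjac g z * cnj (cjac g z) * (f z * cjac h (g z) * cnj (K (g z) (g w)))"
        using z gD by (simp add: scaleR_conv_of_real complex_norm_square del: of_real_power)
      also have "\<dots> = (cjac h (g z) * cjac g z) * (f z * cnj (K (g z) (g w) * cjac g z))"
        by (simp add: mult_ac)
      finally show "f z * cnj (?u z) = (cmod (cjac g z))\<^sup>2 *\<^sub>R (?f (g z) * cnj (K (g z) (g w)))"
        using z by (simp add: cjac_inverse[OF g open_\<Omega> z])
    qed
    also have "\<dots> = L2_inner V ?f (\<lambda>z. K z (g w))"
      unfolding L2_inner_def by (rule automorphism_integral_V[OF g meas])
    also have "\<dots> = ?f (g w)" by (rule kernel(2)[OF gw f1, symmetric])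
    also have "cjac g w * ?f (g w) = f w"
      using w gD cjac_inverse[OF g open_\<Omega> w] by (simp add: mult_ac)
    finally show "f w = L2_inner V f (\<lambda>z. cnj (cjac g w) * ?u z)" by simp
  qed
  from fun_cong[OF this, of z] show ?thesis using z by (simp add: mult_ac)
qed

lemma rotation_automorphism_0:
  "norm c = 1 \<Longrightarrow> automorphism \<Omega> (\<lambda>w. c *s w) (\<lambda>w. inverse c *s w)"
  using rotation_automorphism[of c \<Omega> 0] circular by simp

lemma cjac_rotation: "cjac (\<lambda>w. c *s w) z = c ^ CARD('n)" for z :: "complex ^ 'n"
  using cjac_affine[of 0 c z] by simp

lemma diag_transformation:
  assumes g: "automorphism \<Omega> g h" and z: "z \<in> \<Omega>"
  shows "d (g z) * (cmod (cjac g z))\<^sup>2 = d z"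
proof -
  have "of_real (d (g z) * (cmod (cjac g z))\<^sup>2) = K (g z) (g z) * cjac g z * cnj (cjac g z)"
    using kernel_diag[OF automorphismD(3)[OF g z]] by (simp add: complex_norm_square mult.assoc del: of_real_power)
  also have "\<dots> = of_real (d z)" using kernel_transformation[OF g z z] kernel_diag[OF z] by simp
  finally show ?thesis using of_real_eq_iff by blast
qed

lemma diag_rotation: "z \<in> \<Omega> \<Longrightarrow> norm c = 1 \<Longrightarrow> d (c *s z) = d z"
  using diag_transformation[OF rotation_automorphism_0] by (simp add: cjac_rotation norm_power)

lemma rotation_distr_V:
  assumes "norm c = 1" shows "distr V V (\<lambda>z. c *s z) = V"
  using automorphism_distr_V[OF rotation_automorphism_0[OF assms]] assms
  by (simp add: cjac_rotation norm_power density_1)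

text \<open>
  The constant function 1 represents the evaluation at the origin by the mean value property.
\<close>

lemma kernel_0: "z \<in> \<Omega> \<Longrightarrow> K z 0 = 1" "z \<in> \<Omega> \<Longrightarrow> K 0 z = 1"
proof -
  have "one = (\<lambda>z. K z 0)"
    by (intro kernel_unique zero_mem_\<Omega> one_mem A.circular_mean_value mass_V connected_\<Omega> circular rotation_distr_V)
  then show 1: "K z 0 = 1" if "z \<in> \<Omega>" for z using that by (metis (full_types))
  show "K 0 z = 1" if "z \<in> \<Omega>" using kernel_commute[OF zero_mem_\<Omega> that] 1[OF that] by simp
qed

end

section \<open>Symmetries, the orbit of the origin and powers of the kernel\<close>

lemma norm_vec_le_sum: "norm x \<le> (\<Sum>i\<in>UNIV. norm (x $ i))" for x :: "complex ^ 'n"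
  unfolding norm_vec_def by (rule L2_set_le_sum) simp

text \<open>
  The components of the derivative are holomorphic in the base point, hence locally Lipschitz,
  uniformly for \<open>v\<close> in the unit ball.
\<close>

lemma cderiv_continuous_onorm:
  fixes F :: "complex ^ 'n \<Rightarrow> complex ^ 'n"
  assumes F: "holomorphic_map \<Omega> F" and \<Omega>: "open \<Omega>" and a: "a \<in> \<Omega>" and e: "e > 0"
  shows "\<exists>d>0. \<forall>x. dist a x < d \<longrightarrow> x \<in> \<Omega> \<and>
    (\<forall>v. norm ((\<chi> i. cderiv (\<lambda>z. F z $ i) x v) - (\<chi> i. cderiv (\<lambda>z. F z $ i) a v)) \<le> e * norm v)"
proof -
  obtain r' where r': "r' > 0" "cball a r' \<subseteq> \<Omega>" using \<Omega> a open_contains_cball by blast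
  define r where "r = r' / 2"
  have r: "r > 0" "cball a r \<subseteq> \<Omega>" using r' by (auto simp: r_def subset_iff)
  have Fi: "holomorphic_fun \<Omega> (\<lambda>z. F z $ i)" for i using F unfolding holomorphic_map_def by blast
  have "bounded (F ` cball a r')"
    using holomorphic_map_continuous_on[OF F] r'(2)
    by (intro compact_imp_bounded compact_continuous_image) (auto intro: continuous_on_subset)
  then obtain M where M: "\<And>w. w \<in> cball a r' \<Longrightarrow> norm (F w) \<le> M" unfolding bounded_iff by blast
  have M0: "M \<ge> 0" using M[of a] r' order_trans[OF norm_ge_zero] by auto
  have comp: "norm (cderiv (\<lambda>z. F z $ i) w v) \<le> M * norm v / r" if w: "w \<in> cball a r" for w v i
  proof -
    have sub: "cball w r \<subseteq> cball a r'"
    proof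
      fix x assume "x \<in> cball w r"
      then show "x \<in> cball a r'" using w dist_triangle[of a x w] by (simp add: r_def)
    qed
    show ?thesis
    proof (rule Cauchy_estimate_cderiv[OF Fi _ r(1)])
      show "cball w r \<subseteq> \<Omega>" using sub r'(2) by blast
      show "norm (F x $ i) \<le> M" if "x \<in> cball w r" for x
        using order_trans[OF Finite_Cartesian_Product.norm_nth_le M] sub that by blast
    qed
  qed
  define N where "N = real CARD('n)"
  have N: "N > 0" by (simp add: N_def)
  define d where "d = min (r / 2) (e * r / (N * 5 * (M / r + 1)))"
  have d: "d > 0" unfolding d_def using r e N M0
    by (simp add: add_nonneg_pos)
  have "norm ((\<chi> i. cderiv (\<lambda>z. F z $ i) x v) - (\<chi> i. cderiv (\<lambda>z. F z $ i) a v)) \<le> e * norm v"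
    if x: "dist a x < d" for x v
  proof -
    have xa: "norm (x - a) < d" using x by (simp add: dist_norm norm_minus_commute)
    have ci: "norm (cderiv (\<lambda>z. F z $ i) x v - cderiv (\<lambda>z. F z $ i) a v) \<le> e / N * norm v" for i
    proof -
      have "norm (cderiv (\<lambda>z. F z $ i) (a + (x - a)) v - cderiv (\<lambda>z. F z $ i) a v) \<le> 5 * (M * norm v / r) / r * norm (x - a)"
        using xa comp by (intro holomorphic_local_lipschitz[OF holomorphic_fun_cderiv_direction[OF Fi \<Omega>] r(2,1)]) (auto simp: d_def)
      also have "\<dots> = 5 * (M / r) / r * norm (x - a) * norm v" by simp
      also have "\<dots> \<le> 5 * (M / r + 1) / r * (e * r / (N * 5 * (M / r + 1))) * norm v"
        using xa M0 r by (intro mult_right_mono mult_mono divide_right_mono) (auto simp: d_def)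
      also have "\<dots> = e / N * norm v"
      proof -
        have *: "5 * k / r * (e * r / (N * 5 * k)) = e / N" if "k > 0" for k
          using that r N by (simp add: field_simps)
        have "M / r + 1 > 0" using M0 r by (simp add: add_nonneg_pos)
        then show ?thesis by (simp only: *)
      qed
      finally show ?thesis by simp
    qed
    have "norm ((\<chi> i. cderiv (\<lambda>z. F z $ i) x v) - (\<chi> i. cderiv (\<lambda>z. F z $ i) a v))
        \<le> (\<Sum>i\<in>UNIV. norm (cderiv (\<lambda>z. F z $ i) x v - cderiv (\<lambda>z. F z $ i) a v))"
      using norm_vec_le_sum[of "(\<chi> i. cderiv (\<lambda>z. F z $ i) x v) - (\<chi> i. cderiv (\<lambda>z. F z $ i) a v)"] by simp
    also have "\<dots> \<le> (\<Sum>i\<in>(UNIV :: 'n set). e / N * norm v)" by (intro sum_mono ci)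
    also have "\<dots> = e * norm v" using N by (simp add: N_def)
    finally show ?thesis .
  qed
  moreover have "x \<in> \<Omega>" if "dist a x < d" for x using that r by (auto simp: d_def)
  ultimately show ?thesis using d by blast
qed

text \<open>
  Let \<open>L\<close> be the derivative of \<open>s\<close> at \<open>a\<close>, an
  involution. The map \<open>h z = (z - a) + L (s z - a)\<close> has derivative 2 at
  \<open>a\<close>, so it is injective near \<open>a\<close> and covers a neighbourhood of 0,
  and it satisfies \<open>h (s z) = L (h z)\<close>. If \<open>L\<close> fixed a vector
  \<open>w \<noteq> 0\<close>, the preimage of a small multiple of \<open>w\<close> would be a
  fixed point of \<open>s\<close> near \<open>a\<close>, against the isolation of
  \<open>a\<close>.
\<close>

lemma symmetry_derivative:
  fixes s :: "complex ^ 'n \<Rightarrow> complex ^ 'n"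
  assumes s: "symmetry_at \<Omega> a s" and \<Omega>: "open \<Omega>" and a: "a \<in> \<Omega>"
  shows "(\<chi> i. cderiv (\<lambda>z. s z $ i) a v) = - v"
proof (rule ccontr)
  assume neq: "(\<chi> i. cderiv (\<lambda>z. s z $ i) a v) \<noteq> - v"
  define L where "L = (\<lambda>x v. \<chi> i. cderiv (\<lambda>z. s z $ i) x v)"
  have hol: "holomorphic_map \<Omega> s" and self: "\<And>z. z \<in> \<Omega> \<Longrightarrow> s z \<in> \<Omega>" and inv: "\<And>z. z \<in> \<Omega> \<Longrightarrow> s (s z) = z"
    and sa: "s a = a" using s unfolding symmetry_at_def by auto
  obtain U where U: "open U" "a \<in> U" "\<And>z. z \<in> U \<Longrightarrow> z \<in> \<Omega> \<Longrightarrow> s z = z \<Longrightarrow> z = a"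
    using s unfolding symmetry_at_def by blast
  have der: "(s has_derivative L x) (at x)" if "x \<in> \<Omega>" for x
    unfolding L_def by (rule holomorphic_map_has_derivative[OF hol that])
  have blL: "bounded_linear (L a)" using der[OF a] by (rule has_derivative_bounded_linear)
  then have linL: "linear (L a)" by (simp add: bounded_linear.linear)
  have LL: "L a (L a w) = w" for w
  proof -
    have "((\<lambda>z. s (s z)) has_derivative (\<lambda>v. L a (L a v))) (at a)"
      using has_derivative_compose[OF der[OF a], of s "L a"] der[OF a] sa by simp
    moreover have "((\<lambda>z. s (s z)) has_derivative (\<lambda>v. v)) (at a)"
      by (rule has_derivative_transform_within_open[OF has_derivative_ident \<Omega> a]) (simp add: inv)
    ultimately have "(\<lambda>v. L a (L a v)) = (\<lambda>v. v)" by (rule has_derivative_unique)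
    then show ?thesis by metis
  qed
  define w where "w = v + L a v"
  have w: "w \<noteq> 0" "L a w = w"
  proof -
    show "w \<noteq> 0" using neq unfolding w_def L_def by (metis add.commute add_eq_0_iff)
    show "L a w = w" by (simp add: w_def linear_add[OF linL] LL add.commute)
  qed
  define h where "h = (\<lambda>z. (z - a) + L a (s z - a))"
  define h' where "h' = (\<lambda>x v. v + L a (L x v))"
  have hder: "(h has_derivative h' x) (at x)" if x: "x \<in> \<Omega>" for x
  proof -
    have "((\<lambda>z. s z - a) has_derivative L x) (at x)"
      using has_derivative_diff[OF der[OF x] has_derivative_const[of a]] by simp
    then have "((\<lambda>z. L a (s z - a)) has_derivative (\<lambda>v. L a (L x v))) (at x)"
      by (rule bounded_linear.has_derivative[OF blL])
    then show ?thesis unfolding h_def h'_def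
      using has_derivative_add[OF has_derivative_diff[OF has_derivative_ident has_derivative_const[of a]]] by fastforce
  qed
  have h'a: "h' a v = 2 *\<^sub>R v" for v by (simp add: h'_def LL scaleR_2)
  have ginv: "bounded_linear (\<lambda>v :: complex ^ 'n. (1/2) *\<^sub>R v)" "(\<lambda>v. (1/2) *\<^sub>R v) \<circ> h' a = id" "h' a \<circ> (\<lambda>v. (1/2) *\<^sub>R v) = id"
    by (auto simp: fun_eq_iff h'a bounded_linear_scaleR_right)
  have intertwine: "h (s z) = L a (h z)" if "z \<in> \<Omega>" for z
    using that by (simp add: h_def inv linear_add[OF linL] LL add.commute)
  obtain K where K: "\<And>v. norm (L a v) \<le> norm v * K" using bounded_linear.bounded[OF blL] by blast
  obtain r where r: "r > 0" "ball a r \<subseteq> \<Omega> \<inter> U" "inj_on h (ball a r)"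
  proof (rule has_derivative_locally_injective[of a "\<Omega> \<inter> U" _ h' h])
    show "a \<in> \<Omega> \<inter> U" "open (\<Omega> \<inter> U)" using a U(1,2) \<Omega> by auto
    show "bounded_linear (\<lambda>v :: complex ^ 'n. (1/2) *\<^sub>R v)" "(\<lambda>v. (1/2) *\<^sub>R v) \<circ> h' a = id" by (fact ginv)+
    show "(h has_derivative h' x) (at x)" if "x \<in> \<Omega> \<inter> U" for x using hder that by blast
    fix e :: real assume e: "e > 0"
    have "e / 2 / (\<bar>K\<bar> + 1) > 0" using e by (simp add: add_nonneg_pos)
    from cderiv_continuous_onorm[OF hol \<Omega> a this] obtain d where d: "d > 0"
      "\<And>x v. dist a x < d \<Longrightarrow> norm (L x v - L a v) \<le> e / 2 / (\<bar>K\<bar> + 1) * norm v"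
      unfolding L_def by blast
    have "onorm (\<lambda>v. h' x v - h' a v) < e" if x: "dist a x < d" for x
    proof -
      have "norm (h' x v - h' a v) \<le> e / 2 * norm v" for v
      proof -
        have "norm (h' x v - h' a v) = norm (L a (L x v - L a v))"
          by (simp add: h'_def linear_diff[OF linL])
        also have "\<dots> \<le> norm (L x v - L a v) * K" by (rule K)
        also have "\<dots> \<le> norm (L x v - L a v) * (\<bar>K\<bar> + 1)" by (intro mult_left_mono) auto
        also have "\<dots> \<le> e / 2 / (\<bar>K\<bar> + 1) * norm v * (\<bar>K\<bar> + 1)" by (intro mult_right_mono d(2)[OF x]) auto
        also have "\<dots> = e / 2 * norm v"
        proof -
          have *: "e / 2 / k * norm v * k = e / 2 * norm v" if "k > 0" for k using that by simp
          show ?thesis by (rule *) (simp add: add_nonneg_pos)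
        qed
        finally show ?thesis .
      qed
      then have "onorm (\<lambda>v. h' x v - h' a v) \<le> e / 2" by (rule onorm_le)
      then show ?thesis using e by linarith
    qed
    then show "\<exists>d>0. \<forall>x. dist a x < d \<longrightarrow> onorm (\<lambda>v. h' x v - h' a v) < e" using d(1) by blast
  qed
  have "isCont s a" using has_derivative_continuous[OF der[OF a]] .
  then obtain d where d: "d > 0" "\<And>x. dist x a < d \<Longrightarrow> dist (s x) a < r"
    unfolding continuous_at_eps_delta sa using r(1) by (metis sa)
  define T where "T = ball a (min d r)"
  have "h a \<in> interior (h ` T)"
  proof (rule sussmann_open_mapping[of \<Omega> h a "h' a" "\<lambda>v. (1/2) *\<^sub>R v"])
    show "continuous_on \<Omega> h"
      using hder by (meson continuous_at_imp_continuous_on has_derivative_continuous)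
    show "T \<subseteq> \<Omega>" using r by (auto simp: T_def)
    show "a \<in> interior T" using d r by (simp add: T_def)
  qed (use a \<Omega> hder ginv in auto)
  then obtain e where e: "e > 0" "ball (h a) e \<subseteq> h ` T"
    using mem_interior by blast
  have ha: "h a = 0" by (simp add: h_def sa linear_0[OF linL])
  define t where "t = e / (2 * norm w)"
  have t: "t > 0" using e w by (simp add: t_def)
  have "norm (t *\<^sub>R w) < e" using t e w by (simp add: t_def)
  then have "t *\<^sub>R w \<in> h ` T" using e(2) ha by (auto simp: dist_norm)
  then obtain z where z: "z \<in> T" "h z = t *\<^sub>R w" by auto
  have z\<Omega>: "z \<in> \<Omega>" "z \<in> U" "z \<in> ball a r" using z(1) r(2) by (auto simp: T_def)
  have "h (s z) = h z" using intertwine[OF z\<Omega>(1)] z(2) w(2) by (simp add: linear_scale[OF linL])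
  moreover have "s z \<in> ball a r" using d(2)[of z] z(1) by (simp add: T_def dist_commute)
  ultimately have "s z = z" using r(3) z\<Omega>(3) by (meson inj_onD)
  then have "z = a" using U(3) z\<Omega> by blast
  then show False using z(2) ha t w by simp
qed

locale symmetric_circular_domain = circular_domain \<Omega> for \<Omega> :: "(complex ^ 'n) set" +
  assumes symmetric: "a \<in> \<Omega> \<Longrightarrow> \<exists>s. symmetry_at \<Omega> a s"
begin

definition orbit where "orbit = {g 0 | g h. automorphism \<Omega> g h}"

lemma orbitI: "automorphism \<Omega> g h \<Longrightarrow> g 0 \<in> orbit"
  unfolding orbit_def by (intro CollectI exI[of _ g] exI[of _ h] conjI refl)

lemma orbitE:
  assumes "x \<in> orbit" obtains g h where "automorphism \<Omega> g h" "x = g 0"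
proof -
  have "\<exists>g h. x = g 0 \<and> automorphism \<Omega> g h" using assms by (simp add: orbit_def)
  then show thesis using that by (elim exE conjE)
qed

lemma orbit_subset: "orbit \<subseteq> \<Omega>"
  using automorphismD(3)[OF _ zero_mem_\<Omega>] by (auto elim!: orbitE)

lemma symmetry_automorphism: "symmetry_at \<Omega> a s \<Longrightarrow> automorphism \<Omega> s s"
  unfolding symmetry_at_def automorphism_def by auto

text \<open>
  Up to second order the symmetry at \<open>a\<close> is the point reflection in
  \<open>a\<close>. All symmetries map into the bounded set \<open>\<Omega>\<close>, so the
  constant does not depend on \<open>a\<close>.
\<close>

lemma symmetry_approx_reflection:
  assumes r: "r > 0" and sub: "cball b (2 * r) \<subseteq> \<Omega>"
  obtains C where "C > 0" "\<And>a x s. a \<in> cball b r \<Longrightarrow> symmetry_at \<Omega> a s \<Longrightarrow> norm (x - a) \<le> r / 2 \<Longrightarrow>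
    norm (s x - (2 *\<^sub>R a - x)) \<le> C * (norm (x - a))\<^sup>2"
proof -
  obtain M where M: "\<And>z. z \<in> \<Omega> \<Longrightarrow> norm z \<le> M" using bounded_\<Omega> unfolding bounded_iff by blast
  have M0: "M \<ge> 0" using M[OF zero_mem_\<Omega>] by simp
  define C where "C = real CARD('n) * (8 * (M + 1) / r\<^sup>2)"
  have C: "C > 0" using M0 r by (simp add: C_def)
  have "norm (s x - (2 *\<^sub>R a - x)) \<le> C * (norm (x - a))\<^sup>2"
    if a: "a \<in> cball b r" and s: "symmetry_at \<Omega> a s" and x: "norm (x - a) \<le> r / 2" for a x s
  proof -
    have suba: "cball a r \<subseteq> \<Omega>"
    proof
      fix y assume "y \<in> cball a r"
      then have "y \<in> cball b (2 * r)" using a dist_triangle[of b y a] by simp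
      then show "y \<in> \<Omega>" using sub by blast
    qed
    have a\<Omega>: "a \<in> \<Omega>" using suba r by auto
    note sD = automorphismD[OF symmetry_automorphism[OF s]]
    have si: "holomorphic_fun \<Omega> (\<lambda>z. s z $ i)" for i using sD(1) unfolding holomorphic_map_def by blast
    have "cderiv (\<lambda>z. s z $ i) a (x - a) = (a - x) $ i" for i
      using symmetry_derivative[OF s open_\<Omega> a\<Omega>, of "x - a"] by (simp add: vec_eq_iff)
    moreover have "s a = a" using s unfolding symmetry_at_def by blast
    ultimately have "(s x - (2 *\<^sub>R a - x)) $ i = s (a + (x - a)) $ i - s a $ i - cderiv (\<lambda>z. s z $ i) a (x - a)" for i
      by (simp add: scaleR_2)
    moreover have "norm (s (a + (x - a)) $ i - s a $ i - cderiv (\<lambda>z. s z $ i) a (x - a)) \<le> 8 * (M + 1) * (norm (x - a))\<^sup>2 / r\<^sup>2" for i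
    proof (rule second_order_estimate[OF si suba r _ x])
      fix w assume "w \<in> cball a r"
      then have "norm (s w) \<le> M" using M sD(3) suba by blast
      then show "norm (s w $ i) \<le> M + 1" using Finite_Cartesian_Product.norm_nth_le[of "s w" i] by linarith
    qed
    ultimately have "(\<Sum>i\<in>UNIV. norm ((s x - (2 *\<^sub>R a - x)) $ i)) \<le> (\<Sum>i\<in>(UNIV :: 'n set). 8 * (M + 1) * (norm (x - a))\<^sup>2 / r\<^sup>2)"
      by (intro sum_mono) presburger
    also have "\<dots> = C * (norm (x - a))\<^sup>2" by (simp add: C_def)
    finally show ?thesis using norm_vec_le_sum order_trans by blast
  qed
  with C show thesis using that by blast
qed

lemma orbit_symmetry: "x \<in> orbit \<Longrightarrow> symmetry_at \<Omega> a s \<Longrightarrow> s x \<in> orbit"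
  using orbitI[OF automorphism_compose[OF _ symmetry_automorphism]] by (auto elim!: orbitE)

text \<open>
  The closure of the orbit is open in \<open>\<Omega>\<close>. Let \<open>b'\<close> be close
  to a point of the closure, and let \<open>x\<close> be a point of the orbit that is nearly
  as close to \<open>b'\<close> as possible. The symmetry at the midpoint of \<open>x\<close>
  and \<open>b'\<close> moves \<open>x\<close> to a point of the orbit whose distance from
  \<open>b'\<close> is only quadratic in the distance of \<open>x\<close>, hence smaller by a
  fixed factor; so the distance of \<open>b'\<close> from the orbit is 0. Density suffices
  below, because the estimates proved on the orbit pass to limits.
\<close>

lemma orbit_dense: "\<Omega> \<subseteq> closure orbit"
proof -
  have "0 \<in> orbit" using orbitI[OF automorphism_ident] .
  then have ne: "orbit \<noteq> {}" by blast
  have "openin (top_of_set \<Omega>) (\<Omega> \<inter> closure orbit)"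
    unfolding openin_contains_ball
  proof (intro conjI ballI)
    fix b assume b: "b \<in> \<Omega> \<inter> closure orbit"
    obtain r' where r': "r' > 0" "cball b r' \<subseteq> \<Omega>" using open_\<Omega> b open_contains_cball by blast
    define r where "r = r' / 2"
    have r: "r > 0" "cball b (2 * r) \<subseteq> \<Omega>" using r' by (simp_all add: r_def)
    obtain C where C: "C > 0" "\<And>a x s. a \<in> cball b r \<Longrightarrow> symmetry_at \<Omega> a s \<Longrightarrow> norm (x - a) \<le> r / 2 \<Longrightarrow>
        norm (s x - (2 *\<^sub>R a - x)) \<le> C * (norm (x - a))\<^sup>2"
      using symmetry_approx_reflection[OF r] by blast
    \<comment> \<open>Small enough for the midpoints below to stay in \<open>cball b r\<close>, and for the
      quadratic error \<open>C * norm (x - b')\<^sup>2 / 4\<close> to be less than half of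
      \<open>norm (x - b')\<close>.\<close>
    define \<delta> where "\<delta> = min (r / 8) (1 / (8 * C))"
    have \<delta>: "\<delta> > 0" "\<delta> \<le> r / 8" "C * \<delta> \<le> 1 / 8" using r C(1) by (simp_all add: \<delta>_def field_simps min_def)
    have "b' \<in> closure orbit" if b': "b' \<in> ball b \<delta>" for b'
    proof (rule ccontr)
      assume "b' \<notin> closure orbit"
      then have pos: "infdist b' orbit > 0"
        using in_closure_iff_infdist_zero[OF ne, of b'] infdist_nonneg[of b' orbit] by linarith
      obtain x0 where x0: "x0 \<in> orbit" "dist x0 b < \<delta>"
        using b \<delta>(1) closure_approachable[of b orbit] by blast
      have "infdist b' orbit \<le> dist b' x0" by (rule infdist_le[OF x0(1)])
      also have "\<dots> < 2 * \<delta>" using x0 b' dist_triangle[of b' x0 b] by (simp add: dist_commute)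
      finally have "infdist b' orbit < min (2 * \<delta>) (2 * infdist b' orbit)" using pos by simp
      then obtain x where x: "x \<in> orbit" "dist b' x < min (2 * \<delta>) (2 * infdist b' orbit)"
        unfolding infdist_notempty[OF ne] by (subst (asm) cINF_less_iff) (auto simp: ne)
      define a where "a = (1/2) *\<^sub>R (x + b')"
      have xa: "x - a = (1/2) *\<^sub>R (x - b')" and ab: "a - b' = (1/2) *\<^sub>R (x - b')"
        unfolding a_def by (simp_all add: vec_eq_iff scaleR_conv_of_real[where 'a=complex] field_simps)
      have nx: "norm (x - b') < 2 * \<delta>" "norm (x - b') < 2 * infdist b' orbit" using x by (simp_all add: dist_norm norm_minus_commute)
      have nxa: "norm (x - a) = norm (x - b') / 2" by (simp add: xa)
      have "dist b a \<le> dist b b' + dist b' a" by (rule dist_triangle)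
      also have "\<dots> < \<delta> + \<delta>" using b' nx(1) ab by (intro add_strict_mono) (auto simp: dist_norm norm_minus_commute)
      finally have acb: "a \<in> cball b r" using \<delta> r by simp
      then have "a \<in> \<Omega>" using r by (auto simp: subset_iff)
      then obtain s where s: "symmetry_at \<Omega> a s" using symmetric by blast
      \<comment> \<open>Reflecting \<open>x\<close> in the midpoint \<open>a\<close> gives exactly
        \<open>b'\<close>, since \<open>2 a - x = b'\<close>.\<close>
      have "infdist b' orbit \<le> dist b' (s x)" by (rule infdist_le[OF orbit_symmetry[OF x(1) s]])
      also have "dist b' (s x) = norm (s x - (2 *\<^sub>R a - x))"
        unfolding a_def by (simp add: dist_norm norm_minus_commute)
      also have "\<dots> \<le> C * (norm (x - a))\<^sup>2" using nx(1) \<delta> r by (intro C(2)[OF acb s]) (simp add: nxa)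
      also have "\<dots> = C * norm (x - b') * norm (x - b') / 4" by (simp add: nxa power2_eq_square)
      also have "\<dots> \<le> C * (2 * \<delta>) * norm (x - b') / 4"
        using nx(1) C(1) by (intro divide_right_mono mult_right_mono mult_left_mono) auto
      also have "\<dots> = (C * \<delta>) * norm (x - b') / 2" by simp
      also have "\<dots> \<le> 1 / 8 * norm (x - b') / 2" using \<delta>(3) by (intro divide_right_mono mult_right_mono) auto
      also have "\<dots> \<le> norm (x - b') / 2" by simp
      also have "\<dots> < infdist b' orbit" using nx(2) by simp
      finally show False by simp
    qed
    then show "\<exists>e>0. ball b e \<inter> \<Omega> \<subseteq> \<Omega> \<inter> closure orbit" using \<delta>(1) by blast
  qed simp
  moreover have "closedin (top_of_set \<Omega>) (\<Omega> \<inter> closure orbit)" by (simp add: closedin_closed_Int)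
  ultimately have "\<Omega> \<inter> closure orbit = {} \<or> \<Omega> \<inter> closure orbit = \<Omega>"
    using connected_\<Omega> unfolding connected_clopen by blast
  moreover have "0 \<in> \<Omega> \<inter> closure orbit" using zero_mem_\<Omega> \<open>0 \<in> orbit\<close> closure_subset by blast
  ultimately show ?thesis by blast
qed

lemma orbit_sequence:
  assumes "a \<in> \<Omega>" obtains x where "\<And>n. x n \<in> orbit" "x \<longlonglongrightarrow> a"
  using orbit_dense assms closure_sequential[of a orbit] by blast

text \<open>
  For \<open>a\<close> in the orbit of the origin this is the transformation rule together
  with \<open>K z 0 = 1\<close>. A general \<open>a\<close> is a limit of such points, and
  Hurwitz's theorem on complex lines shows that the zeros of the limit function form an open
  set.
\<close>

lemma kernel_nonzero:
  assumes z: "z \<in> \<Omega>" and a: "a \<in> \<Omega>" shows "K z a \<noteq> 0"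
proof -
  have orb: "K z x \<noteq> 0" if x: "x \<in> orbit" and that: "z \<in> \<Omega>" for x z
  proof -
    obtain g h where g: "automorphism \<Omega> g h" "x = g 0" using x by (rule orbitE)
    have "K (g (h z)) (g 0) * cjac g (h z) * cnj (cjac g 0) = K (h z) 0"
      using kernel_transformation[OF g(1) automorphismD(4)[OF g(1) that] zero_mem_\<Omega>] .
    then have "K z x * cjac g (h z) * cnj (cjac g 0) = 1"
      using automorphismD(4,6)[OF g(1) that] kernel_0(1) g(2) by simp
    then show ?thesis by auto
  qed
  obtain x where x: "\<And>n. x n \<in> orbit" "x \<longlonglongrightarrow> a" using orbit_sequence[OF a] by blast
  have x\<Omega>: "x n \<in> \<Omega>" for n using x(1) orbit_subset by blast
  define Z where "Z = {z \<in> \<Omega>. K z a = 0}"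
  have "openin (top_of_set \<Omega>) Z"
    unfolding openin_contains_ball
  proof (intro conjI ballI)
    fix z0 assume z0: "z0 \<in> Z"
    then obtain r where r: "r > 0" "ball z0 r \<subseteq> \<Omega>" using open_\<Omega> open_contains_ball unfolding Z_def by blast
    have "w \<in> Z" if w: "w \<in> ball z0 r" for w
    proof (cases "w = z0")
      case True then show ?thesis using z0 by simp
    next
      case False
      define v where "v = w - z0"
      have v: "norm v > 0" "norm v < r" using False w by (simp_all add: v_def dist_norm norm_minus_commute)
      define S where "S = ball (0 :: complex) (r / norm v)"
      have lineS: "z0 + \<zeta> *s v \<in> \<Omega>" if "\<zeta> \<in> S" for \<zeta>
      proof -
        have "z0 + \<zeta> *s v \<in> ball z0 r" using that v by (intro line_in_ball) (simp add: S_def pos_less_divide_eq)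
        then show ?thesis using r by blast
      qed
      let ?F = "\<lambda>n \<zeta>. K (z0 + \<zeta> *s v) (x n)" and ?g = "\<lambda>\<zeta>. K (z0 + \<zeta> *s v) a"
      have "?g constant_on S"
      proof (rule ccontr)
        assume nc: "\<not> ?g constant_on S"
        have "?g 0 \<noteq> 0"
        proof (rule Hurwitz_no_zeros[of S ?F ?g])
          show "open S" "connected S" by (simp_all add: S_def)
          show "?F n holomorphic_on S" for n by (intro holomorphic_on_line[OF kernel_holomorphic[OF x\<Omega>]] lineS)
          show "?g holomorphic_on S" by (intro holomorphic_on_line[OF kernel_holomorphic[OF a]] lineS)
          show "\<not> ?g constant_on S" by fact
          show "?F n \<zeta> \<noteq> 0" if "\<zeta> \<in> S" for n \<zeta> by (intro orb x lineS that)
          show "0 \<in> S" using v r by (simp add: S_def)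
          fix Q assume Q: "compact Q" "Q \<subseteq> S"
          obtain \<rho> where \<rho>: "\<rho> > 0" "cball a \<rho> \<subseteq> \<Omega>" using open_\<Omega> a open_contains_cball by blast
          define P where "P = (\<lambda>\<zeta>. z0 + \<zeta> *s v) ` Q"
          have P: "compact P" "P \<subseteq> \<Omega>" using Q lineS unfolding P_def
            by (auto intro!: compact_continuous_image continuous_intros continuous_on_smult_vec)
          have "uniformly_continuous_on (P \<times> cball a \<rho>) (\<lambda>p. K (fst p) (snd p))"
            using P \<rho> by (intro compact_uniformly_continuous continuous_on_subset[OF kernel_continuous] compact_Times) auto
          note uc = this[unfolded uniformly_continuous_on_def, rule_format]
          show "uniform_limit Q ?F ?g sequentially"
          proof (rule uniform_limitI)
            fix e :: real assume "e > 0"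
            from uc[OF this] obtain \<delta> where \<delta>: "\<delta> > 0"
              "\<And>p q. p \<in> P \<times> cball a \<rho> \<Longrightarrow> q \<in> P \<times> cball a \<rho> \<Longrightarrow> dist q p < \<delta> \<Longrightarrow> dist (K (fst q) (snd q)) (K (fst p) (snd p)) < e"
              by blast
            have "\<forall>\<^sub>F n in sequentially. dist (x n) a < min \<delta> \<rho>"
              by (rule tendstoD[OF x(2)]) (simp add: \<delta>(1) \<rho>(1))
            then show "\<forall>\<^sub>F n in sequentially. \<forall>\<zeta>\<in>Q. dist (?F n \<zeta>) (?g \<zeta>) < e"
            proof eventually_elim
              case (elim n)
              show ?case
              proof
                fix \<zeta> assume "\<zeta> \<in> Q"
                then have "z0 + \<zeta> *s v \<in> P" unfolding P_def by (rule imageI)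
                then show "dist (?F n \<zeta>) (?g \<zeta>) < e"
                  using \<delta>(2)[of "(z0 + \<zeta> *s v, a)" "(z0 + \<zeta> *s v, x n)"] elim \<rho>(1)
                  by (simp add: dist_Pair_Pair dist_commute)
              qed
            qed
          qed
        qed
        then show False using z0 by (simp add: Z_def)
      qed
      moreover have "1 \<in> S" "0 \<in> S" using v r by (simp_all add: S_def)
      ultimately have "?g 1 = ?g 0" unfolding constant_on_def by metis
      then have "K w a = 0" using z0 by (simp add: Z_def v_def)
      then show ?thesis using w r by (auto simp: Z_def)
    qed
    then show "\<exists>e>0. ball z0 e \<inter> \<Omega> \<subseteq> Z" using r(1) by blast
  qed (auto simp: Z_def)
  moreover have "closedin (top_of_set \<Omega>) Z"
    unfolding Z_def
    by (rule continuous_closedin_preimage_constant[OF holomorphic_fun_continuous_on[OF kernel_holomorphic[OF a]]])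
  moreover have "0 \<notin> Z" using kernel_0(2)[OF a] by (simp add: Z_def)
  ultimately have "Z = {}" using connected_\<Omega> zero_mem_\<Omega> unfolding connected_clopen by blast
  then show ?thesis using z by (auto simp: Z_def)
qed

text \<open>
  Along a path \<open>\<gamma>\<close> from \<open>a\<close> to the origin the functions
  \<open>K(\<cdot>, \<gamma> t)\<close> have no zeros and end in the constant 1. So
  \<open>K(\<cdot>, a)\<close> is null-homotopic in the punctured plane, although
  \<open>\<Omega>\<close> is not known to be simply connected.
\<close>

lemma kernel_continuous_log:
  assumes a: "a \<in> \<Omega>"
  obtains L where "continuous_on \<Omega> L" "\<And>z. z \<in> \<Omega> \<Longrightarrow> K z a = exp (L z)"
proof -
  obtain \<gamma> where \<gamma>: "path \<gamma>" "path_image \<gamma> \<subseteq> \<Omega>" "pathstart \<gamma> = a" "pathfinish \<gamma> = 0"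
    using connected_open_path_connected[OF open_\<Omega> connected_\<Omega>] a zero_mem_\<Omega> unfolding path_connected_def by metis
  have \<gamma>\<Omega>: "\<gamma> t \<in> \<Omega>" if "t \<in> {0..1}" for t using that \<gamma>(2) by (auto simp: path_image_def)
  let ?H = "\<lambda>p. K (snd p) (\<gamma> (fst p))"
  have "homotopic_with_canon (\<lambda>h. True) \<Omega> (-{0}) (\<lambda>z. K z a) (\<lambda>z. 1)"
  proof (subst homotopic_with, simp, intro exI[of _ ?H] conjI ballI)
    have "continuous_on ({0..1} \<times> \<Omega>) (\<lambda>p. (snd p, \<gamma> (fst p)))"
      using \<gamma>(1) unfolding path_def
      by (intro continuous_on_Pair continuous_on_snd continuous_on_id
          continuous_on_compose2[of "{0..1}" \<gamma> _ fst] continuous_on_fst) auto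
    then have "continuous_on ({0..1} \<times> \<Omega>) (\<lambda>p. K (fst (snd p, \<gamma> (fst p))) (snd (snd p, \<gamma> (fst p))))"
      by (rule continuous_on_compose2[OF kernel_continuous]) (use \<gamma>\<Omega> in force)
    then have "continuous_on ({0..1} \<times> \<Omega>) ?H" by simp
    then show "continuous_map (prod_topology (top_of_set {0..1}) (top_of_set \<Omega>)) (top_of_set (-{0})) ?H"
      using kernel_nonzero \<gamma>\<Omega> by (auto simp: prod_topology_subtopology_eu)
    show "?H (0, z) = K z a" if "z \<in> topspace (top_of_set \<Omega>)" for z using \<gamma>(3) by (simp add: pathstart_def)
    show "?H (1, z) = 1" if "z \<in> topspace (top_of_set \<Omega>)" for z
      using \<gamma>(4) that by (simp add: pathfinish_def kernel_0)
  qed simp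
  then show thesis using inessential_eq_continuous_logarithm[of \<Omega> "\<lambda>z. K z a"] that by blast
qed

text \<open>
  A continuous logarithm of a holomorphic function is locally a constant plus the principal
  branch, hence holomorphic.
\<close>

lemma kernel_power:
  assumes a: "a \<in> \<Omega>"
  obtains F where "holomorphic_fun \<Omega> F" "\<And>z. z \<in> \<Omega> \<Longrightarrow> cmod (F z) = cmod (K z a) powr \<mu>"
proof -
  obtain L where cont: "continuous_on \<Omega> L" and L: "\<And>z. z \<in> \<Omega> \<Longrightarrow> K z a = exp (L z)"
    using kernel_continuous_log[OF a] by blast
  have "\<exists>r>0. holomorphic_fun (ball z0 r) L" if z0: "z0 \<in> \<Omega>" for z0
  proof -
    have "isCont L z0" using cont z0 open_\<Omega> continuous_on_eq_continuous_at by blast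
    then obtain r1 where r1: "r1 > 0" "\<And>z. dist z z0 < r1 \<Longrightarrow> dist (L z) (L z0) < 1"
      unfolding continuous_at_eps_delta by (metis zero_less_one)
    obtain r2 where r2: "r2 > 0" "ball z0 r2 \<subseteq> \<Omega>" using open_\<Omega> z0 open_contains_ball by blast
    let ?B = "ball z0 (min r1 r2)"
    let ?q = "\<lambda>z. inverse (K z0 a) * K z a"
    have q: "?q z = exp (L z - L z0)" "\<bar>Im (L z - L z0)\<bar> < 1" if z: "z \<in> ?B" for z
    proof -
      show "?q z = exp (L z - L z0)" using z r2(2) L z0 by (auto simp: exp_diff divide_inverse mult.commute)
      have "norm (L z - L z0) < 1" using r1(2)[of z] z by (simp add: dist_commute flip: dist_norm)
      then show "\<bar>Im (L z - L z0)\<bar> < 1" using abs_Im_le_cmod le_less_trans by blast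
    qed
    have "holomorphic_fun ?B (\<lambda>z. L z0 + Ln (?q z))"
    proof (intro holomorphic_fun_add holomorphic_fun_const holomorphic_fun_chain[where g=Ln])
      show "holomorphic_fun ?B ?q"
        using r2(2) by (intro holomorphic_fun_cmult holomorphic_fun_subset[OF kernel_holomorphic[OF a]]) auto
      fix z assume z: "z \<in> ?B"
      have "0 < Re (?q z)"
        unfolding q(1)[OF z] Re_exp using q(2)[OF z] pi_gt3
        by (intro mult_pos_pos cos_gt_zero_pi) auto
      then have "?q z \<notin> \<real>\<^sub>\<le>\<^sub>0" by (auto simp: complex_nonpos_Reals_iff)
      then show "Ln field_differentiable at (?q z)" by (rule field_differentiable_at_Ln)
    qed
    moreover have "L z0 + Ln (?q z) = L z" if z: "z \<in> ?B" for z
      unfolding q(1)[OF z] using q(2)[OF z] pi_gt3 by (subst Ln_exp) auto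
    ultimately have "holomorphic_fun ?B L" by (rule holomorphic_fun_cong[OF _ open_ball])
    then show ?thesis using r1(1) r2(1) by (intro exI[of _ "min r1 r2"]) auto
  qed
  then have hol: "holomorphic_fun \<Omega> L" unfolding holomorphic_fun_def by (meson centre_in_ball)
  show thesis
  proof (rule that[of "\<lambda>z. exp (of_real \<mu> * L z)"])
    show "holomorphic_fun \<Omega> (\<lambda>z. exp (of_real \<mu> * L z))"
      by (rule holomorphic_fun_chain[OF holomorphic_fun_cmult[OF hol]]) (unfold field_differentiable_def, rule exI, rule DERIV_exp)
    show "cmod (exp (of_real \<mu> * L z)) = cmod (K z a) powr \<mu>" if "z \<in> \<Omega>" for z
      using L[OF that] by (simp add: norm_exp_eq_Re powr_def)
  qed
qed

end

section \<open>Point evaluations on the weighted Bergman space\<close>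

text \<open>
  The bookkeeping of Jacobian factors behind the invariance of the weighted norms: the
  exponents of \<open>j\<close> on the left add up to \<open>2 l + 2 (1 - l) = 2\<close>, as
  required by the change of variables.
\<close>

lemma weight_identity:
  fixes l :: real
  assumes "j > 0" "k > 0" "D > 0"
  shows "(D * j\<^sup>2) powr l * ((j * k) powr (1 - l))\<^sup>2 = (k powr (1 - l))\<^sup>2 * (j\<^sup>2 * D powr l)"
proof -
  have "(j\<^sup>2) powr l = j powr (2 * l)" "(j powr (1 - l))\<^sup>2 = j powr (2 * (1 - l))"
    using assms by (simp_all add: powr_powr mult.commute flip: powr_numeral)
  then have "(j\<^sup>2) powr l * (j powr (1 - l))\<^sup>2 = j powr (2 * l + 2 * (1 - l))"
    by (simp only: powr_add)
  also have "\<dots> = j\<^sup>2" using assms by simp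
  finally have "(j\<^sup>2) powr l * (j powr (1 - l))\<^sup>2 = j\<^sup>2" .
  then show ?thesis
    using assms by (simp add: powr_mult power_mult_distrib mult_ac)
qed

lemma power2_powr: "x > 0 \<Longrightarrow> (x powr m)\<^sup>2 = (x\<^sup>2) powr m" for x m :: real
  by (simp add: powr_powr mult.commute flip: powr_numeral)

locale weighted_symmetric_domain = symmetric_circular_domain \<Omega> for \<Omega> :: "(complex ^ 'n) set" +
  fixes l :: real
  assumes finite_mass: "(\<integral>\<^sup>+ z. ennreal (bergman_diag \<Omega> z powr l) \<partial>normalized_volume \<Omega>) < \<infinity>"
begin

abbreviation "M \<equiv> weighted_volume \<Omega> l"

text \<open>
  The normalising constant of the weighted volume.
\<close>

definition C :: real where "C = (LINT w|V. d w powr l)"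

lemma diag_pos: "z \<in> \<Omega> \<Longrightarrow> d z > 0"
  using diag_ge_1 by force

lemma weight_continuous: "continuous_on \<Omega> (\<lambda>z. d z powr r)"
  using diag_pos by (intro continuous_intros diag_continuous) force

lemma nn_integral_weight: "(\<integral>\<^sup>+ z. ennreal (d z powr l) \<partial>V) = ennreal C"
  unfolding C_def using finite_mass measurable_V[OF weight_continuous]
  by (intro nn_integral_eq_integral integrableI_nonneg) auto

lemma C_pos: "C > 0"
proof (rule ccontr)
  assume "\<not> C > 0"
  then have "(\<integral>\<^sup>+ z. ennreal (d z powr l) \<partial>V) = 0" by (simp add: nn_integral_weight ennreal_neg)
  then have "AE z in V. ennreal (d z powr l) = 0"
    using measurable_V[OF weight_continuous] by (subst (asm) nn_integral_0_iff_AE) auto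
  then have "AE z in V. False"
    using AE_space
  proof eventually_elim
    case (elim z)
    then show False using diag_pos[of z] by (simp add: space_V ennreal_eq_0_iff)
  qed
  then have "emeasure V (space V) = 0" by (simp add: AE_iff_null_sets null_setsD1 eventually_ae_filter)
  then show False using mass_V by (simp add: space_V)
qed

lemma M_density_V: "M = density V (\<lambda>z. ennreal (d z powr l / C))"
  by (simp add: weighted_volume_def C_def)

lemma weight_measurable [measurable]: "(\<lambda>z. d z powr r) \<in> borel_measurable V"
  by (rule measurable_V[OF weight_continuous])

lemma space_M: "space M = \<Omega>" and sets_M: "sets M = sets V"
  by (simp_all add: M_density_V space_V)

lemma nn_integral_M:
  assumes [measurable]: "F \<in> borel_measurable V"
  shows "(\<integral>\<^sup>+ z. F z \<partial>M) = (\<integral>\<^sup>+ z. ennreal (d z powr l / C) * F z \<partial>V)"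
  unfolding M_density_V by (rule nn_integral_density) measurable

lemma mass_M: "emeasure M \<Omega> = 1"
proof -
  have "emeasure M \<Omega> = (\<integral>\<^sup>+ z. 1 \<partial>M)" by (simp add: space_M)
  also have "\<dots> = (\<integral>\<^sup>+ z. ennreal (1 / C) * ennreal (d z powr l) \<partial>V)"
    using C_pos by (subst nn_integral_M) (auto intro!: nn_integral_cong simp: ennreal_mult[symmetric])
  also have "\<dots> = ennreal (1 / C) * ennreal C"
    by (subst nn_integral_cmult) (simp_all add: nn_integral_weight)
  also have "\<dots> = 1" using C_pos by (simp add: ennreal_mult[symmetric])
  finally show ?thesis .
qed

sublocale W: bergman_measure \<Omega> M
proof -
  have [measurable]: "(\<lambda>z. d z powr l) \<in> borel_measurable R"
    by (rule measurable_restrict_continuous[OF weight_continuous])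
  have "M = density R (\<lambda>z. ennreal (1 / vol) * ennreal (d z powr l / C))"
    unfolding M_density_V by (subst V_density, rule density_density_eq) measurable
  also have "\<dots> = density R (\<lambda>z. ennreal (1 / vol * (d z powr l / C)))"
    using vol_pos C_pos by (simp add: ennreal_mult[symmetric])
  finally have M: "M = density R (\<lambda>z. ennreal (1 / vol * (d z powr l / C)))" .
  show "bergman_measure \<Omega> M"
    unfolding M using vol_pos C_pos diag_pos
    by (intro bergman_measure_density open_\<Omega> continuous_intros weight_continuous) force+
qed

lemma rotation_distr_M:
  assumes c: "norm c = 1" shows "distr M M (\<lambda>z. c *s z) = M"
proof -
  let ?w = "\<lambda>z. ennreal (d z powr l / C)"
  have rot: "(\<lambda>z. c *s z) \<in> measurable V V" by (rule automorphism_measurable_V[OF rotation_automorphism_0[OF c]])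
  have "M = density (distr V V (\<lambda>z. c *s z)) ?w" by (simp add: M_density_V rotation_distr_V[OF c])
  also have "\<dots> = distr (density V (\<lambda>z. ?w (c *s z))) V (\<lambda>z. c *s z)"
    by (rule density_distr[OF _ rot]) measurable
  also have "density V (\<lambda>z. ?w (c *s z)) = M"
    unfolding M_density_V
  proof (rule density_cong)
    show "(\<lambda>z. ?w (c *s z)) \<in> borel_measurable V"
      using measurable_compose[OF rot, of ?w borel] by measurable
    show "AE z in V. ?w (c *s z) = ?w z"
      by (rule AE_I2) (simp add: space_V diag_rotation c)
  qed measurable
  also have "distr M V (\<lambda>z. c *s z) = distr M M (\<lambda>z. c *s z)"
    by (rule distr_cong) (simp_all add: sets_M)
  finally show ?thesis by simp
qed

lemma one_mem_M: "one \<in> W.A2" and one_norm_M: "W.A2_norm one = 1"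
proof -
  show mem: "one \<in> W.A2" by (rule W.indicator_mem) (simp add: mass_M)
  have "(W.A2_norm one)\<^sup>2 = (LINT z|M. 1)"
    unfolding W.A2_norm_sq by (intro Bochner_Integration.integral_cong) (auto simp: space_M)
  then have "(W.A2_norm one)\<^sup>2 = 1\<^sup>2" using mass_M by (simp add: measure_def space_M)
  then show "W.A2_norm one = 1" using W.A2_norm_nonneg[of one] by (rule power2_eq_imp_eq) simp
qed

lemma evaluation_at_0: "f \<in> W.A2 \<Longrightarrow> norm (f 0) \<le> W.A2_norm f"
  using W.circular_mean_value[OF mass_M connected_\<Omega> zero_mem_\<Omega> circular rotation_distr_M]
    W.Cauchy_Schwarz[OF _ one_mem_M] one_norm_M by fastforce

text \<open>
  Let \<open>a = g 0\<close> and \<open>g b = 0\<close>. Multiplying \<open>f \<circ>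
  g\<close> by the power \<open>1 - l\<close> of \<open>K(\<cdot>, b)\<close> gives a function
  whose squared norm is \<open>d a powr (1 - l)\<close> times that of \<open>f\<close>, and
  whose value at the origin has modulus \<open>\<bar>f a\<bar>\<close>. So the mean value
  property at the origin is all that remains.
\<close>

lemma evaluation_orbit:
  assumes f: "f \<in> W.A2" and a: "a \<in> orbit"
  shows "(norm (f a))\<^sup>2 \<le> d a powr (1 - l) * (W.A2_norm f)\<^sup>2"
proof -
  obtain g h where g: "automorphism \<Omega> g h" and ag: "a = g 0" using a by (rule orbitE)
  note gD = automorphismD[OF g]
  define b where "b = h 0"
  have b: "b \<in> \<Omega>" "g b = 0" using gD(4,6)[OF zero_mem_\<Omega>] by (simp_all add: b_def)
  define j where "j = (\<lambda>z. cmod (cjac g z))"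
  have j: "j z > 0" if "z \<in> \<Omega>" for z using cjac_inverse[OF g open_\<Omega> that] by (auto simp: j_def)
  have Kb: "cmod (K z b) = j z * j b" if z: "z \<in> \<Omega>" for z
  proof -
    have "K z b = cjac g z * cnj (cjac g b)"
      using kernel_transformation[OF g z b(1)] kernel_0(1)[OF gD(3)[OF z]] by (simp add: b(2))
    then show ?thesis by (simp add: j_def norm_mult)
  qed
  have dg: "d z = d (g z) * (j z)\<^sup>2" if "z \<in> \<Omega>" for z
    using diag_transformation[OF g that] by (simp add: j_def)
  have d0: "d 0 = 1" using kernel_0(1)[OF zero_mem_\<Omega>] by (simp add: bergman_diag_def)
  have da: "d a = (j b)\<^sup>2"
  proof -
    have "j 0 * j b = 1" using Kb[OF zero_mem_\<Omega>] kernel_0(2)[OF b(1)] by simp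
    then have "(j 0)\<^sup>2 * (j b)\<^sup>2 = 1" by (simp flip: power_mult_distrib)
    then have "d a = d a * ((j 0)\<^sup>2 * (j b)\<^sup>2)" by simp
    also have "\<dots> = (d a * (j 0)\<^sup>2) * (j b)\<^sup>2" by (simp only: mult.assoc)
    also have "\<dots> = (j b)\<^sup>2" using dg[OF zero_mem_\<Omega>] by (simp add: ag d0)
    finally show ?thesis .
  qed
  obtain F where F: "holomorphic_fun \<Omega> F" "\<And>z. z \<in> \<Omega> \<Longrightarrow> cmod (F z) = cmod (K z b) powr (1 - l)"
    using kernel_power[OF b(1)] by blast
  define \<Phi> where "\<Phi> = (\<lambda>z. if z \<in> \<Omega> then f (g z) * F z else 0)"
  have hol: "holomorphic_fun \<Omega> \<Phi>"
    by (rule holomorphic_fun_cong[OF holomorphic_fun_mult[OF holomorphic_fun_compose[OF W.A2D(1)[OF f] gD(1,7)] F(1)] open_\<Omega>])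
       (simp add: \<Phi>_def)
  have mf [measurable]: "f \<in> borel_measurable V" and [measurable]: "\<Phi> \<in> borel_measurable V"
    using measurable_V holomorphic_fun_continuous_on W.A2D(1)[OF f] hol by blast+
  note [measurable] = automorphism_measurable_V[OF g]
  have "(\<integral>\<^sup>+ z. ennreal ((norm (\<Phi> z))\<^sup>2) \<partial>M) = (\<integral>\<^sup>+ z. ennreal (d z powr l / C) * ennreal ((norm (\<Phi> z))\<^sup>2) \<partial>V)"
    by (rule nn_integral_M) measurable
  also have "\<dots> = (\<integral>\<^sup>+ z. ennreal ((j b powr (1 - l))\<^sup>2) * (ennreal ((cmod (cjac g z))\<^sup>2) * (ennreal (d (g z) powr l / C) * ennreal ((norm (f (g z)))\<^sup>2))) \<partial>V)"
  proof (intro nn_integral_cong)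
    fix z assume "z \<in> space V"
    then have z: "z \<in> \<Omega>" by (simp add: space_V)
    have "d z powr l * ((j z * j b) powr (1 - l))\<^sup>2 = (j b powr (1 - l))\<^sup>2 * ((j z)\<^sup>2 * d (g z) powr l)"
      unfolding dg[OF z] by (rule weight_identity[OF j[OF z] j[OF b(1)] diag_pos[OF gD(3)[OF z]]])
    then have "d z powr l / C * (norm (\<Phi> z))\<^sup>2
        = (j b powr (1 - l))\<^sup>2 * ((j z)\<^sup>2 * (d (g z) powr l / C * (norm (f (g z)))\<^sup>2))"
      using z by (simp add: \<Phi>_def norm_mult F(2) Kb power_mult_distrib field_simps)
    then show "ennreal (d z powr l / C) * ennreal ((norm (\<Phi> z))\<^sup>2)
        = ennreal ((j b powr (1 - l))\<^sup>2) * (ennreal ((cmod (cjac g z))\<^sup>2) * (ennreal (d (g z) powr l / C) * ennreal ((norm (f (g z)))\<^sup>2)))"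
      using C_pos by (simp add: j_def flip: ennreal_mult)
  qed
  also have "\<dots> = ennreal ((j b powr (1 - l))\<^sup>2) * (\<integral>\<^sup>+ z. ennreal ((cmod (cjac g z))\<^sup>2) * (ennreal (d (g z) powr l / C) * ennreal ((norm (f (g z)))\<^sup>2)) \<partial>V)"
  proof (rule nn_integral_cmult)
    have "(\<lambda>z. ennreal (d z powr l / C) * ennreal ((norm (f z))\<^sup>2)) \<in> borel_measurable V" by measurable
    from measurable_compose[OF automorphism_measurable_V(1)[OF g] this]
    show "(\<lambda>z. ennreal ((cmod (cjac g z))\<^sup>2) * (ennreal (d (g z) powr l / C) * ennreal ((norm (f (g z)))\<^sup>2))) \<in> borel_measurable V"
      by measurable
  qed
  also have "(\<integral>\<^sup>+ z. ennreal ((cmod (cjac g z))\<^sup>2) * (ennreal (d (g z) powr l / C) * ennreal ((norm (f (g z)))\<^sup>2)) \<partial>V)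
      = (\<integral>\<^sup>+ z. ennreal (d z powr l / C) * ennreal ((norm (f z))\<^sup>2) \<partial>V)"
    by (rule automorphism_nn_integral_V[OF g]) measurable
  also have "\<dots> = (\<integral>\<^sup>+ z. ennreal ((norm (f z))\<^sup>2) \<partial>M)"
    by (rule nn_integral_M[symmetric]) measurable
  also have "\<dots> = ennreal ((W.A2_norm f)\<^sup>2)" by (rule W.A2_nn_norm[OF f])
  finally have int: "(\<integral>\<^sup>+ z. ennreal ((norm (\<Phi> z))\<^sup>2) \<partial>M) = ennreal ((j b powr (1 - l))\<^sup>2 * (W.A2_norm f)\<^sup>2)"
    by (simp add: ennreal_mult)
  have \<Phi>: "\<Phi> \<in> W.A2"
    by (rule W.A2I[OF hol]) (simp_all add: \<Phi>_def[THEN fun_cong] int[unfolded \<Phi>_def])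
  have "norm (f a) = norm (\<Phi> 0)"
    using F(2)[OF zero_mem_\<Omega>] kernel_0(2)[OF b(1)] zero_mem_\<Omega> by (simp add: \<Phi>_def ag norm_mult)
  also have "(norm (\<Phi> 0))\<^sup>2 \<le> (W.A2_norm \<Phi>)\<^sup>2" using evaluation_at_0[OF \<Phi>] by (intro power_mono) auto
  also have "(W.A2_norm \<Phi>)\<^sup>2 = (j b powr (1 - l))\<^sup>2 * (W.A2_norm f)\<^sup>2"
    using W.A2_nn_norm[OF \<Phi>] int by (simp add: ennreal_inj)
  also have "(j b powr (1 - l))\<^sup>2 = d a powr (1 - l)" unfolding da by (rule power2_powr[OF j[OF b(1)]])
  finally show ?thesis .
qed

text \<open>
  Both sides are continuous in \<open>a\<close>, and the orbit of the origin is dense.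
\<close>

lemma weighted_evaluation:
  assumes f: "f \<in> W.A2" and a: "a \<in> \<Omega>"
  shows "(norm (f a))\<^sup>2 \<le> d a powr (1 - l) * (W.A2_norm f)\<^sup>2"
proof -
  obtain x where x: "\<And>n. x n \<in> orbit" "x \<longlonglongrightarrow> a" using orbit_sequence[OF a] by blast
  have lim: "(\<lambda>n. u (x n)) \<longlonglongrightarrow> u a" if "continuous_on \<Omega> u" for u :: "complex ^ 'n \<Rightarrow> 'b :: topological_space"
    using continuous_on_tendsto_compose[OF that x(2) a] x(1) orbit_subset by (auto simp: eventually_sequentially)
  show ?thesis
  proof (rule LIMSEQ_le)
    show "(\<lambda>n. (norm (f (x n)))\<^sup>2) \<longlonglongrightarrow> (norm (f a))\<^sup>2"
      by (intro tendsto_intros lim holomorphic_fun_continuous_on[OF W.A2D(1)[OF f]])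
    show "(\<lambda>n. d (x n) powr (1 - l) * (W.A2_norm f)\<^sup>2) \<longlonglongrightarrow> d a powr (1 - l) * (W.A2_norm f)\<^sup>2"
      by (intro tendsto_mult_right lim weight_continuous)
  qed (use evaluation_orbit[OF f] x(1) in blast)
qed

lemma kernel_measurable: "a \<in> \<Omega> \<Longrightarrow> (\<lambda>z. K z a) \<in> borel_measurable V"
  by (intro measurable_V holomorphic_fun_continuous_on kernel_holomorphic)

text \<open>
  Here \<open>a = g 0\<close>, and the substitution \<open>z = g w\<close> turns the integrand
  into a multiple of the weight itself.
\<close>

lemma kernel_power_integral_orbit:
  assumes a: "a \<in> orbit"
  shows "(\<integral>\<^sup>+ z. ennreal ((cmod (K z a) powr (1 - l))\<^sup>2) \<partial>M) = ennreal (d a powr (1 - l))"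
proof -
  obtain g h where g: "automorphism \<Omega> g h" and ag: "a = g 0" using a by (rule orbitE)
  note gD = automorphismD[OF g]
  have a\<Omega>: "a \<in> \<Omega>" using a orbit_subset by blast
  define j where "j = (\<lambda>z. cmod (cjac g z))"
  have j: "j z > 0" if "z \<in> \<Omega>" for z using cjac_inverse[OF g open_\<Omega> that] by (auto simp: j_def)
  have Ka: "cmod (K (g z) a) * (j z * j 0) = 1" if z: "z \<in> \<Omega>" for z
  proof -
    have "K (g z) a * cjac g z * cnj (cjac g 0) = 1"
      using kernel_transformation[OF g z zero_mem_\<Omega>] kernel_0(1)[OF z] by (simp add: ag)
    then have "cmod (K (g z) a * cjac g z * cnj (cjac g 0)) = 1" by simp
    then show ?thesis by (simp add: j_def norm_mult mult.assoc)
  qed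
  have dg: "d z = d (g z) * (j z)\<^sup>2" if "z \<in> \<Omega>" for z
    using diag_transformation[OF g that] by (simp add: j_def)
  have d0: "d 0 = 1" using kernel_0(1)[OF zero_mem_\<Omega>] by (simp add: bergman_diag_def)
  have da: "d a = (1 / j 0)\<^sup>2"
    using dg[OF zero_mem_\<Omega>] j[OF zero_mem_\<Omega>] by (simp add: ag d0 power_divide field_simps)
  note [measurable] = kernel_measurable[OF a\<Omega>] automorphism_measurable_V[OF g]
  have "(\<integral>\<^sup>+ z. ennreal ((cmod (K z a) powr (1 - l))\<^sup>2) \<partial>M)
      = (\<integral>\<^sup>+ z. ennreal (d z powr l / C) * ennreal ((cmod (K z a) powr (1 - l))\<^sup>2) \<partial>V)"
    by (rule nn_integral_M) measurable
  also have "\<dots> = (\<integral>\<^sup>+ z. ennreal ((cmod (cjac g z))\<^sup>2) * (ennreal (d (g z) powr l / C) * ennreal ((cmod (K (g z) a) powr (1 - l))\<^sup>2)) \<partial>V)"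
    by (rule automorphism_nn_integral_V[OF g, symmetric]) measurable
  also have "\<dots> = (\<integral>\<^sup>+ z. ennreal (d a powr (1 - l)) * (ennreal (d z powr l / C) * 1) \<partial>V)"
  proof (intro nn_integral_cong)
    fix z assume "z \<in> space V"
    then have z: "z \<in> \<Omega>" by (simp add: space_V)
    have j0: "1 / j 0 > 0" using j[OF zero_mem_\<Omega>] by simp
    have K: "cmod (K (g z) a) = 1 / j z * (1 / j 0)"
      using Ka[OF z] j[OF z] j[OF zero_mem_\<Omega>] by (simp add: field_simps)
    have "(d z * (1 / j z)\<^sup>2) powr l * ((1 / j z * (1 / j 0)) powr (1 - l))\<^sup>2 = ((1 / j 0) powr (1 - l))\<^sup>2 * ((1 / j z)\<^sup>2 * d z powr l)"
      using j[OF z] j0 diag_pos[OF z] by (intro weight_identity) auto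
    moreover have "d z * (1 / j z)\<^sup>2 = d (g z)" using dg[OF z] j[OF z] by (simp add: power_divide)
    moreover have "((1 / j 0) powr (1 - l))\<^sup>2 = d a powr (1 - l)" unfolding da by (rule power2_powr[OF j0])
    ultimately have "d (g z) powr l * (cmod (K (g z) a) powr (1 - l))\<^sup>2 = d a powr (1 - l) * ((1 / j z)\<^sup>2 * d z powr l)"
      by (simp only: K)
    then have "(j z)\<^sup>2 * (d (g z) powr l / C * (cmod (K (g z) a) powr (1 - l))\<^sup>2) = d a powr (1 - l) * (d z powr l / C)"
      using j[OF z] C_pos by (simp add: power_divide field_simps)
    then show "ennreal ((cmod (cjac g z))\<^sup>2) * (ennreal (d (g z) powr l / C) * ennreal ((cmod (K (g z) a) powr (1 - l))\<^sup>2))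
        = ennreal (d a powr (1 - l)) * (ennreal (d z powr l / C) * 1)"
      using C_pos by (simp add: j_def flip: ennreal_mult)
  qed
  also have "\<dots> = ennreal (d a powr (1 - l)) * (\<integral>\<^sup>+ z. ennreal (d z powr l / C) * 1 \<partial>V)"
    by (rule nn_integral_cmult) measurable
  also have "(\<integral>\<^sup>+ z. ennreal (d z powr l / C) * 1 \<partial>V) = (\<integral>\<^sup>+ z. 1 \<partial>M)"
    by (rule nn_integral_M[symmetric]) measurable
  also have "\<dots> = 1" using mass_M by (simp add: space_M)
  finally show ?thesis by simp
qed

text \<open>
  Fatou's lemma along a sequence in the orbit that converges to \<open>a\<close>.
\<close>

lemma kernel_power_integral_le:
  assumes a: "a \<in> \<Omega>"
  shows "(\<integral>\<^sup>+ z. ennreal ((cmod (K z a) powr (1 - l))\<^sup>2) \<partial>M) \<le> ennreal (d a powr (1 - l))"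
proof -
  obtain x where x: "\<And>n. x n \<in> orbit" "x \<longlonglongrightarrow> a" using orbit_sequence[OF a] by blast
  have x\<Omega>: "x n \<in> \<Omega>" for n using x(1) orbit_subset by blast
  have lim: "(\<lambda>n. cmod (K z (x n))) \<longlonglongrightarrow> cmod (K z a)" if z: "z \<in> \<Omega>" for z
  proof -
    have "(\<lambda>n. K (x n) z) \<longlonglongrightarrow> K a z"
      using continuous_on_tendsto_compose[OF holomorphic_fun_continuous_on[OF kernel_holomorphic[OF z]] x(2) a] x\<Omega>
      by auto
    then have "(\<lambda>n. cmod (K (x n) z)) \<longlonglongrightarrow> cmod (K a z)" by (rule tendsto_norm)
    then show ?thesis using kernel_commute[OF z x\<Omega>] kernel_commute[OF z a] by simp
  qed
  have "(\<integral>\<^sup>+ z. ennreal ((cmod (K z a) powr (1 - l))\<^sup>2) \<partial>M)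
      = (\<integral>\<^sup>+ z. liminf (\<lambda>n. ennreal ((cmod (K z (x n)) powr (1 - l))\<^sup>2)) \<partial>M)"
  proof (intro nn_integral_cong)
    fix z assume "z \<in> space M"
    then have z: "z \<in> \<Omega>" by (simp add: space_M)
    have "(\<lambda>n. ennreal ((cmod (K z (x n)) powr (1 - l))\<^sup>2)) \<longlonglongrightarrow> ennreal ((cmod (K z a) powr (1 - l))\<^sup>2)"
      using kernel_nonzero[OF z a] by (intro tendsto_ennrealI tendsto_intros lim z) auto
    then show "ennreal ((cmod (K z a) powr (1 - l))\<^sup>2) = liminf (\<lambda>n. ennreal ((cmod (K z (x n)) powr (1 - l))\<^sup>2))"
      by (rule lim_imp_Liminf[OF sequentially_bot, symmetric])
  qed
  also have "\<dots> \<le> liminf (\<lambda>n. \<integral>\<^sup>+ z. ennreal ((cmod (K z (x n)) powr (1 - l))\<^sup>2) \<partial>M)"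
  proof (rule nn_integral_liminf)
    fix n
    have [measurable]: "(\<lambda>z. K z (x n)) \<in> borel_measurable M"
      using kernel_measurable[OF x\<Omega>] by (simp add: measurable_cong_sets[OF sets_M refl])
    show "(\<lambda>z. ennreal ((cmod (K z (x n)) powr (1 - l))\<^sup>2)) \<in> borel_measurable M" by measurable
  qed
  also have "\<dots> = liminf (\<lambda>n. ennreal (d (x n) powr (1 - l)))"
    by (simp add: kernel_power_integral_orbit[OF x(1)])
  also have "\<dots> = ennreal (d a powr (1 - l))"
  proof (rule lim_imp_Liminf[OF sequentially_bot])
    have "(\<lambda>n. d (x n) powr (1 - l)) \<longlonglongrightarrow> d a powr (1 - l)"
      using continuous_on_tendsto_compose[OF weight_continuous x(2) a] x\<Omega> by auto
    then show "(\<lambda>n. ennreal (d (x n) powr (1 - l))) \<longlonglongrightarrow> ennreal (d a powr (1 - l))" by (rule tendsto_ennrealI)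
  qed
  finally show ?thesis .
qed

text \<open>
  The function \<open>K(\<cdot>, a)\<close> to the power \<open>1 - l\<close>. With the
  evaluation bound this says that \<open>d a powr (1 - l)\<close> is the squared norm of the
  point evaluation at \<open>a\<close>.
\<close>

lemma peak_function:
  assumes a: "a \<in> \<Omega>"
  obtains f where "f \<in> W.A2" "norm (f a) = d a powr (1 - l)" "(W.A2_norm f)\<^sup>2 \<le> d a powr (1 - l)"
proof -
  obtain F where F: "holomorphic_fun \<Omega> F" "\<And>z. z \<in> \<Omega> \<Longrightarrow> cmod (F z) = cmod (K z a) powr (1 - l)"
    using kernel_power[OF a] by blast
  define f where "f = (\<lambda>z. if z \<in> \<Omega> then F z else 0)"
  have le: "(\<integral>\<^sup>+ z. ennreal ((norm (f z))\<^sup>2) \<partial>M) \<le> ennreal (d a powr (1 - l))"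
  proof -
    have "(\<integral>\<^sup>+ z. ennreal ((norm (f z))\<^sup>2) \<partial>M) = (\<integral>\<^sup>+ z. ennreal ((cmod (K z a) powr (1 - l))\<^sup>2) \<partial>M)"
      by (intro nn_integral_cong) (simp add: space_M f_def F(2))
    then show ?thesis using kernel_power_integral_le[OF a] by simp
  qed
  have f: "f \<in> W.A2"
  proof (rule W.A2I)
    show "holomorphic_fun \<Omega> f" by (rule holomorphic_fun_cong[OF F(1) open_\<Omega>]) (simp add: f_def)
    show "(\<integral>\<^sup>+ z. ennreal ((norm (f z))\<^sup>2) \<partial>M) < \<infinity>" using le by (rule le_less_trans) simp
  qed (simp add: f_def)
  show thesis
  proof (rule that[OF f])
    show "norm (f a) = d a powr (1 - l)"
      using a diag_pos[OF a] by (simp add: f_def F(2) kernel_diag)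
    show "(W.A2_norm f)\<^sup>2 \<le> d a powr (1 - l)"
      using le unfolding W.A2_nn_norm[OF f] by (simp add: ennreal_le_iff)
  qed
qed

end

section \<open>Integrability for Schatten class weighted composition operators\<close>

text \<open>
  Jensen's inequality after division by the total weight \<open>\<beta>\<close>; the powers of
  \<open>\<beta>\<close> that this introduces are harmless since \<open>\<beta> \<le>
  1\<close> and \<open>q \<ge> 1\<close>.
\<close>

lemma weighted_sum_powr_le:
  fixes s b :: "'i \<Rightarrow> real"
  assumes I: "finite I" and q: "1 \<le> q" and s: "\<And>i. i \<in> I \<Longrightarrow> 0 < s i" and b: "\<And>i. i \<in> I \<Longrightarrow> 0 \<le> b i"
    and le: "(\<Sum>i\<in>I. b i) \<le> 1"
  shows "(\<Sum>i\<in>I. s i * b i) powr q \<le> (\<Sum>i\<in>I. s i powr q * b i)"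
proof -
  define \<beta> where "\<beta> = (\<Sum>i\<in>I. b i)"
  have \<beta>0: "0 \<le> \<beta>" unfolding \<beta>_def by (rule sum_nonneg[OF b])
  show ?thesis
  proof (cases "\<beta> = 0")
    case True
    then have "b i = 0" if "i \<in> I" for i using sum_nonneg_eq_0_iff[OF I, of b] b that by (simp add: \<beta>_def)
    then show ?thesis using q by simp
  next
    case False
    then have \<beta>: "0 < \<beta>" using \<beta>0 by simp
    have ne: "I \<noteq> {}" using False by (auto simp: \<beta>_def)
    have "(\<Sum>i\<in>I. (b i / \<beta>) *\<^sub>R s i) powr q \<le> (\<Sum>i\<in>I. b i / \<beta> * s i powr q)"
      using s b \<beta> by (intro convex_on_sum[OF I ne powr_convex[OF q]]) (auto simp: \<beta>_def simp flip: sum_divide_distrib)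
    moreover have "(\<Sum>i\<in>I. s i * b i) = \<beta> * (\<Sum>i\<in>I. (b i / \<beta>) *\<^sub>R s i)"
      using \<beta> by (simp add: sum_distrib_left mult.commute)
    moreover have "0 \<le> (\<Sum>i\<in>I. (b i / \<beta>) *\<^sub>R s i)" using s b \<beta> by (intro sum_nonneg) (simp add: less_imp_le)
    ultimately have "(\<Sum>i\<in>I. s i * b i) powr q \<le> \<beta> powr q * (\<Sum>i\<in>I. b i / \<beta> * s i powr q)"
      using \<beta> by (simp add: powr_mult mult_left_mono)
    also have "\<beta> powr q \<le> \<beta> powr 1" using \<beta> le q by (intro powr_mono') (auto simp: \<beta>_def)
    then have "\<beta> powr q * (\<Sum>i\<in>I. b i / \<beta> * s i powr q) \<le> \<beta> * (\<Sum>i\<in>I. b i / \<beta> * s i powr q)"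
      using b \<beta> by (intro mult_right_mono sum_nonneg) auto
    also have "\<dots> = (\<Sum>i\<in>I. s i powr q * b i)"
      using \<beta> by (simp add: sum_distrib_left mult.commute)
    finally show ?thesis .
  qed
qed

lemma norm_sum_mult_le:
  fixes c f :: "'i \<Rightarrow> complex"
  shows "norm (\<Sum>i\<in>I. c i * f i) \<le> sqrt (\<Sum>i\<in>I. (norm (c i))\<^sup>2) * sqrt (\<Sum>i\<in>I. (norm (f i))\<^sup>2)"
proof -
  have "norm (\<Sum>i\<in>I. c i * f i) \<le> (\<Sum>i\<in>I. \<bar>norm (c i)\<bar> * \<bar>norm (f i)\<bar>)"
    using norm_sum[of "\<lambda>i. c i * f i" I] by (simp add: norm_mult)
  also have "\<dots> \<le> L2_set (\<lambda>i. norm (c i)) I * L2_set (\<lambda>i. norm (f i)) I" by (rule L2_set_mult_ineq)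
  finally show ?thesis by (simp add: L2_set_def)
qed

context weighted_symmetric_domain
begin

text \<open>
  Expand the peak function at \<open>a\<close> in the basis, evaluate at \<open>a\<close> and
  apply the Cauchy-Schwarz inequality to the coefficients and the values of the basis
  functions.
\<close>

lemma diag_le_basis_sum:
  assumes E: "orthonormal_basis W.A2 (L2_inner M) E" and a: "a \<in> \<Omega>" and \<epsilon>: "\<epsilon> > 0"
  obtains I where "finite I" "I \<subseteq> E" "d a powr ((1 - l) / 2) \<le> \<epsilon> + sqrt (\<Sum>e\<in>I. (norm (e a))\<^sup>2)"
proof -
  obtain f where f: "f \<in> W.A2" "norm (f a) = d a powr (1 - l)" "(W.A2_norm f)\<^sup>2 \<le> d a powr (1 - l)"
    using peak_function[OF a] by blast
  define D where "D = d a powr ((1 - l) / 2)"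
  have D: "D > 0" using diag_pos[OF a] by (simp add: D_def)
  have "D\<^sup>2 = (d a powr ((1 - l) / 2)) powr 2" using D by (simp add: D_def)
  moreover have "(1 - l) / 2 * 2 = 1 - l" by (simp add: field_simps)
  ultimately have D2: "d a powr (1 - l) = D\<^sup>2" by (simp only: powr_powr)
  obtain I where I: "finite I" "I \<subseteq> E" and err: "W.A2_norm (\<lambda>x. f x - (\<Sum>e\<in>I. L2_inner M f e * e x)) < \<epsilon>"
    by (rule W.orthonormal_basis_approx[OF E f(1) \<epsilon>])
  let ?s = "\<lambda>x. \<Sum>e\<in>I. L2_inner M f e * e x"
  have EH: "e \<in> W.A2" if "e \<in> I" for e using that I E unfolding orthonormal_basis_def by blast
  have s: "?s \<in> W.A2" using I EH by (intro W.sum_mem[of I "\<lambda>e. e"])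
  have fD: "W.A2_norm f \<le> D"
    by (rule power2_le_imp_le) (use f(3) D2 D in auto)
  have "D\<^sup>2 \<le> norm (f a - ?s a) + norm (?s a)"
    using f(2) norm_triangle_ineq[of "f a - ?s a" "?s a"] by (simp add: D2)
  also have "norm (f a - ?s a) \<le> D * \<epsilon>"
  proof (rule power2_le_imp_le)
    have "(norm (f a - ?s a))\<^sup>2 \<le> D\<^sup>2 * (W.A2_norm (\<lambda>x. f x - ?s x))\<^sup>2"
      using weighted_evaluation[OF W.diff_mem[OF f(1) s] a] by (simp add: D2)
    also have "\<dots> \<le> D\<^sup>2 * \<epsilon>\<^sup>2"
      using err W.A2_norm_nonneg by (intro mult_left_mono power_mono) auto
    finally show "(norm (f a - ?s a))\<^sup>2 \<le> (D * \<epsilon>)\<^sup>2" by (simp add: power_mult_distrib)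
  qed (use D \<epsilon> in simp)
  also have "norm (?s a) \<le> sqrt (\<Sum>e\<in>I. (norm (L2_inner M f e))\<^sup>2) * sqrt (\<Sum>e\<in>I. (norm (e a))\<^sup>2)"
    by (rule norm_sum_mult_le)
  also have "\<dots> \<le> D * sqrt (\<Sum>e\<in>I. (norm (e a))\<^sup>2)"
  proof (rule mult_right_mono)
    have "sqrt (\<Sum>e\<in>I. (norm (L2_inner M f e))\<^sup>2) \<le> sqrt ((W.A2_norm f)\<^sup>2)"
      by (rule real_sqrt_le_mono[OF W.Bessel_inequality[OF E I f(1)]])
    then show "sqrt (\<Sum>e\<in>I. (norm (L2_inner M f e))\<^sup>2) \<le> D" using fD W.A2_norm_nonneg[of f] by simp
  qed (simp add: sum_nonneg)
  finally have "D * D \<le> D * (\<epsilon> + sqrt (\<Sum>e\<in>I. (norm (e a))\<^sup>2))"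
    by (simp add: power2_eq_square algebra_simps)
  then have "D \<le> \<epsilon> + sqrt (\<Sum>e\<in>I. (norm (e a))\<^sup>2)" using D by simp
  then show thesis using that[OF I] by (simp add: D_def)
qed

text \<open>
  Apply the evaluation bound to the combination of the \<open>f i\<close> with coefficients
  \<open>cnj (f i a) / s i\<close>: both its value at \<open>a\<close> and its squared norm
  are equal to the sum \<open>S\<close> in question, so \<open>S\<^sup>2 \<le> d a powr (1 -
  l) * S\<close>.
\<close>

lemma orthogonal_evaluation_sum:
  assumes I: "finite I" and f: "\<And>i. i \<in> I \<Longrightarrow> f i \<in> W.A2" and s: "\<And>i. i \<in> I \<Longrightarrow> 0 < s i"
    and ortho: "\<And>i j. i \<in> I \<Longrightarrow> j \<in> I \<Longrightarrow> L2_inner M (f i) (f j) = (if i = j then of_real (s i) else 0)"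
    and a: "a \<in> \<Omega>"
  shows "(\<Sum>i\<in>I. (norm (f i a))\<^sup>2 / s i) \<le> d a powr (1 - l)"
proof -
  define S where "S = (\<Sum>i\<in>I. (norm (f i a))\<^sup>2 / s i)"
  define c where "c = (\<lambda>i. cnj (f i a) / of_real (s i))"
  have S0: "S \<ge> 0" unfolding S_def using s by (intro sum_nonneg) (simp add: less_imp_le)
  let ?F = "\<lambda>x. \<Sum>i\<in>I. c i * f i x"
  have F: "?F \<in> W.A2" by (rule W.sum_mem[OF I f])
  have "(W.A2_norm ?F)\<^sup>2 = (\<Sum>i\<in>I. (norm (c i))\<^sup>2 * s i)"
    by (rule W.orthogonal_sum_norm[OF I f ortho])
  also have "\<dots> = S" unfolding S_def
  proof (rule sum.cong[OF refl])
    fix i assume "i \<in> I"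
    then have "s i > 0" by (rule s)
    then show "(norm (c i))\<^sup>2 * s i = (norm (f i a))\<^sup>2 / s i"
      by (simp add: c_def norm_divide power_divide power2_eq_square)
  qed
  finally have normF: "(W.A2_norm ?F)\<^sup>2 = S" .
  have "?F a = (\<Sum>i\<in>I. of_real ((norm (f i a))\<^sup>2 / s i))"
  proof (rule sum.cong[OF refl])
    fix i
    show "c i * f i a = of_real ((norm (f i a))\<^sup>2 / s i)"
      unfolding of_real_divide complex_norm_square by (simp add: c_def mult.commute)
  qed
  then have Fa: "?F a = of_real S" by (simp only: S_def of_real_sum)
  have "S\<^sup>2 \<le> d a powr (1 - l) * S"
    using weighted_evaluation[OF F a] S0 unfolding normF Fa by simp
  then show ?thesis
    using S0 unfolding S_def[symmetric] by (cases "S = 0") (simp_all add: power2_eq_square)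
qed

text \<open>
  The integrand is bounded pointwise by the series of the functions \<open>t e\<close>, and
  each \<open>t e\<close> has integral \<open>C * s e powr (p / 2)\<close> with respect to the
  invariant measure.
\<close>

lemma schatten_class_weighted_composition_integral:
  assumes p: "2 \<le> p" and \<phi>: "\<phi> ` \<Omega> \<subseteq> \<Omega>"
    and sch: "schatten_class W.A2 (L2_inner M) p (weighted_composition \<Omega> \<phi> \<psi>)"
  shows "(\<integral>\<^sup>+ z. ennreal (norm (\<psi> z) powr p * (d (\<phi> z) / d z) powr (p * (1 - l) / 2)) \<partial>invariant_measure \<Omega>) < \<infinity>"
proof -
  define T where "T = weighted_composition \<Omega> \<phi> \<psi>"
  define m where "m = 1 - l"
  define q where "q = p / 2"
  have q: "q \<ge> 1" using p by (simp add: q_def)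
  obtain E s B where E: "orthonormal_basis W.A2 (L2_inner M) E" and s: "\<And>e. e \<in> E \<Longrightarrow> 0 \<le> s e"
    and ortho: "\<And>e e'. e \<in> E \<Longrightarrow> e' \<in> E \<Longrightarrow> L2_inner M (T e) (T e') = (if e = e' then of_real (s e) else 0)"
    and B: "\<And>I. finite I \<Longrightarrow> I \<subseteq> E \<Longrightarrow> (\<Sum>e\<in>I. s e powr q) \<le> B"
  proof (rule W.schatten_class_singular_values[OF sch])
    fix E s B
    assume "orthonormal_basis W.A2 (L2_inner M) E" "\<And>e. e \<in> E \<Longrightarrow> 0 \<le> s e"
      "\<And>e e'. e \<in> E \<Longrightarrow> e' \<in> E \<Longrightarrow> L2_inner M (weighted_composition \<Omega> \<phi> \<psi> e) (weighted_composition \<Omega> \<phi> \<psi> e')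
        = (if e = e' then of_real (s e) else 0)"
      "\<And>I. finite I \<Longrightarrow> I \<subseteq> E \<Longrightarrow> (\<Sum>e\<in>I. s e powr (p / 2)) \<le> B"
    then show thesis using that[of E s B] unfolding T_def q_def by presburger
  qed
  have T_apply: "T f z = \<psi> z * f (\<phi> z)" if "z \<in> \<Omega>" for f z using that by (simp add: T_def weighted_composition_def)
  have EH: "e \<in> W.A2" if "e \<in> E" for e using that E unfolding orthonormal_basis_def by blast
  have TH: "T e \<in> W.A2" if "e \<in> E" for e
    using sch EH[OF that] unfolding T_def schatten_class_def compact_op_def linear_op_def by blast
  \<comment> \<open>Only the basis vectors with a nonzero singular value contribute, and summability makes
    them countable; this allows integrating the series term by term.\<close>
  define E' where "E' = {e \<in> E. s e powr q \<noteq> 0}"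
  have sE': "s e > 0" if "e \<in> E'" for e using that s[of e] by (auto simp: E'_def)
  have E'E: "E' \<subseteq> E" by (auto simp: E'_def)
  have T0: "T e z = 0" if e: "e \<in> E" "e \<notin> E'" for e z
  proof -
    have "s e = 0" using e by (simp add: E'_def)
    then have "L2_inner M (T e) (T e) = 0" using ortho[OF e(1) e(1)] by simp
    then have "T e = (\<lambda>x. 0)" using W.ip_definite[OF TH[OF e(1)]] by simp
    then show ?thesis by simp
  qed
  have "countable E'"
  proof -
    have "(\<lambda>e. s e powr q) summable_on E"
      by (rule nonneg_bdd_above_summable_on) (auto intro!: bdd_aboveI[of _ B] B)
    then show ?thesis unfolding E'_def by (rule summable_countable_real)
  qed
  \<comment> \<open>The weights \<open>\<bar>T e z\<bar>\<^sup>2 / (s e * d z powr m)\<close> have total at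
    most 1, so Jensen's inequality will apply to the exponent \<open>q = p / 2\<close>.\<close>
  define t where "t = (\<lambda>e z. s e powr q * ((norm (T e z))\<^sup>2 / (s e * d z powr m)))"
  have t0: "t e z \<ge> 0" if "e \<in> E'" for e z using sE'[OF that] by (simp add: t_def)
  have pointwise: "norm (\<psi> z) powr p * (d (\<phi> z) / d z) powr (p * m / 2) \<le> G"
    if z: "z \<in> \<Omega>" and G: "\<And>I. finite I \<Longrightarrow> I \<subseteq> E' \<Longrightarrow> (\<Sum>e\<in>I. t e z) \<le> G" for z G
  proof -
    have \<phi>z: "\<phi> z \<in> \<Omega>" using \<phi> z by blast
    have dz: "d z > 0" "d (\<phi> z) > 0" using diag_pos z \<phi>z by auto
    have G0: "G \<ge> 0" using G[of "{}"] by simp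
    define Dz where "Dz = d z powr (m / 2)"
    have Dz: "Dz > 0" "Dz\<^sup>2 = d z powr m"
      using dz power2_powr[OF dz(1), of "m / 2"] by (simp_all add: Dz_def powr_powr flip: powr_numeral)
    define y where "y = norm (\<psi> z) * d (\<phi> z) powr (m / 2) / Dz"
    have y0: "y \<ge> 0" using Dz by (simp add: y_def)
    \<comment> \<open>The \<open>p\<close>-th root of the integrand is \<open>y\<close>. The slack
      \<open>\<delta>\<close> absorbs the error of the finite expansion of the peak function
      at \<open>\<phi> z\<close>.\<close>
    have "y \<le> G powr (1 / p) + \<delta>" if \<delta>: "\<delta> > 0" for \<delta>
    proof -
      define \<epsilon> where "\<epsilon> = \<delta> * Dz / (norm (\<psi> z) + 1)"
      have \<epsilon>: "\<epsilon> > 0" using \<delta> Dz(1) by (simp add: \<epsilon>_def add_nonneg_pos)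
      obtain I where I: "finite I" "I \<subseteq> E" "d (\<phi> z) powr ((1 - l) / 2) \<le> \<epsilon> + sqrt (\<Sum>e\<in>I. (norm (e (\<phi> z)))\<^sup>2)"
        by (rule diag_le_basis_sum[OF E \<phi>z \<epsilon>])
      define x where "x = (\<Sum>e\<in>I \<inter> E'. s e * ((norm (T e z))\<^sup>2 / (s e * d z powr m)))"
      have x: "x = (\<Sum>e\<in>I. (norm (\<psi> z * e (\<phi> z)))\<^sup>2) / Dz\<^sup>2"
      proof -
        have "x = (\<Sum>e\<in>I \<inter> E'. (norm (T e z))\<^sup>2 / Dz\<^sup>2)"
          unfolding x_def
        proof (rule sum.cong[OF refl])
          fix e assume "e \<in> I \<inter> E'"
          then have "s e > 0" using sE' by blast
          then show "s e * ((norm (T e z))\<^sup>2 / (s e * d z powr m)) = (norm (T e z))\<^sup>2 / Dz\<^sup>2"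
            by (simp add: Dz(2))
        qed
        also have "\<dots> = (\<Sum>e\<in>I. (norm (T e z))\<^sup>2 / Dz\<^sup>2)"
          using I T0 by (intro sum.mono_neutral_left) auto
        finally show ?thesis by (simp add: T_apply[OF z] sum_divide_distrib)
      qed
      have x0: "x \<ge> 0" unfolding x by (simp add: sum_nonneg)
      have "x powr q \<le> (\<Sum>e\<in>I \<inter> E'. t e z)"
        unfolding x_def t_def
      proof (rule weighted_sum_powr_le)
        show "finite (I \<inter> E')" using I by simp
        show "0 < s e" if "e \<in> I \<inter> E'" for e using sE' that by blast
        show "0 \<le> (norm (T e z))\<^sup>2 / (s e * d z powr m)" if "e \<in> I \<inter> E'" for e
          using sE'[of e] that by simp
        have "(\<Sum>e\<in>I \<inter> E'. (norm (T e z))\<^sup>2 / s e) \<le> d z powr (1 - l)"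
          using I E'E by (intro orthogonal_evaluation_sum TH sE' ortho z) auto
        then have "(\<Sum>e\<in>I \<inter> E'. (norm (T e z))\<^sup>2 / s e) / d z powr m \<le> 1" using dz by (simp add: m_def)
        then show "(\<Sum>e\<in>I \<inter> E'. (norm (T e z))\<^sup>2 / (s e * d z powr m)) \<le> 1"
          by (simp add: sum_divide_distrib)
      qed (rule q)
      also have "\<dots> \<le> G" using I by (intro G) auto
      finally have "(x powr q) powr (1 / p) \<le> G powr (1 / p)" using p by (intro powr_mono2) auto
      then have sx: "sqrt x \<le> G powr (1 / p)"
        using p x0 by (simp add: powr_powr q_def powr_half_sqrt)
      have "norm (\<psi> z) * d (\<phi> z) powr (m / 2) \<le> norm (\<psi> z) * (\<epsilon> + sqrt (\<Sum>e\<in>I. (norm (e (\<phi> z)))\<^sup>2))"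
        using I(3) by (intro mult_left_mono) (auto simp: m_def)
      also have "\<dots> = norm (\<psi> z) * \<epsilon> + sqrt (\<Sum>e\<in>I. (norm (\<psi> z * e (\<phi> z)))\<^sup>2)"
      proof -
        have "(\<Sum>e\<in>I. (norm (\<psi> z * e (\<phi> z)))\<^sup>2) = (norm (\<psi> z))\<^sup>2 * (\<Sum>e\<in>I. (norm (e (\<phi> z)))\<^sup>2)"
          by (simp add: norm_mult power_mult_distrib sum_distrib_left)
        then show ?thesis by (simp add: real_sqrt_mult algebra_simps)
      qed
      also have "sqrt (\<Sum>e\<in>I. (norm (\<psi> z * e (\<phi> z)))\<^sup>2) = sqrt x * Dz"
        unfolding x using Dz(1) by (simp add: real_sqrt_divide)
      also have "norm (\<psi> z) * \<epsilon> \<le> \<delta> * Dz"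
      proof -
        have "norm (\<psi> z) * \<epsilon> = (norm (\<psi> z) / (norm (\<psi> z) + 1)) * (\<delta> * Dz)" by (simp add: \<epsilon>_def)
        also have "\<dots> \<le> 1 * (\<delta> * Dz)"
        proof (rule mult_right_mono)
          have "norm (\<psi> z) + 1 > 0" by (simp add: add_nonneg_pos)
          then show "norm (\<psi> z) / (norm (\<psi> z) + 1) \<le> 1" by simp
        qed (use \<delta> Dz(1) in simp)
        finally show ?thesis by simp
      qed
      finally have "norm (\<psi> z) * d (\<phi> z) powr (m / 2) \<le> (\<delta> + sqrt x) * Dz" by (simp add: algebra_simps)
      then have "y \<le> \<delta> + sqrt x" using Dz(1) by (simp add: y_def pos_divide_le_eq)
      then show ?thesis using sx by simp
    qed
    then have "y \<le> G powr (1 / p)" by (rule field_le_epsilon)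
    then have "y powr p \<le> (G powr (1 / p)) powr p" using y0 p by (intro powr_mono2) auto
    also have "\<dots> = G" using p G0 by (simp add: powr_powr)
    finally have "y powr p \<le> G" .
    moreover have "y powr p = norm (\<psi> z) powr p * (d (\<phi> z) / d z) powr (p * m / 2)"
    proof -
      have "y = norm (\<psi> z) * (d (\<phi> z) / d z) powr (m / 2)"
        using dz by (simp add: y_def Dz_def powr_divide)
      then show ?thesis using dz by (simp add: powr_mult powr_powr mult.commute)
    qed
    ultimately show ?thesis by simp
  qed
  \<comment> \<open>An enumeration of \<open>E'\<close>; indices outside of its range get the value 0.\<close>
  define N where "N = to_nat_on E'"
  have injN: "inj_on N E'" using inj_on_to_nat_on[OF \<open>countable E'\<close>] by (simp add: N_def)
  define e where "e = (\<lambda>n. inv_into E' N n)"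
  have eN: "e (N x) = x" if "x \<in> E'" for x using injN that by (simp add: e_def)
  have eE': "e n \<in> E'" if "n \<in> N ` E'" for n using that by (simp add: e_def inv_into_into)
  define u where "u = (\<lambda>n z. if n \<in> N ` E' then ennreal (t (e n) z) else 0)"
  have sum_u: "(\<Sum>x\<in>I. ennreal (t x z)) \<le> (\<Sum>n. u n z)" if I: "finite I" "I \<subseteq> E'" for I z
  proof -
    have "(\<Sum>x\<in>I. ennreal (t x z)) = (\<Sum>x\<in>I. u (N x) z)"
    proof (rule sum.cong[OF refl])
      fix x assume "x \<in> I"
      then have "x \<in> E'" using I by blast
      then show "ennreal (t x z) = u (N x) z" using eN[of x] by (simp add: u_def)
    qed
    also have "\<dots> = (\<Sum>n\<in>N ` I. u n z)"
      using inj_on_subset[OF injN I(2)] by (simp add: sum.reindex)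
    also have "\<dots> \<le> (\<Sum>n. u n z)" using I by (intro sum_le_suminf) auto
    finally show ?thesis .
  qed
  have le_suminf: "ennreal (norm (\<psi> z) powr p * (d (\<phi> z) / d z) powr (p * m / 2)) \<le> (\<Sum>n. u n z)" if z: "z \<in> \<Omega>" for z
  proof (cases "(\<Sum>n. u n z)")
    case (real G)
    have "(\<Sum>x\<in>I. t x z) \<le> G" if I: "finite I" "I \<subseteq> E'" for I
    proof -
      have "ennreal (\<Sum>x\<in>I. t x z) = (\<Sum>x\<in>I. ennreal (t x z))" using t0 I by (intro sum_ennreal[symmetric]) blast
      also have "\<dots> \<le> ennreal G" using sum_u[OF I, of z] by (simp only: real)
      finally show ?thesis using real by (simp add: ennreal_le_iff)
    qed
    then show ?thesis using pointwise[OF z] real by (simp add: ennreal_leI)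
  qed simp
  have T_meas: "(\<lambda>z. T x z) \<in> borel_measurable V" if "x \<in> E'" for x
    using W.A2D(1)[OF TH] E'E that by (intro measurable_V holomorphic_fun_continuous_on) auto
  have d_meas [measurable]: "d \<in> borel_measurable V" by (rule measurable_V[OF diag_continuous])
  have u_meas [measurable]: "u n \<in> borel_measurable V" for n
  proof (cases "n \<in> N ` E'")
    case True
    note [measurable] = T_meas[OF eE'[OF True]]
    show ?thesis using True by (simp add: u_def t_def)
  qed (simp add: u_def)
  have int_u: "(\<integral>\<^sup>+ z. ennreal (d z) * u n z \<partial>V) = (if n \<in> N ` E' then ennreal (C * s (e n) powr q) else 0)" for n
  proof (cases "n \<in> N ` E'")
    case True
    define x where "x = e n"
    have x: "x \<in> E'" "x \<in> E" using eE'[OF True] E'E by (auto simp: x_def)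
    note [measurable] = T_meas[OF x(1)]
    have sx: "s x > 0" by (rule sE'[OF x(1)])
    have "(\<integral>\<^sup>+ z. ennreal (d z) * u n z \<partial>V)
        = (\<integral>\<^sup>+ z. ennreal (C * s x powr q / s x) * (ennreal (d z powr l / C) * ennreal ((norm (T x z))\<^sup>2)) \<partial>V)"
    proof (intro nn_integral_cong)
      fix z assume "z \<in> space V"
      then have dz: "d z > 0" using diag_pos by (simp add: space_V)
      have "d z powr l * d z powr m = d z" using dz by (simp add: m_def flip: powr_add)
      then have "d z / d z powr m = d z powr l" using dz by (simp add: field_simps)
      then have "d z * t x z = C * s x powr q / s x * (d z powr l / C * (norm (T x z))\<^sup>2)"
        using C_pos by (simp add: t_def flip: \<open>d z / d z powr m = d z powr l\<close>)
      then show "ennreal (d z) * u n z = ennreal (C * s x powr q / s x) * (ennreal (d z powr l / C) * ennreal ((norm (T x z))\<^sup>2))"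
        using True dz C_pos sx by (simp add: u_def x_def t0[OF eE'[OF True]] flip: ennreal_mult)
    qed
    also have "\<dots> = ennreal (C * s x powr q / s x) * (\<integral>\<^sup>+ z. ennreal (d z powr l / C) * ennreal ((norm (T x z))\<^sup>2) \<partial>V)"
      by (rule nn_integral_cmult) measurable
    also have "(\<integral>\<^sup>+ z. ennreal (d z powr l / C) * ennreal ((norm (T x z))\<^sup>2) \<partial>V) = (\<integral>\<^sup>+ z. ennreal ((norm (T x z))\<^sup>2) \<partial>M)"
      by (rule nn_integral_M[symmetric]) measurable
    also have "\<dots> = ennreal (s x)"
      unfolding W.A2_nn_norm[OF TH[OF x(2)]] W.ip_norm_sq[OF TH[OF x(2)]] using ortho[OF x(2) x(2)] by simp
    also have "ennreal (C * s x powr q / s x) * ennreal (s x) = ennreal (C * s x powr q)"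
      using sx C_pos by (simp flip: ennreal_mult)
    finally show ?thesis using True by (simp add: x_def)
  qed (simp add: u_def)
  have "(\<integral>\<^sup>+ z. ennreal (norm (\<psi> z) powr p * (d (\<phi> z) / d z) powr (p * m / 2)) \<partial>invariant_measure \<Omega>)
      \<le> (\<integral>\<^sup>+ z. (\<Sum>n. u n z) \<partial>invariant_measure \<Omega>)"
    by (rule nn_integral_mono) (simp add: invariant_measure_def space_V le_suminf)
  also have "\<dots> = (\<integral>\<^sup>+ z. ennreal (d z) * (\<Sum>n. u n z) \<partial>V)"
    unfolding invariant_measure_def by (rule nn_integral_density) measurable
  also have "\<dots> = (\<integral>\<^sup>+ z. (\<Sum>n. ennreal (d z) * u n z) \<partial>V)" by simp
  also have "\<dots> = (\<Sum>n. \<integral>\<^sup>+ z. ennreal (d z) * u n z \<partial>V)" by (rule nn_integral_suminf) measurable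
  also have "\<dots> \<le> ennreal (C * B)"
  proof (rule suminf_le_const)
    fix k
    define I where "I = e ` ({..<k} \<inter> N ` E')"
    have I: "finite I" "I \<subseteq> E" using eE' E'E by (auto simp: I_def)
    have inj: "inj_on e ({..<k} \<inter> N ` E')" using eN by (intro inj_onI) auto
    have "(\<Sum>n<k. \<integral>\<^sup>+ z. ennreal (d z) * u n z \<partial>V) = (\<Sum>n\<in>{..<k} \<inter> N ` E'. ennreal (C * s (e n) powr q))"
      unfolding int_u by (simp add: sum.inter_restrict)
    also have "\<dots> = (\<Sum>x\<in>I. ennreal (C * s x powr q))" unfolding I_def by (simp add: sum.reindex[OF inj])
    also have "\<dots> = ennreal (C * (\<Sum>x\<in>I. s x powr q))"
      using C_pos by (subst sum_ennreal) (simp_all add: sum_distrib_left)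
    also have "\<dots> \<le> ennreal (C * B)" using B[OF I] C_pos by (intro ennreal_leI mult_left_mono) auto
    finally show "(\<Sum>n<k. \<integral>\<^sup>+ z. ennreal (d z) * u n z \<partial>V) \<le> ennreal (C * B)" .
  qed simp
  also have "\<dots> < \<infinity>" by simp
  finally show ?thesis by (simp add: m_def)
qed

end

theorem theorem4p2:
  fixes \<Omega> :: "(complex ^ 'n) set"
    and \<phi> :: "complex ^ 'n \<Rightarrow> complex ^ 'n"
    and \<psi> :: "complex ^ 'n \<Rightarrow> complex"
    and p \<epsilon> l :: real
  assumes "bounded_symmetric_domain \<Omega>" and "standard_representation \<Omega>"
    and "\<epsilon> > 0"
    and "\<And>t. t < \<epsilon> \<Longrightarrow> (\<integral>\<^sup>+ z. ennreal (bergman_diag \<Omega> z powr t) \<partial>normalized_volume \<Omega>) < \<infinity>"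
    and "l < \<epsilon>"
    and "2 \<le> p"
    and "holomorphic_map \<Omega> \<phi>" and "\<phi> ` \<Omega> \<subseteq> \<Omega>" and "holomorphic_fun \<Omega> \<psi>"
    and "schatten_class (bergman_space \<Omega> (weighted_volume \<Omega> l)) (L2_inner (weighted_volume \<Omega> l)) p
           (weighted_composition \<Omega> \<phi> \<psi>)"
  shows "(\<integral>\<^sup>+ z. ennreal (norm (\<psi> z) powr p *
            (bergman_diag \<Omega> (\<phi> z) / bergman_diag \<Omega> z) powr (p * (1 - l) / 2))
          \<partial>invariant_measure \<Omega>) < \<infinity>"
proof -
  interpret weighted_symmetric_domain \<Omega> l
    using assms(1,2) assms(4)[OF assms(5)]
    unfolding bounded_symmetric_domain_def standard_representation_def by unfold_locales auto
  show ?thesis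
    using assms(6,8,10) by (rule schatten_class_weighted_composition_integral)
qed

end
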